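(* Let $1\le k<d$ be integers. (i) If $\mu\in\mathcal M(\mathbb{R}^d)$, then for all $u\in[0,k]$, $$\dim_{\mathrm H}\{V\in G(d,k):\dim_{\mathrm H}\mu_V<u\}\le\max\Big\{0,\ k(d-k)+\inf_{\theta\in(0,1]}\frac{u-\dim_{\mathrm F}^{\theta}\mu}{\theta}\Big\}.$$ (ii) If $X$ is a Borel set in $\mathbb{R}^d$, then for all $u\in[0,k]$, $$\dim_{\mathrm H}\{V\in G(d,k):\dim_{\mathrm H}P_V(X)<u\}\le\max\Big\{0,\ k(d-k)+\inf_{\theta\in(0,1]}\frac{u-\dim_{\mathrm F}^{\theta}X}{\theta}\Big\}.$$
   Context: $G(d,k)$ is the Grassmannian of $k$-dimensional linear subspaces $V$ of $\mathbb{R}^d$, with its usual metric (e.g. $\|P_V-P_W\|$), with respect to which Hausdorff dimensions of its subsets are taken. $P_V:\mathbb{R}^d\to V$ is orthogonal projection, and $V$ is identified with $\mathbb{R}^k$. $\mu_V$ is the push-forward of $\mu$ under $P_V$, i.e. $\mu_V(B)=\mu(P_V^{-1}(B))$, a measure on $\mathbb{R}^k$. $\dim_{\mathrm H}$ is Hausdorff dimension, with $\dim_{\mathrm H}\varnothing=0$; for a finite nonzero Borel measure $\nu$, $\dim_{\mathrm H}\nu=\inf\{\dim_{\mathrm H}B: B\text{ Borel},\ \nu(B)>0\}$. For $X\subseteq\mathbb{R}^d$, $\mathcal M(X)$ is the set of Borel measures $\mu$ compactly supported on $X$ with $0<\mu(X)<\infty$. The Fourier transform is $\widehat\mu(z)=\int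 e^{-2\pi i z\cdot x}\,d\mu(x)$. For $\mu\in\mathcal M(\mathbb{R}^d)$ and $\theta\in(0,1]$ put $$\mathcal J_{s,\theta}(\mu)=\Big(\int_{\mathbb{R}^d}|\widehat\mu(z)|^{2/\theta}|z|^{s/\theta-d}\,dz\Big)^{\theta}.$$ The Fourier spectrum of $\mu$ at $\theta$ is $\dim_{\mathrm F}^{\theta}\mu=\sup\{s\in\mathbb{R}:\mathcal J_{s,\theta}(\mu)<\infty\}$ (possibly $+\infty$), and of a Borel set $X\subseteq\mathbb{R}^d$ it is $\dim_{\mathrm F}^{\theta}X=\sup\{\min\{\dim_{\mathrm F}^{\theta}\mu,d\}:\mu\in\mathcal M(X)\}$ (suprema over empty sets are $0$). *)

theory Defs
  imports "HOL-Analysis.Analysis"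
begin

section \<open>Hausdorff dimension\<close>

text \<open>
  The metric is an explicit parameter \<open>\<rho>\<close>, so that the same definition serves for Euclidean space
  (\<open>\<rho> = dist\<close>) and for the Grassmannian, which is a subset of a type carrying no metric of its own.
  Covers may be taken by arbitrary subsets of the type: replacing a covering set by its intersection
  with \<open>A\<close> never increases its diameter, so only the values of \<open>\<rho>\<close> on \<open>A\<close> matter.
\<close>

definition ediam :: "('a \<Rightarrow> 'a \<Rightarrow> real) \<Rightarrow> 'a set \<Rightarrow> ennreal" where
  "ediam \<rho> U = (SUP x\<in>U. SUP y\<in>U. ennreal (\<rho> x y))"

text \<open>
  \<open>diam(U)\<^sup>s\<close> for a set of finite diameter, with the convention that the empty set contributes 0
  and that \<open>diam(U)\<^sup>0 = 1\<close> for nonempty \<open>U\<close> (recall \<open>0 powr 0 = 0\<close> in HOL).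
\<close>

definition diam_powr :: "('a \<Rightarrow> 'a \<Rightarrow> real) \<Rightarrow> real \<Rightarrow> 'a set \<Rightarrow> ennreal" where
  "diam_powr \<rho> s U =
     (if U = {} then 0 else if s = 0 then 1 else ennreal (enn2real (ediam \<rho> U) powr s))"

definition hausdorff_premeasure ::
    "('a \<Rightarrow> 'a \<Rightarrow> real) \<Rightarrow> real \<Rightarrow> real \<Rightarrow> 'a set \<Rightarrow> ennreal" where
  "hausdorff_premeasure \<rho> s \<delta> A =
     Inf {\<Sum>i. diam_powr \<rho> s (U i) |U :: nat \<Rightarrow> 'a set.
            A \<subseteq> (\<Union>i. U i) \<and> (\<forall>i. ediam \<rho> (U i) \<le> ennreal \<delta>)}"

definition hausdorff_measure :: "('a \<Rightarrow> 'a \<Rightarrow> real) \<Rightarrow> real \<Rightarrow> 'a set \<Rightarrow> ennreal" where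
  "hausdorff_measure \<rho> s A = (SUP \<delta>\<in>{0<..}. hausdorff_premeasure \<rho> s \<delta> A)"

definition hausdorff_dim :: "('a \<Rightarrow> 'a \<Rightarrow> real) \<Rightarrow> 'a set \<Rightarrow> ereal" where
  "hausdorff_dim \<rho> A = Inf {ereal s |s. 0 \<le> s \<and> hausdorff_measure \<rho> s A = 0}"

lemma hausdorff_dim_empty: "hausdorff_dim \<rho> {} = 0"
proof -
  have "hausdorff_premeasure \<rho> 0 \<delta> {} = 0" for \<delta>
  proof -
    have "hausdorff_premeasure \<rho> 0 \<delta> {} \<le> (\<Sum>i. diam_powr \<rho> 0 ((\<lambda>_::nat. {}) i))"
      unfolding hausdorff_premeasure_def
      by (rule Inf_lower) (auto simp: ediam_def bot_ennreal intro!: exI[of _ "\<lambda>_. {}"])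
    then show ?thesis by (simp add: diam_powr_def)
  qed
  then have "hausdorff_measure \<rho> 0 {} = 0"
    by (simp add: hausdorff_measure_def)
  then have "hausdorff_dim \<rho> {} \<le> 0"
    unfolding hausdorff_dim_def by (intro Inf_lower) (auto simp: zero_ereal_def)
  moreover have "0 \<le> hausdorff_dim \<rho> {}"
    unfolding hausdorff_dim_def by (rule Inf_greatest) auto
  ultimately show ?thesis by simp
qed

definition measure_hausdorff_dim :: "'a::metric_space measure \<Rightarrow> ereal" where
  "measure_hausdorff_dim \<nu> = Inf {hausdorff_dim dist B |B. B \<in> sets \<nu> \<and> emeasure \<nu> B > 0}"


section \<open>Orthogonal projections and the Grassmannian\<close>

definition orth_proj :: "'a::euclidean_space set \<Rightarrow> 'a \<Rightarrow> 'a" where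
  "orth_proj V x = (THE y. y \<in> V \<and> (\<forall>w\<in>V. orthogonal (x - y) w))"

lemma orth_proj_unique:
  assumes "subspace V" "y \<in> V" "\<forall>w\<in>V. orthogonal (x - y) w"
  shows "orth_proj V x = y"
  unfolding orth_proj_def
proof (rule the_equality)
  fix z assume z: "z \<in> V \<and> (\<forall>w\<in>V. orthogonal (x - z) w)"
  then have "y - z \<in> V" using assms by (simp add: subspace_diff)
  then have "(x - z) \<bullet> (y - z) = 0" "(x - y) \<bullet> (y - z) = 0"
    using z assms(3) by (auto simp: orthogonal_def)
  then have "(y - z) \<bullet> (y - z) = 0"
    by (simp add: inner_diff_left)
  then show "z = y" by simp
qed (use assms in auto)

lemma orth_proj:
  assumes "subspace V"
  shows orth_proj_in: "orth_proj V x \<in> V"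
    and orth_proj_orthogonal: "w \<in> V \<Longrightarrow> orthogonal (x - orth_proj V x) w"
proof -
  obtain y z where yz: "y \<in> span V" "\<And>w. w \<in> span V \<Longrightarrow> orthogonal z w" "x = y + z"
    using orthogonal_subspace_decomp_exists by metis
  have sp: "span V = V" using assms by simp
  have "x - y = z" using yz(3) by simp
  then have y: "y \<in> V" "\<forall>w\<in>V. orthogonal (x - y) w"
    using yz(1,2) unfolding sp by auto
  then have "orth_proj V x = y" using assms by (intro orth_proj_unique) auto
  with y show "orth_proj V x \<in> V" "w \<in> V \<Longrightarrow> orthogonal (x - orth_proj V x) w" by auto
qed

lemma linear_orth_proj:
  assumes V: "subspace V"
  shows "linear (orth_proj V)"
proof (rule linearI)
  fix x y :: 'a and c :: real
  have o: "(v - orth_proj V v) \<bullet> w = 0" if "w \<in> V" for v w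
    using orth_proj_orthogonal[OF V that] by (simp add: orthogonal_def)
  have "(x + y - (orth_proj V x + orth_proj V y)) \<bullet> w = 0" if "w \<in> V" for w
    using o[OF that, of x] o[OF that, of y] by (simp add: inner_diff_left inner_add_left)
  then show "orth_proj V (x + y) = orth_proj V x + orth_proj V y"
    by (intro orth_proj_unique[OF V] subspace_add[OF V] orth_proj_in[OF V])
      (simp add: orthogonal_def)
  have "(c *\<^sub>R x - c *\<^sub>R orth_proj V x) \<bullet> w = 0" if "w \<in> V" for w
    using o[OF that, of x] by (simp add: inner_diff_left)
  then show "orth_proj V (c *\<^sub>R x) = c *\<^sub>R orth_proj V x"
    by (intro orth_proj_unique[OF V] subspace_scale[OF V] orth_proj_in[OF V])
      (simp add: orthogonal_def)
qed

lemma bounded_linear_orth_proj: "subspace V \<Longrightarrow> bounded_linear (orth_proj V)"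
  using linear_orth_proj linear_conv_bounded_linear by blast

lemma measurable_orth_proj:
  assumes "subspace V"
  shows "orth_proj V \<in> borel \<rightarrow>\<^sub>M restrict_space borel V"
proof (rule measurable_restrict_space2)
  show "orth_proj V \<in> borel_measurable borel"
    by (intro borel_measurable_continuous_onI linear_continuous_on bounded_linear_orth_proj assms)
  show "orth_proj V \<in> space borel \<rightarrow> V"
    using orth_proj_in[OF assms] by blast
qed

lemma range_orth_proj:
  assumes "subspace V"
  shows "range (orth_proj V) = V"
proof -
  have "orth_proj V v = v" if "v \<in> V" for v
    by (rule orth_proj_unique[OF assms that]) (simp add: orthogonal_def)
  then have "V \<subseteq> range (orth_proj V)" by (metis rangeI subsetI)
  moreover have "range (orth_proj V) \<subseteq> V" using orth_proj_in[OF assms] by blast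
  ultimately show ?thesis by blast
qed

definition grassmannian :: "nat \<Rightarrow> 'a::euclidean_space set set" where
  "grassmannian k = {V. subspace V \<and> dim V = k}"

definition grassmann_dist :: "'a::euclidean_space set \<Rightarrow> 'a set \<Rightarrow> real" where
  "grassmann_dist V W = onorm (\<lambda>x. orth_proj V x - orth_proj W x)"

lemma grassmann_dist_metric:
  assumes "V \<in> grassmannian k" "W \<in> grassmannian k" "Z \<in> grassmannian k"
  shows "0 \<le> grassmann_dist V W"
    and "grassmann_dist V W = grassmann_dist W V"
    and "grassmann_dist V W = 0 \<longleftrightarrow> V = W"
    and "grassmann_dist V Z \<le> grassmann_dist V W + grassmann_dist W Z"
proof -
  have bl: "bounded_linear (\<lambda>x. orth_proj A x - orth_proj B x)"
    if "A \<in> grassmannian k" "B \<in> grassmannian k" for A B :: "'a set"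
    using that by (intro bounded_linear_sub bounded_linear_orth_proj) (auto simp: grassmannian_def)
  show "0 \<le> grassmann_dist V W"
    unfolding grassmann_dist_def using bl assms by (intro onorm_pos_le) auto
  show "grassmann_dist V W = grassmann_dist W V"
    unfolding grassmann_dist_def onorm_def by (simp add: norm_minus_commute)
  show "grassmann_dist V W = 0 \<longleftrightarrow> V = W"
  proof
    assume "grassmann_dist V W = 0"
    then have "orth_proj V = orth_proj W"
      unfolding grassmann_dist_def using onorm_eq_0[OF bl] assms by (auto simp: fun_eq_iff)
    then show "V = W"
      using assms(1,2) range_orth_proj unfolding grassmannian_def by (metis mem_Collect_eq)
  qed (simp add: grassmann_dist_def onorm_zero)
  show "grassmann_dist V Z \<le> grassmann_dist V W + grassmann_dist W Z"
    unfolding grassmann_dist_def using assms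
      onorm_triangle[OF bl[of V W] bl[of W Z]] by simp
qed

text \<open>
  The projected measure \<open>\<mu>\<^sub>V\<close>, as a Borel measure on \<open>V\<close> with the metric inherited from the ambient
  space. An isometric identification of \<open>V\<close> with \<open>\<real>\<^sup>k\<close> does not affect Hausdorff dimensions.
\<close>

definition proj_measure :: "'a::euclidean_space set \<Rightarrow> 'a measure \<Rightarrow> 'a measure" where
  "proj_measure V \<mu> = distr \<mu> (restrict_space borel V) (orth_proj V)"


section \<open>Measures and the Fourier spectrum\<close>

definition msupport :: "'a::topological_space measure \<Rightarrow> 'a set" where
  "msupport \<mu> = \<Inter>{F. closed F \<and> emeasure \<mu> (- F) = 0}"

definition compact_measures :: "'a::euclidean_space set \<Rightarrow> 'a measure set" where
  "compact_measures X =
     {\<mu>. sets \<mu> = sets borel \<and> compact (msupport \<mu>) \<and> msupport \<mu> \<subseteq> X \<and>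
         0 < emeasure \<mu> X \<and> emeasure \<mu> X < \<infinity>}"

definition fourier :: "'a::euclidean_space measure \<Rightarrow> 'a \<Rightarrow> complex" where
  "fourier \<mu> z = (LINT x|\<mu>. exp (- 2 * of_real pi * \<i> * of_real (z \<bullet> x)))"

definition ennreal_powr :: "ennreal \<Rightarrow> real \<Rightarrow> ennreal" where
  "ennreal_powr a p = (if a = \<infinity> then \<infinity> else ennreal (enn2real a powr p))"

definition energy :: "real \<Rightarrow> real \<Rightarrow> 'a::euclidean_space measure \<Rightarrow> ennreal" where
  "energy s \<theta> \<mu> =
     ennreal_powr
       (\<integral>\<^sup>+ z. ennreal (norm (fourier \<mu> z) powr (2 / \<theta>) * norm z powr (s / \<theta> - DIM('a))) \<partial>lborel) \<theta>"

text \<open>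
  Suprema over empty sets are 0. This matters: the set of admissible \<open>s\<close> in \<open>fourier_spectrum\<close> is
  empty, for instance, when \<open>\<mu>\<close> is a point mass, whereas \<open>Sup {} = - \<infinity>\<close> in \<open>ereal\<close>.
\<close>

definition Sup0 :: "ereal set \<Rightarrow> ereal" where
  "Sup0 A = (if A = {} then 0 else Sup A)"

definition fourier_spectrum :: "real \<Rightarrow> 'a::euclidean_space measure \<Rightarrow> ereal" where
  "fourier_spectrum \<theta> \<mu> = Sup0 {ereal s |s. energy s \<theta> \<mu> < \<infinity>}"

definition fourier_spectrum_set :: "real \<Rightarrow> 'a::euclidean_space set \<Rightarrow> ereal" where
  "fourier_spectrum_set \<theta> X =
     Sup0 {min (fourier_spectrum \<theta> \<mu>) (ereal DIM('a)) |\<mu>. \<mu> \<in> compact_measures X}"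

end

theory Submission
  imports Defs "HOL-Probability.Probability"
begin

text \<open>
  No Frostman measure on the set of exceptional planes is needed; the set is covered by hand. Fix
  \<open>\<theta>\<close> and \<open>s\<close> with \<open>energy s \<theta> \<mu>\<close> finite and let \<open>A n\<close> be the dyadic annulus \<open>|z| \<approx> 2^n\<close>. Call \<open>V\<close>
  bad at scale \<open>n\<close> if the energy of the Fourier transform of \<open>\<mu>\<close> on the part of \<open>A n\<close> at bounded
  distance from \<open>V\<close> (a Gaussian weight \<open>tube V\<close>) exceeds \<open>2^(n (k - u))\<close>.

  If \<open>V\<close> is bad for only finitely many \<open>n\<close>, a Gaussian form of Plancherel's theorem bounds the average
  \<open>\<mu>\<^sub>V\<close>-mass of a ball of radius \<open>r\<close> by \<open>r^w\<close> for every \<open>w < u\<close>, and the mass distribution principle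
  gives \<open>dim \<mu>\<^sub>V \<ge> u\<close>.

  Conversely, in a chart writing planes as graphs of matrices, cut the matrices into cells of side
  \<open>2^-n\<close>. The tube weight changes by a bounded factor within a cell, and a given \<open>z\<close> in \<open>A n\<close> sees
  only about \<open>2^(n (k-1) (d-k))\<close> cells, the dimension of the planes through a given line being
  \<open>(k-1) (d-k)\<close>. Integrating against the \<open>2/\<theta>\<close>-th power of the Fourier transform shows that about
  \<open>2^(n (k (d-k) + (u-s)/\<theta>))\<close> cells contain a plane that is bad at scale \<open>n\<close>. Summing over \<open>n\<close>, the
  planes that are bad infinitely often have measure zero in every dimension above the exponent.
\<close>

section \<open>Hausdorff measure\<close>

text \<open>The exponent arises as follows. At scale n a bad plane has mean square of the Fourier
  transform above a multiple of 2^(-n u) on a tube of volume about 2^(n k). Since 2/\<theta> >= 2,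
  convexity forces a 2/\<theta>-mass of at least about 2^(n (k - u/\<theta>)) on that tube, whereas
  finite energy allows only about 2^(n (d - s/\<theta>)) on the whole annulus. With the overlap 2^(n
  (k-1) (d-k)) of the tubes, double counting gives (k-1) (d-k) + d - s/\<theta> - k + u/\<theta> = k
  (d-k) + (u-s)/\<theta>.

  The weights are Gaussians because their transforms are again positive Gaussians: the passage
  between close projections in space and energy near a plane in frequency is then an exact identity.

  The counting says nothing at a \<theta> for which no s has finite energy. There the spectrum is 0
  by convention, and the bound rests on the dimension k (d-k) of the whole Grassmannian, obtained
  from the same covers by calling every plane bad.\<close>

lemma ediam_le:
  assumes "\<And>x y. x \<in> U \<Longrightarrow> y \<in> U \<Longrightarrow> \<rho> x y \<le> \<delta>"
  shows "ediam \<rho> U \<le> ennreal \<delta>"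
  unfolding ediam_def using assms by (intro SUP_least ennreal_leI) auto

lemma diam_powr_le:
  assumes "\<And>x y. x \<in> U \<Longrightarrow> y \<in> U \<Longrightarrow> \<rho> x y \<le> \<delta>" "0 \<le> \<delta>" "0 < t"
  shows "diam_powr \<rho> t U \<le> ennreal (\<delta> powr t)"
proof -
  have "enn2real (ediam \<rho> U) \<le> \<delta>"
    using ediam_le[of U \<rho> \<delta>] assms by (intro enn2real_leI) auto
  then show ?thesis
    using assms by (auto simp: diam_powr_def intro!: ennreal_leI powr_mono2)
qed

lemma diam_powr_empty [simp]: "diam_powr \<rho> s {} = 0"
  by (simp add: diam_powr_def)

lemma ediam_empty [simp]: "ediam \<rho> {} = 0"
  by (simp add: ediam_def bot_ennreal)

lemma hausdorff_measure_zeroI: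
  assumes "\<And>\<delta> \<epsilon>. 0 < \<delta> \<Longrightarrow> 0 < \<epsilon> \<Longrightarrow> \<exists>U :: nat \<Rightarrow> 'a set. A \<subseteq> (\<Union>i. U i) \<and>
     (\<forall>i. ediam \<rho> (U i) \<le> ennreal \<delta>) \<and> (\<Sum>i. diam_powr \<rho> s (U i)) \<le> ennreal \<epsilon>"
  shows "hausdorff_measure \<rho> s A = 0"
proof -
  have "hausdorff_premeasure \<rho> s \<delta> A = 0" if "\<delta> > 0" for \<delta>
  proof -
    have "hausdorff_premeasure \<rho> s \<delta> A \<le> 0 + ennreal \<epsilon>" if \<epsilon>: "\<epsilon> > 0" for \<epsilon>
    proof -
      from assms[OF \<open>\<delta> > 0\<close> \<epsilon>] obtain U where U: "A \<subseteq> (\<Union>i. U i)"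
        "\<forall>i. ediam \<rho> (U i) \<le> ennreal \<delta>" "(\<Sum>i. diam_powr \<rho> s (U i)) \<le> ennreal \<epsilon>"
        by (elim exE conjE) (rule that)
      have "hausdorff_premeasure \<rho> s \<delta> A \<le> (\<Sum>i. diam_powr \<rho> s (U i))"
        unfolding hausdorff_premeasure_def using U(1,2) by (intro Inf_lower CollectI exI[of _ U] conjI refl)
      also note U(3)
      finally show ?thesis by simp
    qed
    then have "hausdorff_premeasure \<rho> s \<delta> A \<le> 0" by (rule ennreal_le_epsilon)
    then show ?thesis by simp
  qed
  then show ?thesis by (simp add: hausdorff_measure_def)
qed

lemma hausdorff_measure_zeroD:
  assumes "hausdorff_measure \<rho> s A = 0" "0 < \<delta>" "0 < \<epsilon>"
  shows "\<exists>U :: nat \<Rightarrow> 'a set. A \<subseteq> (\<Union>i. U i) \<and>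
     (\<forall>i. ediam \<rho> (U i) \<le> ennreal \<delta>) \<and> (\<Sum>i. diam_powr \<rho> s (U i)) < ennreal \<epsilon>"
proof -
  have "hausdorff_premeasure \<rho> s \<delta> A \<le> hausdorff_measure \<rho> s A"
    unfolding hausdorff_measure_def using assms by (intro SUP_upper) auto
  then have "hausdorff_premeasure \<rho> s \<delta> A < ennreal \<epsilon>"
    using assms by simp
  then show ?thesis
    unfolding hausdorff_premeasure_def Inf_less_iff by (elim bexE CollectE exE conjE) (simp, metis)
qed

lemma hausdorff_measure_mono:
  assumes "A \<subseteq> B"
  shows "hausdorff_measure \<rho> s A \<le> hausdorff_measure \<rho> s B"
  unfolding hausdorff_measure_def hausdorff_premeasure_def
  using assms by (intro SUP_mono' Inf_superset_mono) blast

lemma hausdorff_dim_mono: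
  assumes "A \<subseteq> B"
  shows "hausdorff_dim \<rho> A \<le> hausdorff_dim \<rho> B"
  unfolding hausdorff_dim_def
proof (rule Inf_superset_mono, safe)
  fix s assume "0 \<le> s" "hausdorff_measure \<rho> s B = 0"
  then show "\<exists>s'. ereal s = ereal s' \<and> 0 \<le> s' \<and> hausdorff_measure \<rho> s' A = 0"
    using hausdorff_measure_mono[OF assms, of \<rho> s] by auto
qed

lemma hausdorff_dim_le:
  "0 \<le> t \<Longrightarrow> hausdorff_measure \<rho> t A = 0 \<Longrightarrow> hausdorff_dim \<rho> A \<le> ereal t"
  unfolding hausdorff_dim_def by (intro Inf_lower) auto

lemma hausdorff_dim_nonneg: "0 \<le> hausdorff_dim \<rho> A"
  unfolding hausdorff_dim_def by (intro Inf_greatest) auto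

lemma hausdorff_measure_zero_UN:
  fixes A :: "nat \<Rightarrow> 'a set"
  assumes "\<And>n. hausdorff_measure \<rho> s (A n) = 0"
  shows "hausdorff_measure \<rho> s (\<Union>n. A n) = 0"
proof (rule hausdorff_measure_zeroI)
  fix \<delta> \<epsilon> :: real assume "0 < \<delta>" "0 < \<epsilon>"
  then have "\<forall>n. \<exists>U :: nat \<Rightarrow> 'a set. A n \<subseteq> (\<Union>i. U i) \<and>
     (\<forall>i. ediam \<rho> (U i) \<le> ennreal \<delta>) \<and> (\<Sum>i. diam_powr \<rho> s (U i)) < ennreal (\<epsilon> * (1/2)^Suc n)"
    using hausdorff_measure_zeroD[OF assms] by simp
  then obtain U :: "nat \<Rightarrow> nat \<Rightarrow> 'a set" where U: "\<And>n. A n \<subseteq> (\<Union>i. U n i)"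
     "\<And>n i. ediam \<rho> (U n i) \<le> ennreal \<delta>"
     "\<And>n. (\<Sum>i. diam_powr \<rho> s (U n i)) < ennreal (\<epsilon> * (1/2)^Suc n)"
    by metis
  define W where "W = (\<lambda>i. case_prod U (prod_decode i))"
  have "(\<Sum>i. diam_powr \<rho> s (W i)) = (\<Sum>n. \<Sum>i. diam_powr \<rho> s (U n i))"
    unfolding W_def
    by (rule suminf_ennreal_2dimen[of _ "\<lambda>p. diam_powr \<rho> s (case_prod U p)"]) simp
  also have "\<dots> \<le> (\<Sum>n. ennreal (\<epsilon> * (1/2)^Suc n))"
    using U(3) by (intro suminf_le) (auto intro: less_imp_le)
  also have "\<dots> = ennreal (\<Sum>n. \<epsilon> * (1/2)^Suc n)"
    using \<open>0 < \<epsilon>\<close> sums_mult[OF power_half_series, of \<epsilon>]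
    by (intro suminf_ennreal2) (auto simp: sums_iff)
  also have "(\<Sum>n. \<epsilon> * (1/2)^Suc n) = \<epsilon>"
    using sums_mult[OF power_half_series, of \<epsilon>] by (simp add: sums_iff)
  finally have "(\<Sum>i. diam_powr \<rho> s (W i)) \<le> ennreal \<epsilon>" .
  moreover have "(\<Union>n. A n) \<subseteq> (\<Union>i. W i)"
  proof safe
    fix x n assume "x \<in> A n"
    then obtain i where "x \<in> U n i" using U(1) by blast
    then have "x \<in> W (prod_encode (n, i))" by (simp add: W_def)
    then show "x \<in> (\<Union>i. W i)" by blast
  qed
  moreover have "ediam \<rho> (W i) \<le> ennreal \<delta>" for i
    using U(2) by (simp add: W_def split_beta)
  ultimately show "\<exists>U :: nat \<Rightarrow> 'a set. (\<Union>n. A n) \<subseteq> (\<Union>i. U i) \<and>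
     (\<forall>i. ediam \<rho> (U i) \<le> ennreal \<delta>) \<and> (\<Sum>i. diam_powr \<rho> s (U i)) \<le> ennreal \<epsilon>"
    by (intro exI[of _ W] conjI allI)
qed

text \<open>Borel-Cantelli for covers: the cells of all levels from \<open>m\<close> on cover
  \<open>A\<close>, and their total cost is at most the sum of
  \<open>C * 2 powr (n * a) * (c / 2 ^ n) powr t\<close>, the tail of a geometric series because
  \<open>a < t\<close>.\<close>

lemma hausdorff_measure_limsup_zero:
  fixes cell :: "nat \<Rightarrow> 'i \<Rightarrow> 'a set"
  assumes fin: "\<And>n. finite (Z n)"
    and diam: "\<And>n g x y. g \<in> Z n \<Longrightarrow> x \<in> cell n g \<Longrightarrow> y \<in> cell n g \<Longrightarrow> \<rho> x y \<le> c * (1/2)^n"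
    and card: "\<And>n. real (card (Z n)) \<le> C * 2 powr (real n * a)"
    and "a < t" "0 < t" "0 \<le> c"
    and cover: "\<And>x m. x \<in> A \<Longrightarrow> \<exists>n\<ge>m. \<exists>g\<in>Z n. x \<in> cell n g"
  shows "hausdorff_measure \<rho> t A = 0"
proof (rule hausdorff_measure_zeroI)
  fix \<delta> \<epsilon> :: real assume "0 < \<delta>" "0 < \<epsilon>"
  define q where "q = 2 powr (a - t)"
  have q: "0 < q" "q < 1" using \<open>a < t\<close> by (auto simp: q_def powr_less_one)
  have C0: "0 \<le> C"
  proof -
    have "0 \<le> C * 2 powr (real 0 * a)" using card[of 0] by (meson of_nat_0_le_iff order_trans)
    then show ?thesis by simp
  qed
  \<comment> \<open>\<open>K * q^m\<close> is the sum of the geometric tail that starts at level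
    \<open>m\<close>.\<close>
  define K where "K = C * c powr t / (1 - q)"
  have "(\<lambda>m. c * (1/2)^m) \<longlonglongrightarrow> c * 0" by (intro tendsto_intros LIMSEQ_power_zero) auto
  then have "\<forall>\<^sub>F m in sequentially. c * (1/2)^m < \<delta>"
    using \<open>0 < \<delta>\<close> by (auto intro: order_tendstoD)
  moreover have "(\<lambda>m. K * q^m) \<longlonglongrightarrow> K * 0" using q by (intro tendsto_intros LIMSEQ_power_zero) auto
  then have "\<forall>\<^sub>F m in sequentially. K * q^m < \<epsilon>"
    using \<open>0 < \<epsilon>\<close> by (auto intro: order_tendstoD)
  ultimately have "\<forall>\<^sub>F m in sequentially. c * (1/2)^m < \<delta> \<and> K * q^m < \<epsilon>"
    by (rule eventually_conj)
  then obtain m where m: "c * (1/2)^m < \<delta>" "K * q^m < \<epsilon>"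
    using eventually_happens by force
  have "\<exists>e. bij_betw e {..<card (Z n)} (Z n)" for n
    using ex_bij_betw_nat_finite[OF fin[of n]] by (simp add: atLeast0LessThan)
  then obtain e where e: "\<And>n. bij_betw (e n) {..<card (Z n)} (Z n)" by metis
  \<comment> \<open>Row \<open>n\<close> enumerates the cells of level \<open>m + n\<close> and is
    padded with empty sets, which cost 0.\<close>
  define U where "U n j = (if j < card (Z (m + n)) then cell (m + n) (e (m + n) j) else {})" for n j
  have eZ: "e n j \<in> Z n" if "j < card (Z n)" for n j
    using bij_betwE[OF e[of n]] that by blast
  have dU: "\<rho> x y \<le> c * (1/2)^(m+n)" if "x \<in> U n j" "y \<in> U n j" for x y n j
    using that by (auto simp: U_def intro!: diam[OF eZ] split: if_splits)
  define W where "W = (\<lambda>i. case_prod U (prod_decode i))"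
  have "(\<Sum>i. diam_powr \<rho> t (W i)) = (\<Sum>n. \<Sum>i. diam_powr \<rho> t (U n i))"
    unfolding W_def
    by (rule suminf_ennreal_2dimen[of _ "\<lambda>p. diam_powr \<rho> t (case_prod U p)"]) simp
  also have "\<dots> \<le> (\<Sum>n. ennreal (C * c powr t * q^m * q^n))"
  proof (intro suminf_le allI)
    fix n
    define v where "v = (c * (1/2)^(m+n)) powr t"
    have "(1/2::real)^(m+n) = 2 powr (- real (m+n))"
      by (simp only: powr_minus powr_realpow zero_less_numeral power_one_over inverse_eq_divide)
    then have v: "v = c powr t * 2 powr (- t * real (m + n))"
      using \<open>0 \<le> c\<close> by (simp only: v_def powr_mult powr_powr) (simp add: algebra_simps)
    have "(\<Sum>i. diam_powr \<rho> t (U n i)) = (\<Sum>i<card (Z (m+n)). diam_powr \<rho> t (U n i))"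
      by (rule suminf_finite) (auto simp: U_def)
    also have "\<dots> \<le> (\<Sum>i<card (Z (m+n)). ennreal v)"
      unfolding v_def using dU \<open>0 < t\<close> \<open>0 \<le> c\<close> by (intro sum_mono diam_powr_le) auto
    also have "\<dots> = ennreal (card (Z (m+n)) * v)"
      by (simp add: ennreal_mult'' ennreal_of_nat_eq_real_of_nat v_def)
    also have "\<dots> \<le> ennreal (C * 2 powr (real (m+n) * a) * v)"
      by (intro ennreal_leI mult_right_mono card) (auto simp: v_def)
    also have "C * 2 powr (real (m+n) * a) * v = C * c powr t * (2 powr (real (m+n) * a) * 2 powr (- t * real (m + n)))"
      by (simp add: v)
    also have "2 powr (real (m+n) * a) * 2 powr (- t * real (m + n)) = 2 powr ((a - t) * real (m+n))"
      by (simp only: powr_add[symmetric]) (simp add: algebra_simps)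
    also have "\<dots> = q ^ (m+n)"
      by (simp only: q_def powr_powr[symmetric] powr_realpow powr_gt_zero)
    finally show "(\<Sum>i. diam_powr \<rho> t (U n i)) \<le> ennreal (C * c powr t * q^m * q^n)"
      by (simp add: power_add mult.assoc)
  qed auto
  also have "\<dots> = ennreal (\<Sum>n. C * c powr t * q^m * q^n)"
    using q C0 by (intro suminf_ennreal2 summable_mult summable_geometric) auto
  also have "(\<Sum>n. C * c powr t * q^m * q^n) = K * q^m"
    using q by (subst suminf_mult) (auto simp: K_def suminf_geometric summable_geometric)
  also have "ennreal (K * q^m) \<le> ennreal \<epsilon>" using m by (intro ennreal_leI) auto
  finally have "(\<Sum>i. diam_powr \<rho> t (W i)) \<le> ennreal \<epsilon>" .
  moreover have "A \<subseteq> (\<Union>i. W i)"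
  proof
    fix x assume "x \<in> A"
    then obtain n g where n: "n \<ge> m" "g \<in> Z n" "x \<in> cell n g" using cover by blast
    then obtain j where j: "j < card (Z n)" "e n j = g" 
      using bij_betw_imp_surj_on[OF e[of n]] by (metis imageE lessThan_iff)
    then have "x \<in> W (prod_encode (n - m, j))" using n by (simp add: W_def U_def)
    then show "x \<in> (\<Union>i. W i)" by blast
  qed
  moreover have dU': "ediam \<rho> (U n j) \<le> ennreal \<delta>" for n j
  proof (rule ediam_le)
    fix x y assume "x \<in> U n j" "y \<in> U n j"
    then have "\<rho> x y \<le> c * (1/2)^(m+n)" by (rule dU)
    also have "\<dots> \<le> c * (1/2)^m" using \<open>0 \<le> c\<close> by (intro mult_left_mono power_decreasing) auto
    finally show "\<rho> x y \<le> \<delta>" using m by simp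
  qed
  moreover have "ediam \<rho> (W i) \<le> ennreal \<delta>" for i
    using dU' by (simp add: W_def split_beta)
  ultimately show "\<exists>U :: nat \<Rightarrow> 'a set. A \<subseteq> (\<Union>i. U i) \<and>
     (\<forall>i. ediam \<rho> (U i) \<le> ennreal \<delta>) \<and> (\<Sum>i. diam_powr \<rho> t (U i)) \<le> ennreal \<epsilon>"
    by (intro exI[of _ W] conjI allI)
qed

section \<open>Graph charts of the Grassmannian\<close>

text \<open>Orthonormal bases of a plane and of its orthogonal complement. Any plane can thus be the
  centre of a chart in coordinates of its own, without being moved to a standard position.\<close>

locale orthonormal_split =
  fixes B C :: "'a::euclidean_space set"
  assumes finite_B: "finite B" and finite_C: "finite C" and disjoint: "B \<inter> C = {}"
    and orthonormal: "b \<in> B \<union> C \<Longrightarrow> c \<in> B \<union> C \<Longrightarrow> b \<bullet> c = (if b = c then 1 else 0)"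
    and representation: "(\<Sum>b\<in>B. (x \<bullet> b) *\<^sub>R b) + (\<Sum>c\<in>C. (x \<bullet> c) *\<^sub>R c) = x"
begin

lemma inner_representation:
  "x \<bullet> y = (\<Sum>b\<in>B. (x \<bullet> b) * (y \<bullet> b)) + (\<Sum>c\<in>C. (x \<bullet> c) * (y \<bullet> c))"
proof -
  have "x \<bullet> y = ((\<Sum>b\<in>B. (x \<bullet> b) *\<^sub>R b) + (\<Sum>c\<in>C. (x \<bullet> c) *\<^sub>R c)) \<bullet> y"
    by (simp only: representation)
  also have "\<dots> = (\<Sum>b\<in>B. (x \<bullet> b) * (y \<bullet> b)) + (\<Sum>c\<in>C. (x \<bullet> c) * (y \<bullet> c))"
    unfolding inner_add_left inner_sum_left inner_scaleR_left by (simp add: inner_commute)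
  finally show ?thesis .
qed

lemma norm_representation:
  "(norm x)\<^sup>2 = (\<Sum>b\<in>B. (x \<bullet> b)\<^sup>2) + (\<Sum>c\<in>C. (x \<bullet> c)\<^sup>2)"
  unfolding power2_norm_eq_inner using inner_representation[of x x] by (simp add: power2_eq_square)

lemma norm_basis: "b \<in> B \<union> C \<Longrightarrow> norm b = 1"
  using orthonormal[of b b] by (simp add: norm_eq_1)

lemma inner_basis_le: "b \<in> B \<union> C \<Longrightarrow> \<bar>x \<bullet> b\<bar> \<le> norm x"
  using Cauchy_Schwarz_ineq2[of x b] norm_basis[of b] by simp

lemma inner_combination:
  assumes "S \<subseteq> B \<union> C" "c \<in> B \<union> C"
  shows "(\<Sum>b\<in>S. f b *\<^sub>R b) \<bullet> c = (if c \<in> S then f c else 0)"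
proof -
  have fin: "finite S" using assms finite_B finite_C by (meson finite_UnI finite_subset)
  have "(\<Sum>b\<in>S. f b *\<^sub>R b) \<bullet> c = (\<Sum>b\<in>S. if b = c then f b else 0)"
    using assms by (auto simp: inner_sum_left orthonormal subset_eq intro!: sum.cong)
  then show ?thesis using fin by (simp add: sum.delta')
qed

lemma orth_proj_span: "orth_proj (span B) x = (\<Sum>b\<in>B. (x \<bullet> b) *\<^sub>R b)"
proof (rule orth_proj_unique)
  show "(\<Sum>b\<in>B. (x \<bullet> b) *\<^sub>R b) \<in> span B"
    by (intro span_sum span_scale span_base)
  show "\<forall>w\<in>span B. orthogonal (x - (\<Sum>b\<in>B. (x \<bullet> b) *\<^sub>R b)) w"
  proof
    fix w assume "w \<in> span B"
    then show "orthogonal (x - (\<Sum>b\<in>B. (x \<bullet> b) *\<^sub>R b)) w"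
    proof (rule orthogonal_to_span)
      fix b assume "b \<in> B"
      then show "orthogonal (x - (\<Sum>b\<in>B. (x \<bullet> b) *\<^sub>R b)) b"
        using inner_combination[of B b "\<lambda>b. x \<bullet> b"] by (simp add: orthogonal_def inner_diff_left)
    qed
  qed
qed simp

lemma norm_orth_proj_span: "(norm (orth_proj (span B) x))\<^sup>2 = (\<Sum>b\<in>B. (x \<bullet> b)\<^sup>2)"
proof -
  have C: "(\<Sum>c\<in>C. (orth_proj (span B) x \<bullet> c)\<^sup>2) = 0"
    using disjoint by (intro sum.neutral) (auto simp: orth_proj_span inner_combination)
  have "(\<Sum>c\<in>B. (orth_proj (span B) x \<bullet> c)\<^sup>2) = (\<Sum>c\<in>B. (x \<bullet> c)\<^sup>2)"
    by (intro sum.cong) (auto simp: orth_proj_span inner_combination)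
  with C show ?thesis by (simp add: norm_representation)
qed

lemma norm_minus_orth_proj_span: "(norm (x - orth_proj (span B) x))\<^sup>2 = (\<Sum>c\<in>C. (x \<bullet> c)\<^sup>2)"
proof -
  have C: "(\<Sum>c\<in>C. ((x - orth_proj (span B) x) \<bullet> c)\<^sup>2) = (\<Sum>c\<in>C. (x \<bullet> c)\<^sup>2)"
    using disjoint
    by (intro sum.cong) (auto simp: orth_proj_span inner_diff_left inner_combination)
  have "(\<Sum>c\<in>B. ((x - orth_proj (span B) x) \<bullet> c)\<^sup>2) = 0"
    by (intro sum.neutral) (auto simp: orth_proj_span inner_diff_left inner_combination)
  with C show ?thesis by (simp add: norm_representation)
qed

text \<open>The graph of the linear map from \<open>span B\<close> to \<open>span C\<close> with
  matrix \<open>L\<close>, given by its equations: the defect of the equations at a point then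
  measures its distance from the plane.\<close>

definition graph :: "('a \<Rightarrow> 'a \<Rightarrow> real) \<Rightarrow> 'a set" where
  "graph L = {w. \<forall>c\<in>C. w \<bullet> c = (\<Sum>b\<in>B. L c b * (w \<bullet> b))}"

lemma subspace_graph: "subspace (graph L)"
  unfolding subspace_def graph_def
  by (auto simp: inner_add_left distrib_left sum.distrib sum_distrib_left ac_simps)

text \<open>The left-hand side is a linear functional of \<open>z\<close> that vanishes on
  \<open>graph L\<close>, so only the component of \<open>z\<close> orthogonal to the plane
  contributes; its coefficients are at most 1 in absolute value.\<close>

lemma abs_diff_graph_le:
  assumes "\<And>c b. c \<in> C \<Longrightarrow> b \<in> B \<Longrightarrow> \<bar>L c b\<bar> \<le> 1" "c \<in> C"
  shows "\<bar>z \<bullet> c - (\<Sum>b\<in>B. L c b * (z \<bullet> b))\<bar> \<le> (1 + card B) * norm (z - orth_proj (graph L) z)"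
proof -
  define w where "w = orth_proj (graph L) z"
  have "w \<in> graph L" unfolding w_def by (rule orth_proj_in[OF subspace_graph])
  then have "z \<bullet> c - (\<Sum>b\<in>B. L c b * (z \<bullet> b)) = (z - w) \<bullet> c - (\<Sum>b\<in>B. L c b * ((z - w) \<bullet> b))"
    using assms(2) by (simp add: graph_def inner_diff_left right_diff_distrib sum_subtractf)
  also have "\<bar>\<dots>\<bar> \<le> \<bar>(z - w) \<bullet> c\<bar> + (\<Sum>b\<in>B. \<bar>L c b * ((z - w) \<bullet> b)\<bar>)"
    by (rule order.trans[OF abs_triangle_ineq4 add_left_mono[OF sum_abs]])
  also have "\<dots> \<le> norm (z - w) + (\<Sum>b\<in>B. 1 * norm (z - w))"
    unfolding abs_mult using assms by (intro add_mono sum_mono mult_mono inner_basis_le) auto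
  also have "\<dots> = (1 + card B) * norm (z - w)" by (simp add: algebra_simps)
  finally show ?thesis by (simp add: w_def)
qed

end

lemma orthonormal_split_exists:
  fixes V :: "'a::euclidean_space set"
  assumes "V \<in> grassmannian k"
  obtains B C where "orthonormal_split B C" "span B = V" "card B = k" "card C = DIM('a) - k"
proof -
  have V: "subspace V" "dim V = k" using assms by (auto simp: grassmannian_def)
  define W where "W = {y. \<forall>x\<in>V. orthogonal x y}"
  have W: "subspace W" unfolding W_def by (rule subspace_orthogonal_to_vectors)
  have dW: "dim W + k = DIM('a)"
    using dim_subspace_orthogonal_to_vectors[of V UNIV] V by (simp add: W_def)
  obtain B where B: "B \<subseteq> V" "pairwise orthogonal B" "\<And>x. x \<in> B \<Longrightarrow> norm x = 1"
    "independent B" "card B = dim V" "span B = V" using orthonormal_basis_subspace[OF V(1)] by metis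
  obtain C where C: "C \<subseteq> W" "pairwise orthogonal C" "\<And>x. x \<in> C \<Longrightarrow> norm x = 1"
    "independent C" "card C = dim W" "span C = W" using orthonormal_basis_subspace[OF W] by metis
  have BC: "orthogonal b c" if "b \<in> B" "c \<in> C" for b c
    using that B(1) C(1) by (auto simp: W_def)
  have disj: "B \<inter> C = {}"
  proof -
    have False if "b \<in> B" "b \<in> C" for b
      using BC[OF that] B(3)[OF that(1)] by (auto simp: orthogonal_def norm_eq_1)
    then show ?thesis by blast
  qed
  have on: "b \<bullet> c = (if b = c then 1 else 0)" if "b \<in> B \<union> C" "c \<in> B \<union> C" for b c
  proof (cases "b = c")
    case True then show ?thesis using that B(3) C(3) by (auto simp: norm_eq_1)
  next
    case False
    then have "orthogonal b c"
      using that B(2) C(2) BC orthogonal_commute[of b c] by (auto simp: pairwise_def)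
    then show ?thesis using False by (simp add: orthogonal_def)
  qed
  have fin: "finite B" "finite C" using B(4) C(4) by (auto intro: independent_imp_finite)
  have rep: "(\<Sum>b\<in>B. (x \<bullet> b) *\<^sub>R b) + (\<Sum>c\<in>C. (x \<bullet> c) *\<^sub>R c) = x" for x
  proof -
    obtain y z where yz: "y \<in> span V" "\<And>w. w \<in> span V \<Longrightarrow> orthogonal z w" "x = y + z"
      using orthogonal_subspace_decomp_exists by metis
    have y: "y \<in> span B" using yz(1) V(1) B(6) by (simp add: span_eq_iff[THEN iffD2])
    have z: "z \<in> span C" using yz(2) V(1) C(6)
      by (simp add: W_def orthogonal_commute span_eq_iff[THEN iffD2])
    have "x \<in> span (B \<union> C)" using y z yz(3) by (metis span_add span_mono Un_upper1 Un_upper2 subsetD)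
    moreover have "independent (B \<union> C)"
    proof (rule pairwise_orthogonal_independent)
      show "pairwise orthogonal (B \<union> C)"
        using on by (auto simp: pairwise_def orthogonal_def)
      show "0 \<notin> B \<union> C" using B(3) C(3) by force
    qed
    ultimately have "(\<Sum>b\<in>B \<union> C. (x \<bullet> b) *\<^sub>R b) = x"
    proof -
      obtain f where f: "x = (\<Sum>b\<in>B \<union> C. f b *\<^sub>R b)"
        using \<open>x \<in> span (B \<union> C)\<close> fin by (auto simp: span_finite)
      have "x \<bullet> c = f c" if "c \<in> B \<union> C" for c
      proof -
        have "x \<bullet> c = (\<Sum>b\<in>B \<union> C. if b = c then f b else 0)"
          unfolding f using that by (auto simp: inner_sum_left on intro!: sum.cong)
        then show ?thesis using that fin by (simp add: sum.delta' del: Un_iff)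
      qed
      then show ?thesis using f by simp
    qed
    then show ?thesis using disj fin by (simp add: sum.union_disjoint)
  qed
  have "orthonormal_split B C"
    using fin disj on rep by unfold_locales auto
  moreover have "card C = DIM('a) - k" using dW C(5) by simp
  ultimately show thesis using that B V by metis
qed

lemma norm_orth_proj_diff_le:
  fixes V W :: "'a::euclidean_space set"
  assumes "V \<in> grassmannian k" "W \<in> grassmannian k"
  shows "norm (orth_proj V x - orth_proj W x) \<le> grassmann_dist V W * norm x"
  unfolding grassmann_dist_def using assms
  by (intro onorm bounded_linear_sub bounded_linear_orth_proj) (auto simp: grassmannian_def)

context orthonormal_split
begin

text \<open>Projection to \<open>span B\<close> moves a vector of \<open>V\<close> by at most half
  its length. It is therefore injective on \<open>V\<close> and, by equality of dimensions, onto;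
  column \<open>b\<close> of \<open>L\<close> is the \<open>C\<close>-part of the vector of
  \<open>V\<close> lying above \<open>b\<close>.\<close>

lemma graph_representation:
  assumes "V \<in> grassmannian (card B)" and near: "grassmann_dist V (span B) \<le> 1/2"
    and sB: "span B \<in> grassmannian (card B)"
  obtains L where "V = graph L" "\<And>c b. c \<in> C \<Longrightarrow> b \<in> B \<Longrightarrow> \<bar>L c b\<bar> \<le> 1"
proof -
  define P where "P = orth_proj (span B)"
  have V: "subspace V" "dim V = card B" using assms by (auto simp: grassmannian_def)
  have linP: "linear P" unfolding P_def by (intro linear_orth_proj) simp
  have close: "norm (x - P x) \<le> norm x / 2" if "x \<in> V" for x
  proof -
    have "orth_proj V x = x" using that V by (intro orth_proj_unique) (auto simp: orthogonal_def)
    then have "norm (x - P x) \<le> grassmann_dist V (span B) * norm x"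
      using norm_orth_proj_diff_le[OF assms(1) sB, of x] by (simp add: P_def)
    also have "\<dots> \<le> 1/2 * norm x" using near by (intro mult_right_mono) auto
    finally show ?thesis by simp
  qed
  have inj: "inj_on P V"
  proof (rule inj_onI)
    fix x y assume xy: "x \<in> V" "y \<in> V" "P x = P y"
    then have "x - y \<in> V" "P (x - y) = 0"
      using V linP by (auto simp: subspace_diff linear_diff)
    then have "norm (x - y) \<le> norm (x - y) / 2" using close[of "x - y"] by simp
    then show "x = y" by simp
  qed
  have spV: "span V = V" using V by simp
  have "P ` V = span B"
  proof (rule subspace_dim_equal)
    show "subspace (P ` V)" by (rule linear_subspace_image[OF linP V(1)])
    show "P ` V \<subseteq> span B" unfolding P_def using orth_proj_in[of "span B"] by auto
    have "dim (P ` V) = dim V" using linP inj by (intro dim_image_eq) (simp_all add: spV)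
    then show "dim (P ` V) \<ge> dim (span B)" using sB V by (simp add: grassmannian_def)
  qed simp
  then have "\<exists>v. v \<in> V \<and> P v = b" if "b \<in> B" for b
    using span_base[OF that] by (metis imageE)
  then obtain v where v: "\<And>b. b \<in> B \<Longrightarrow> v b \<in> V" "\<And>b. b \<in> B \<Longrightarrow> P (v b) = b" by metis
  have Pin: "P x \<bullet> b = x \<bullet> b" if "b \<in> B" for x b
    using that by (simp add: P_def orth_proj_span inner_combination)
  have decomp: "v b = b + (\<Sum>c\<in>C. (v b \<bullet> c) *\<^sub>R c)" if "b \<in> B" for b
    using representation[of "v b"] v(2)[OF that] by (simp add: P_def orth_proj_span)
  define L where "L c b = v b \<bullet> c" for c b
  have eq: "w = (\<Sum>b\<in>B. (w \<bullet> b) *\<^sub>R v b)" if "w \<in> V" for w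
  proof (rule inj_onD[OF inj])
    have "P (\<Sum>b\<in>B. (w \<bullet> b) *\<^sub>R v b) = (\<Sum>b\<in>B. (w \<bullet> b) *\<^sub>R b)"
      using v(2) by (simp add: linear_sum[OF linP] linear_scale[OF linP])
    then show "P w = P (\<Sum>b\<in>B. (w \<bullet> b) *\<^sub>R v b)" by (simp add: P_def orth_proj_span)
    show "(\<Sum>b\<in>B. (w \<bullet> b) *\<^sub>R v b) \<in> V"
      using v(1) by (intro subspace_sum[OF V(1)] subspace_scale[OF V(1)])
  qed fact
  have "V = graph L"
  proof
    show "V \<subseteq> graph L"
    proof
      fix w assume "w \<in> V"
      show "w \<in> graph L"
        unfolding graph_def
      proof (safe)
        fix c assume "c \<in> C"
        have "w \<bullet> c = (\<Sum>b\<in>B. (w \<bullet> b) *\<^sub>R v b) \<bullet> c" using eq[OF \<open>w \<in> V\<close>] by simp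
        then show "w \<bullet> c = (\<Sum>b\<in>B. L c b * (w \<bullet> b))"
          by (simp add: inner_sum_left L_def mult.commute)
      qed
    qed
    show "graph L \<subseteq> V"
    proof
      fix w assume w: "w \<in> graph L"
      have "w = (\<Sum>b\<in>B. (w \<bullet> b) *\<^sub>R b) + (\<Sum>c\<in>C. (\<Sum>b\<in>B. L c b * (w \<bullet> b)) *\<^sub>R c)"
        using representation[of w] w by (simp add: graph_def)
      also have "(\<Sum>c\<in>C. (\<Sum>b\<in>B. L c b * (w \<bullet> b)) *\<^sub>R c) = (\<Sum>c\<in>C. \<Sum>b\<in>B. (w \<bullet> b) *\<^sub>R ((v b \<bullet> c) *\<^sub>R c))"
        by (simp add: L_def scaleR_sum_left mult.commute)
      also have "\<dots> = (\<Sum>b\<in>B. (w \<bullet> b) *\<^sub>R (\<Sum>c\<in>C. (v b \<bullet> c) *\<^sub>R c))"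
        by (subst sum.swap) (simp add: scaleR_sum_right)
      also have "(\<Sum>b\<in>B. (w \<bullet> b) *\<^sub>R b) + \<dots> = (\<Sum>b\<in>B. (w \<bullet> b) *\<^sub>R v b)"
        unfolding sum.distrib[symmetric] scaleR_add_right[symmetric]
        using decomp by (intro sum.cong) auto
      finally have "w = (\<Sum>b\<in>B. (w \<bullet> b) *\<^sub>R v b)" .
      moreover have "(\<Sum>b\<in>B. (w \<bullet> b) *\<^sub>R v b) \<in> V"
        using v(1) by (intro subspace_sum[OF V(1)] subspace_scale[OF V(1)])
      ultimately show "w \<in> V" by simp
    qed
  qed
  moreover have "\<bar>L c b\<bar> \<le> 1" if "c \<in> C" "b \<in> B" for c b
  proof -
    \<comment> \<open>The radius 1/2 yields the entry bound 1: from |v b| <= |v b| / 2 + 1 follows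
      |v b| <= 2, so \<open>v b - b\<close> has norm at most 1.\<close>
    have cl: "norm (v b - b) \<le> norm (v b) / 2" using close[OF v(1)] v(2) that by metis
    have "norm (v b) \<le> norm (v b - b) + norm b" using norm_triangle_ineq[of "v b - b" b] by simp
    then have "norm (v b) \<le> 2" using cl norm_basis[of b] that by simp
    then have "norm (v b - b) \<le> 1" using cl by simp
    moreover have "b \<bullet> c = 0" using that disjoint orthonormal[of b c] by auto
    then have "L c b = (v b - b) \<bullet> c" by (simp add: L_def inner_diff_left)
    ultimately show ?thesis using inner_basis_le[of c "v b - b"] that by auto
  qed
  ultimately show thesis by (rule that)
qed

text \<open>The projection is the nearest point of \<open>graph L'\<close>, so it is enough to
  compare \<open>w\<close> with the point \<open>v\<close> of \<open>graph L'\<close> that has the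
  same \<open>B\<close>-coordinates.\<close>

lemma graph_close:
  assumes "\<And>c b. c \<in> C \<Longrightarrow> b \<in> B \<Longrightarrow> \<bar>L c b - L' c b\<bar> \<le> \<epsilon>" "w \<in> graph L"
  shows "norm (w - orth_proj (graph L') w) \<le> real (card B) * real (card C) * \<epsilon> * norm w"
proof -
  define v where "v = (\<Sum>b\<in>B. (w \<bullet> b) *\<^sub>R b) + (\<Sum>c\<in>C. (\<Sum>b\<in>B. L' c b * (w \<bullet> b)) *\<^sub>R c)"
  have vb: "v \<bullet> b = w \<bullet> b" if "b \<in> B" for b
    using that disjoint by (auto simp: v_def inner_add_left inner_combination)
  have vc: "v \<bullet> c = (\<Sum>b\<in>B. L' c b * (w \<bullet> b))" if "c \<in> C" for c
    using that disjoint by (auto simp: v_def inner_add_left inner_combination)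
  have vg: "v \<in> graph L'" by (simp add: graph_def vb vc)
  have "norm (w - orth_proj (graph L') w) \<le> norm (w - v)"
  proof -
    have "orthogonal (w - orth_proj (graph L') w) (orth_proj (graph L') w - v)"
      by (intro orth_proj_orthogonal subspace_graph subspace_diff orth_proj_in vg)
    then have "(norm (w - v))\<^sup>2 = (norm (w - orth_proj (graph L') w))\<^sup>2 + (norm (orth_proj (graph L') w - v))\<^sup>2"
      using norm_add_Pythagorean by fastforce
    then show ?thesis by (simp add: power2_le_imp_le)
  qed
  also have "w - v = (\<Sum>c\<in>C. (\<Sum>b\<in>B. (L c b - L' c b) * (w \<bullet> b)) *\<^sub>R c)"
  proof -
    have "w - v = (\<Sum>b\<in>B. ((w - v) \<bullet> b) *\<^sub>R b) + (\<Sum>c\<in>C. ((w - v) \<bullet> c) *\<^sub>R c)"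
      by (simp add: representation)
    also have "(\<Sum>b\<in>B. ((w - v) \<bullet> b) *\<^sub>R b) = 0"
      using vb by (intro sum.neutral) (simp add: inner_diff_left)
    also have "(\<Sum>c\<in>C. ((w - v) \<bullet> c) *\<^sub>R c) = (\<Sum>c\<in>C. (\<Sum>b\<in>B. (L c b - L' c b) * (w \<bullet> b)) *\<^sub>R c)"
      using assms(2) vc by (intro sum.cong)
        (auto simp: inner_diff_left graph_def left_diff_distrib sum_subtractf)
    finally show ?thesis by simp
  qed
  also have "norm \<dots> \<le> (\<Sum>c\<in>C. \<Sum>b\<in>B. \<epsilon> * norm w)"
  proof (intro sum_norm_le)
    fix c assume "c \<in> C"
    then have "norm ((\<Sum>b\<in>B. (L c b - L' c b) * (w \<bullet> b)) *\<^sub>R c) = \<bar>\<Sum>b\<in>B. (L c b - L' c b) * (w \<bullet> b)\<bar>"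
      using norm_basis[of c] by simp
    also have "\<dots> \<le> (\<Sum>b\<in>B. \<bar>(L c b - L' c b) * (w \<bullet> b)\<bar>)" by (rule sum_abs)
    also have "\<dots> \<le> (\<Sum>b\<in>B. \<epsilon> * norm w)"
    proof (rule sum_mono)
      fix b assume "b \<in> B"
      then have "\<bar>L c b - L' c b\<bar> \<le> \<epsilon>" "\<bar>w \<bullet> b\<bar> \<le> norm w"
        using assms(1) \<open>c \<in> C\<close> inner_basis_le by auto
      then show "\<bar>(L c b - L' c b) * (w \<bullet> b)\<bar> \<le> \<epsilon> * norm w"
        unfolding abs_mult by (intro mult_mono) auto
    qed
    finally show "norm ((\<Sum>b\<in>B. (L c b - L' c b) * (w \<bullet> b)) *\<^sub>R c) \<le> (\<Sum>b\<in>B. \<epsilon> * norm w)" .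
  qed
  also have "\<dots> = real (card B) * real (card C) * \<epsilon> * norm w" by simp
  finally show ?thesis .
qed

end

text \<open>Write \<open>x = v + y\<close> with \<open>v\<close> in \<open>V\<close> and
  \<open>y\<close> orthogonal to \<open>V\<close>. The first bound controls the part from
  \<open>v\<close>. The projection \<open>w\<close> of \<open>y\<close> to \<open>W\<close> is
  controlled by duality: the inner product of \<open>w\<close> with itself equals that of
  \<open>y\<close> with \<open>w - orth_proj V w\<close>, to which the second bound applies.\<close>

lemma grassmann_dist_le:
  fixes V W :: "'a::euclidean_space set"
  assumes V: "subspace V" and W: "subspace W" and "0 \<le> \<eta>"
    and VW: "\<And>x. x \<in> V \<Longrightarrow> norm (x - orth_proj W x) \<le> \<eta> * norm x"
    and WV: "\<And>x. x \<in> W \<Longrightarrow> norm (x - orth_proj V x) \<le> \<eta> * norm x"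
  shows "grassmann_dist V W \<le> 2 * \<eta>"
  unfolding grassmann_dist_def
proof (rule onorm_le)
  fix x
  define v where "v = orth_proj V x"
  define y where "y = x - v"
  define w where "w = orth_proj W y"
  have vx: "(norm x)\<^sup>2 = (norm v)\<^sup>2 + (norm y)\<^sup>2"
  proof -
    have "orthogonal v y" unfolding y_def v_def using orth_proj_in[OF V] orth_proj_orthogonal[OF V]
      by (simp add: orthogonal_commute)
    then show ?thesis using norm_add_Pythagorean[of v y] by (simp add: y_def)
  qed
  then have nv: "norm v \<le> norm x" and ny: "norm y \<le> norm x" by (auto simp: power2_le_imp_le)
  have w: "norm w \<le> \<eta> * norm y"
  proof -
    have wW: "w \<in> W" unfolding w_def by (rule orth_proj_in[OF W])
    have "w \<bullet> w = y \<bullet> w"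
      using orth_proj_orthogonal[OF W wW, of y] by (simp add: w_def orthogonal_def inner_diff_left)
    also have "\<dots> = y \<bullet> (w - orth_proj V w)"
      using orth_proj_orthogonal[OF V orth_proj_in[OF V, of w], of x]
      by (simp add: y_def v_def orthogonal_def inner_diff_right)
    also have "\<dots> \<le> norm y * norm (w - orth_proj V w)" by (rule norm_cauchy_schwarz)
    also have "\<dots> \<le> norm y * (\<eta> * norm w)" by (intro mult_left_mono WV wW) auto
    finally have "norm w * norm w \<le> (\<eta> * norm y) * norm w"
      by (simp add: dot_square_norm power2_eq_square ac_simps)
    then show ?thesis using \<open>0 \<le> \<eta>\<close>
      by (cases "norm w = 0") (auto simp: mult_le_cancel_right)
  qed
  have "orth_proj W x = orth_proj W v + w"
    using linear_add[OF linear_orth_proj[OF W], of v y] by (simp add: w_def y_def)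
  then have "norm (orth_proj V x - orth_proj W x) \<le> norm (v - orth_proj W v) + norm w"
    using norm_triangle_ineq4[of "v - orth_proj W v" w] by (simp add: v_def[symmetric] algebra_simps)
  also have "\<dots> \<le> \<eta> * norm v + \<eta> * norm y"
    using VW[of v] orth_proj_in[OF V, of x] w by (simp add: v_def)
  also have "\<dots> \<le> \<eta> * norm x + \<eta> * norm x" using nv ny \<open>0 \<le> \<eta>\<close> by (intro add_mono mult_left_mono)
  finally show "norm (orth_proj V x - orth_proj W x) \<le> 2 * \<eta> * norm x" by simp
qed

lemma (in orthonormal_split) grassmann_dist_graph_le:
  assumes "\<And>c b. c \<in> C \<Longrightarrow> b \<in> B \<Longrightarrow> \<bar>L c b - L' c b\<bar> \<le> \<epsilon>" "0 \<le> \<epsilon>"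
  shows "grassmann_dist (graph L) (graph L') \<le> 2 * (real (card B) * real (card C) * \<epsilon>)"
proof (rule grassmann_dist_le)
  show "norm (x - orth_proj (graph L) x) \<le> real (card B) * real (card C) * \<epsilon> * norm x" if "x \<in> graph L'" for x
    using assms(1) that by (intro graph_close) (auto simp: abs_minus_commute)
  show "norm (x - orth_proj (graph L') x) \<le> real (card B) * real (card C) * \<epsilon> * norm x" if "x \<in> graph L" for x
    using assms(1) that by (intro graph_close)
qed (use assms(2) subspace_graph in auto)

lemma norm_orth_proj_Pythagorean:
  fixes V :: "'a::euclidean_space set"
  assumes "subspace V"
  shows "(norm z)\<^sup>2 = (norm (orth_proj V z))\<^sup>2 + (norm (z - orth_proj V z))\<^sup>2"
proof -
  have "orthogonal (orth_proj V z) (z - orth_proj V z)"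
    using orth_proj_in[OF assms] orth_proj_orthogonal[OF assms] by (simp add: orthogonal_commute)
  then show ?thesis using norm_add_Pythagorean by fastforce
qed

lemma norm_orth_proj_le:
  fixes V :: "'a::euclidean_space set"
  assumes "subspace V"
  shows "norm (orth_proj V x) \<le> norm x"
  using norm_orth_proj_Pythagorean[OF assms, of x] by (simp add: power2_le_imp_le)

text \<open>The metric is the operator norm distance of the projections, which form a bounded set in
  a finite-dimensional space. The centres of a cover by balls of radius 1/4 need not be projections;
  replacing each by a plane from its ball doubles the radius.\<close>

lemma grassmannian_finite_net:
  obtains T :: "'a::euclidean_space set set" where "finite T" "T \<subseteq> grassmannian k"
    "\<And>V. V \<in> grassmannian k \<Longrightarrow> \<exists>W\<in>T. grassmann_dist V W \<le> 1/2"
proof -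
  define P :: "'a set \<Rightarrow> 'a \<Rightarrow>\<^sub>L 'a" where "P V = Blinfun (orth_proj V)" for V
  have P: "blinfun_apply (P V) = orth_proj V" if "V \<in> grassmannian k" for V
    using that bounded_linear_orth_proj unfolding P_def grassmannian_def
    by (auto intro: bounded_linear_Blinfun_apply)
  have dist: "grassmann_dist V W = dist (P V) (P W)" if "V \<in> grassmannian k" "W \<in> grassmannian k" for V W
    using that by (simp add: grassmann_dist_def dist_norm norm_blinfun.rep_eq minus_blinfun.rep_eq P)
  define S where "S = P ` grassmannian k"
  have "bounded S"
    unfolding bounded_iff
  proof (intro exI ballI)
    fix x assume "x \<in> S"
    then obtain V where V: "V \<in> grassmannian k" "x = P V" by (auto simp: S_def)
    then show "norm x \<le> 1"
      using norm_orth_proj_le[of V] by (auto simp: grassmannian_def P intro!: norm_blinfun_bound)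
  qed
  then have "compact (closure S)" by (simp add: compact_closure)
  then obtain K where K: "finite K" "closure S \<subseteq> (\<Union>x\<in>K. ball x (1/4))"
    unfolding compact_eq_totally_bounded by (metis zero_less_divide_1_iff zero_less_numeral)
  define rep where "rep x = (SOME V. V \<in> grassmannian k \<and> P V \<in> ball x (1/4))" for x
  define T where "T = rep ` {x\<in>K. \<exists>V. V \<in> grassmannian k \<and> P V \<in> ball x (1/4)}"
  have rep: "rep x \<in> grassmannian k" "P (rep x) \<in> ball x (1/4)"
    if "\<exists>V. V \<in> grassmannian k \<and> P V \<in> ball x (1/4)" for x
    using someI_ex[OF that] unfolding rep_def by auto
  show thesis
  proof
    show "finite T" using K by (simp add: T_def)
    show "T \<subseteq> grassmannian k" using rep by (auto simp: T_def)
    fix V :: "'a set" assume V: "V \<in> grassmannian k"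
    then have "P V \<in> closure S" by (intro subsetD[OF closure_subset]) (simp add: S_def)
    then obtain x where x: "x \<in> K" "P V \<in> ball x (1/4)" using K by auto
    then have r: "rep x \<in> grassmannian k" "P (rep x) \<in> ball x (1/4)" using rep V by blast+
    have "dist (P V) (P (rep x)) \<le> dist (P V) x + dist x (P (rep x))" by (rule dist_triangle)
    also have "\<dots> \<le> 1/2" using x r by (simp add: dist_commute)
    finally have "grassmann_dist V (rep x) \<le> 1/2" using V r by (simp add: dist)
    then show "\<exists>W\<in>T. grassmann_dist V W \<le> 1/2" using x V by (auto simp: T_def)
  qed
qed

section \<open>Gaussian sums over grids\<close>

text \<open>A single term of the exponential series. It is the form in which exponential decay is
  played against powers of 2^n.\<close>

lemma power_le_fact_exp:
  fixes x :: real
  assumes "0 \<le> x"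
  shows "x ^ p \<le> fact p * exp x"
proof -
  have "(\<Sum>i\<in>{p}. x ^ i /\<^sub>R fact i) \<le> (\<Sum>i. x ^ i /\<^sub>R fact i)"
    using assms by (intro sum_le_suminf summable_exp_generic) auto
  then show ?thesis by (simp add: exp_def field_simps)
qed

lemma sum_power_abs_int_le:
  fixes q :: real
  assumes "finite F" "0 < q" "q < 1"
  shows "(\<Sum>m\<in>F. q ^ nat \<bar>m :: int\<bar>) \<le> 2 / (1 - q)"
proof -
  have geo: "(\<Sum>i\<in>S. q ^ i) \<le> 1 / (1 - q)" if "finite S" for S
  proof -
    have "(\<Sum>i\<in>S. q ^ i) \<le> (\<Sum>i. q ^ i)"
      using assms that by (intro sum_le_suminf summable_geometric) auto
    then show ?thesis using assms by (simp add: suminf_geometric)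
  qed
  define P where "P = {m\<in>F. 0 \<le> m}"
  define N where "N = {m\<in>F. m < 0}"
  have "inj_on (\<lambda>m. nat \<bar>m\<bar>) P" "inj_on (\<lambda>m. nat \<bar>m\<bar>) N"
    by (auto simp: inj_on_def P_def N_def)
  then have "(\<Sum>m\<in>P. q ^ nat \<bar>m\<bar>) = (\<Sum>i\<in>(\<lambda>m. nat \<bar>m\<bar>) ` P. q ^ i)"
    "(\<Sum>m\<in>N. q ^ nat \<bar>m\<bar>) = (\<Sum>i\<in>(\<lambda>m. nat \<bar>m\<bar>) ` N. q ^ i)"
    by (simp_all add: sum.reindex)
  moreover have "finite P" "finite N" using assms by (auto simp: P_def N_def)
  ultimately have "(\<Sum>m\<in>P. q ^ nat \<bar>m\<bar>) \<le> 1 / (1 - q)" "(\<Sum>m\<in>N. q ^ nat \<bar>m\<bar>) \<le> 1 / (1 - q)"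
    using geo by simp_all
  moreover have "F = P \<union> N" "P \<inter> N = {}" by (auto simp: P_def N_def)
  then have "(\<Sum>m\<in>F. q ^ nat \<bar>m\<bar>) = (\<Sum>m\<in>P. q ^ nat \<bar>m\<bar>) + (\<Sum>m\<in>N. q ^ nat \<bar>m\<bar>)"
    using \<open>finite P\<close> \<open>finite N\<close> by (simp add: sum.union_disjoint)
  ultimately show ?thesis by simp
qed

text \<open>The points \<open>l * \<alpha>\<close> have spacing at least \<open>\<kappa>\<close>, so
  a Gaussian meets boundedly many of them up to its tails. The point is that \<open>K\<close>
  depends on \<open>c\<close> and \<open>\<kappa>\<close> only.\<close>

lemma sum_gaussian_int_bounded:
  fixes c \<kappa> :: real
  assumes "0 < c" "0 < \<kappa>"
  shows "\<exists>K>0. \<forall>\<alpha> \<beta> F. finite F \<longrightarrow> \<kappa> \<le> \<bar>\<alpha>\<bar> \<longrightarrow>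
    (\<Sum>l\<in>F. exp (- c * (\<beta> - real_of_int l * \<alpha>)\<^sup>2)) \<le> K"
proof -
  define a where "a = c * \<kappa>\<^sup>2"
  define q where "q = exp (- 2 * a)"
  have a: "a > 0" using assms by (simp add: a_def)
  have q: "0 < q" "q < 1" using a by (auto simp: q_def)
  have "(\<Sum>l\<in>F. exp (- c * (\<beta> - real_of_int l * \<alpha>)\<^sup>2)) \<le> exp (3 * a) * (2 / (1 - q))"
    if fin: "finite F" and \<alpha>: "\<kappa> \<le> \<bar>\<alpha>\<bar>" for \<alpha> \<beta> F
  proof -
    define y where "y = \<beta> / \<alpha>"
    have \<alpha>0: "\<alpha> \<noteq> 0" using \<alpha> assms by auto
    have "exp (- c * (\<beta> - real_of_int l * \<alpha>)\<^sup>2) \<le> exp (3 * a) * q ^ nat \<bar>\<lfloor>y\<rfloor> - l\<bar>" for l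
    proof -
      have "(\<beta> - real_of_int l * \<alpha>)\<^sup>2 = \<alpha>\<^sup>2 * (y - l)\<^sup>2"
        using \<alpha>0 by (simp add: y_def power_mult_distrib[symmetric] right_diff_distrib mult.commute)
      moreover have "\<kappa>\<^sup>2 \<le> \<alpha>\<^sup>2" using \<alpha> assms by (simp add: abs_le_square_iff[symmetric])
      ultimately have 1: "(\<beta> - real_of_int l * \<alpha>)\<^sup>2 \<ge> \<kappa>\<^sup>2 * (y - l)\<^sup>2" by (simp add: mult_right_mono)
      \<comment> \<open>The tangent line to the square turns the Gaussian into a geometric sequence
        in the distance of \<open>l\<close> from the floor of \<open>y\<close>. The constant 3 is 1
        from the tangent line and 2 from replacing \<open>y\<close> by its floor.\<close>
      have "(y - l)\<^sup>2 - 2 * \<bar>y - l\<bar> + 1 = (\<bar>y - l\<bar> - 1)\<^sup>2"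
        using power2_diff[of "\<bar>y - l\<bar>" 1] by simp
      also have "\<dots> \<ge> 0" by simp
      finally have "(y - l)\<^sup>2 \<ge> 2 * \<bar>y - l\<bar> - 1" by linarith
      moreover have "\<bar>y - l\<bar> \<ge> real_of_int \<bar>\<lfloor>y\<rfloor> - l\<bar> - 1" by linarith
      ultimately have 2: "(y - l)\<^sup>2 \<ge> 2 * real_of_int \<bar>\<lfloor>y\<rfloor> - l\<bar> - 3" by simp
      have "c * (\<beta> - real_of_int l * \<alpha>)\<^sup>2 \<ge> c * (\<kappa>\<^sup>2 * (y - l)\<^sup>2)"
        using 1 assms by (intro mult_left_mono) auto
      also have "c * (\<kappa>\<^sup>2 * (y - l)\<^sup>2) = a * (y - l)\<^sup>2" by (simp add: a_def)
      also have "\<dots> \<ge> a * (2 * real_of_int \<bar>\<lfloor>y\<rfloor> - l\<bar> - 3)" using 2 a by (intro mult_left_mono) auto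
      finally have "exp (- c * (\<beta> - real_of_int l * \<alpha>)\<^sup>2) \<le> exp (3 * a + real (nat \<bar>\<lfloor>y\<rfloor> - l\<bar>) * (- 2 * a))"
        by (simp add: algebra_simps)
      then show ?thesis by (simp only: exp_add exp_of_nat_mult q_def)
    qed
    then have "(\<Sum>l\<in>F. exp (- c * (\<beta> - real_of_int l * \<alpha>)\<^sup>2)) \<le> (\<Sum>l\<in>F. exp (3 * a) * q ^ nat \<bar>\<lfloor>y\<rfloor> - l\<bar>)"
      by (rule sum_mono)
    also have "\<dots> = exp (3 * a) * (\<Sum>m\<in>(\<lambda>l. \<lfloor>y\<rfloor> - l) ` F. q ^ nat \<bar>m\<bar>)"
      by (subst sum.reindex) (auto simp: sum_distrib_left inj_on_def)
    also have "\<dots> \<le> exp (3 * a) * (2 / (1 - q))"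
      using fin q by (intro mult_left_mono sum_power_abs_int_le) auto
    finally show ?thesis .
  qed
  then show ?thesis using q by (intro exI[of _ "exp (3 * a) * (2 / (1 - q))"]) auto
qed

text \<open>Both ends are included: a matrix entry equal to 1 rounds down to
  \<open>2 ^ n\<close>.\<close>

abbreviation grid_ints :: "nat \<Rightarrow> int set" where
  "grid_ints n \<equiv> {- (2 ^ n)..2 ^ n}"

lemma card_grid_ints_le: "real (card (grid_ints n)) \<le> 3 * 2 ^ n"
proof -
  have "card (grid_ints n) = nat (2 * 2 ^ n + 1)" by simp
  also have "real \<dots> = 2 * 2 ^ n + 1" by (simp add: nat_add_distrib nat_mult_distrib nat_power_eq)
  finally show ?thesis using one_le_power[of "2::real" n] by simp
qed

text \<open>This is where one dimension per row is lost. If \<open>a j\<close> is large, then for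
  fixed remaining entries the sum over the entry \<open>g j\<close> is bounded uniformly, and only
  the other \<open>card I - 1\<close> entries range freely.\<close>

lemma sum_gaussian_grid_row_bounded:
  fixes c \<kappa> :: real
  assumes "0 < c" "0 < \<kappa>" and I: "finite I"
  shows "\<exists>K>0. \<forall>a \<beta> n. (\<exists>i\<in>I. \<kappa> * 2 ^ n \<le> \<bar>a i\<bar>) \<longrightarrow>
    (\<Sum>g\<in>PiE I (\<lambda>_. grid_ints n). exp (- c * (\<beta> - (\<Sum>i\<in>I. real_of_int (g i) / 2 ^ n * a i))\<^sup>2))
      \<le> K * (2 ^ n) ^ (card I - 1)"
proof -
  obtain K where K: "K > 0" "\<And>\<alpha> \<beta> F. finite F \<Longrightarrow> \<kappa> \<le> \<bar>\<alpha>\<bar> \<Longrightarrow>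
    (\<Sum>l\<in>F. exp (- c * (\<beta> - real_of_int l * \<alpha>)\<^sup>2)) \<le> K"
    using sum_gaussian_int_bounded[OF assms(1,2)] by blast
  have "(\<Sum>g\<in>PiE I (\<lambda>_. grid_ints n). exp (- c * (\<beta> - (\<Sum>i\<in>I. real_of_int (g i) / 2 ^ n * a i))\<^sup>2))
      \<le> K * 3 ^ (card I - 1) * (2 ^ n) ^ (card I - 1)"
    if j: "j \<in> I" "\<kappa> * 2 ^ n \<le> \<bar>a j\<bar>" for a \<beta> n j
  proof -
    define I' where "I' = I - {j}"
    have I': "I = insert j I'" "j \<notin> I'" "finite I'" "card I' = card I - 1"
      using j I by (auto simp: I'_def)
    define f where "f g = exp (- c * (\<beta> - (\<Sum>i\<in>I. real_of_int (g i) / 2 ^ n * a i))\<^sup>2)" for g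
    have "(\<Sum>g\<in>PiE I (\<lambda>_. grid_ints n). f g)
      = (\<Sum>(l, g)\<in>grid_ints n \<times> PiE I' (\<lambda>_. grid_ints n). f (g(j := l)))"
      unfolding I'(1) PiE_insert_eq
      by (subst sum.reindex[OF inj_combinator[OF I'(2)]]) (simp add: comp_def case_prod_unfold)
    also have "\<dots> = (\<Sum>g\<in>PiE I' (\<lambda>_. grid_ints n). \<Sum>l\<in>grid_ints n. f (g(j := l)))"
      by (subst sum.cartesian_product[symmetric]) (rule sum.swap)
    also have "\<dots> \<le> (\<Sum>g\<in>PiE I' (\<lambda>_. grid_ints n). K)"
    proof (rule sum_mono)
      fix g
      define \<gamma> where "\<gamma> = \<beta> - (\<Sum>i\<in>I'. real_of_int (g i) / 2 ^ n * a i)"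
      have eq: "f (g(j := l)) = exp (- c * (\<gamma> - real_of_int l * (a j / 2 ^ n))\<^sup>2)" for l
      proof -
        have "(\<Sum>i\<in>I. real_of_int ((g(j := l)) i) / 2 ^ n * a i)
          = real_of_int l / 2 ^ n * a j + (\<Sum>i\<in>I'. real_of_int (g i) / 2 ^ n * a i)"
          unfolding I'(1) using I'(2,3) by (subst sum.insert) (auto intro!: sum.cong)
        then show ?thesis by (simp add: f_def \<gamma>_def algebra_simps)
      qed
      have "\<kappa> \<le> \<bar>a j / 2 ^ n\<bar>" using j by (simp add: pos_le_divide_eq)
      then show "(\<Sum>l\<in>grid_ints n. f (g(j := l))) \<le> K"
        unfolding eq by (intro K(2)) auto
    qed
    also have "\<dots> = K * real (card (grid_ints n)) ^ card I'"
      using I' by (simp add: card_PiE)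
    also have "\<dots> \<le> K * (3 * 2 ^ n) ^ card I'"
      using K(1) card_grid_ints_le[of n] by (intro mult_left_mono power_mono) auto
    finally show ?thesis by (simp add: f_def I'(4) power_mult_distrib)
  qed
  then show ?thesis using K(1) by (intro exI[of _ "K * 3 ^ (card I - 1)"]) auto
qed

abbreviation grid :: "'j set \<Rightarrow> 'i set \<Rightarrow> nat \<Rightarrow> ('j \<Rightarrow> 'i \<Rightarrow> int) set" where
  "grid J I n \<equiv> PiE J (\<lambda>_. PiE I (\<lambda>_. grid_ints n))"

lemma finite_grid: "finite I \<Longrightarrow> finite J \<Longrightarrow> finite (grid J I n)"
  by (intro finite_PiE) auto

lemma card_grid_le:
  assumes "finite I" "finite J"
  shows "real (card (grid J I n)) \<le> 3 ^ (card I * card J) * (2 ^ n) ^ (card I * card J)"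
proof -
  have "real (card (grid J I n)) = real (card (grid_ints n)) ^ (card I * card J)"
    using assms by (simp add: card_PiE power_mult)
  also have "\<dots> \<le> (3 * 2 ^ n) ^ (card I * card J)"
    by (intro power_mono card_grid_ints_le) auto
  finally show ?thesis by (simp add: power_mult_distrib)
qed

text \<open>Bounds the number of cells whose planes pass near a given frequency with coordinates
  \<open>a\<close> along the centre of the chart and \<open>b\<close> across. If some
  \<open>a i\<close> is comparable to \<open>2 ^ n\<close>, the sum factors over the rows and the
  row bound applies to each; otherwise the exponential decay outweighs the total number of grid
  points.\<close>

lemma sum_gaussian_grid_bounded:
  fixes c :: real
  assumes c: "0 < c" and I: "finite I" and J: "finite J"
  shows "\<exists>K>0. \<forall>a b n. (2 ^ n)\<^sup>2 / 4 \<le> (\<Sum>i\<in>I. (a i)\<^sup>2) + (\<Sum>j\<in>J. (b j)\<^sup>2) \<longrightarrow>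
    (\<Sum>g\<in>grid J I n. exp (- c * (\<Sum>j\<in>J. (b j - (\<Sum>i\<in>I. real_of_int (g j i) / 2 ^ n * a i))\<^sup>2)))
      \<le> K * (2 ^ n) ^ ((card I - 1) * card J)"
proof -
  define m where "m = (1 + card I) * (1 + card J)"
  have m: "0 < m" by (simp add: m_def)
  \<comment> \<open>With this choice the \<open>a\<close>-coordinates together with their image
    under a grid matrix account for at most \<open>2 * (m * \<kappa>)\<^sup>2 = 1/32\<close> of
    \<open>(2 ^ n)\<^sup>2\<close>, below the share 1/8 that may be lost.\<close>
  define \<kappa> :: real where "\<kappa> = 1 / (8 * m)"
  have \<kappa>: "0 < \<kappa>" using m by (simp add: \<kappa>_def)
  obtain K where K: "K > 0" "\<And>a \<beta> n. (\<exists>i\<in>I. \<kappa> * 2 ^ n \<le> \<bar>a i\<bar>) \<Longrightarrow>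
    (\<Sum>g\<in>PiE I (\<lambda>_. grid_ints n). exp (- c * (\<beta> - (\<Sum>i\<in>I. real_of_int (g i) / 2 ^ n * a i))\<^sup>2))
      \<le> K * (2 ^ n) ^ (card I - 1)"
    using sum_gaussian_grid_row_bounded[OF c \<kappa> I] by meson
  define p where "p = card I * card J"
  \<comment> \<open>Bounds the number \<open>3 ^ p * (2 ^ n) ^ p\<close> of grid points times
    \<open>exp (- y)\<close> for \<open>y = c * (2 ^ n)\<^sup>2 / 16\<close>, using
    \<open>2 ^ n \<le> 16 / c * y\<close>.\<close>
  define K' where "K' = 3 ^ p * (fact p * (16 / c) ^ p)"
  have K': "K' > 0" using c by (simp add: K'_def)
  define f where "f a b n g = exp (- c * (\<Sum>j\<in>J. (b j - (\<Sum>i\<in>I. real_of_int (g j i) / 2 ^ n * a i))\<^sup>2))"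
    for a :: "'a \<Rightarrow> real" and b :: "'b \<Rightarrow> real" and n g
  have "(\<Sum>g\<in>grid J I n. f a b n g) \<le> (K ^ card J + K') * (2 ^ n) ^ ((card I - 1) * card J)"
    if R: "(2 ^ n)\<^sup>2 / 4 \<le> (\<Sum>i\<in>I. (a i)\<^sup>2) + (\<Sum>j\<in>J. (b j)\<^sup>2)" for a b n
  proof (cases "\<exists>i\<in>I. \<kappa> * 2 ^ n \<le> \<bar>a i\<bar>")
    case True
    have "(\<Sum>g\<in>grid J I n. f a b n g) = (\<Sum>g\<in>grid J I n. \<Prod>j\<in>J. exp (- c * (b j - (\<Sum>i\<in>I. real_of_int (g j i) / 2 ^ n * a i))\<^sup>2))"
      unfolding f_def using J by (simp add: sum_distrib_left exp_sum)
    also have "\<dots> = (\<Prod>j\<in>J. \<Sum>g\<in>PiE I (\<lambda>_. grid_ints n). exp (- c * (b j - (\<Sum>i\<in>I. real_of_int (g i) / 2 ^ n * a i))\<^sup>2))"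
      using I J by (intro prod_sum_PiE[symmetric] finite_PiE) auto
    also have "\<dots> \<le> (\<Prod>j\<in>J. K * (2 ^ n) ^ (card I - 1))"
      using K(2)[OF True] by (intro prod_mono) (auto intro: sum_nonneg)
    also have "\<dots> = K ^ card J * (2 ^ n) ^ ((card I - 1) * card J)"
      by (simp add: power_mult_distrib power_mult)
    also have "\<dots> \<le> (K ^ card J + K') * (2 ^ n) ^ ((card I - 1) * card J)"
      using K' by (intro mult_right_mono) auto
    finally show ?thesis .
  next
    case False \<comment> \<open>the vector is almost orthogonal to every plane of the chart, so each summand is tiny\<close>
    then have a: "\<bar>a i\<bar> \<le> \<kappa> * 2 ^ n" if "i \<in> I" for i using that by force
    define y :: real where "y = c * (2 ^ n)\<^sup>2 / 16"
    have "f a b n g \<le> exp (- y)" if g: "g \<in> grid J I n" for g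
    proof -
      define Y where "Y j = (\<Sum>i\<in>I. real_of_int (g j i) / 2 ^ n * a i)" for j
      have Y: "\<bar>Y j\<bar> \<le> card I * (\<kappa> * 2 ^ n)" if j: "j \<in> J" for j
      proof -
        have "\<bar>real_of_int (g j i) / 2 ^ n * a i\<bar> \<le> 1 * (\<kappa> * 2 ^ n)" if i: "i \<in> I" for i
        proof -
          have "g j i \<in> grid_ints n" using PiE_mem[OF PiE_mem[OF g j] i] by simp
          then have "\<bar>g j i\<bar> \<le> 2 ^ n" by (simp add: abs_le_iff)
          then have "\<bar>real_of_int (g j i)\<bar> \<le> 2 ^ n" by (metis of_int_abs of_int_le_iff of_int_numeral of_int_power)
          then show ?thesis
            unfolding abs_mult using a[OF i] by (intro mult_mono) auto
        qed
        then have "\<bar>Y j\<bar> \<le> (\<Sum>i\<in>I. 1 * (\<kappa> * 2 ^ n))"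
          unfolding Y_def by (intro order.trans[OF sum_abs] sum_mono)
        then show ?thesis by simp
      qed
      have "(b j)\<^sup>2 \<le> 2 * (b j - Y j)\<^sup>2 + 2 * (card I * (\<kappa> * 2 ^ n))\<^sup>2" if "j \<in> J" for j
      proof -
        have "(Y j)\<^sup>2 \<le> (card I * (\<kappa> * 2 ^ n))\<^sup>2" using power_mono[OF Y[OF that], of 2] by simp
        moreover have "(b j)\<^sup>2 \<le> 2 * (b j - Y j)\<^sup>2 + 2 * (Y j)\<^sup>2"
          using zero_le_power2[of "b j - 2 * Y j"] by (simp add: power2_eq_square algebra_simps)
        ultimately show ?thesis by simp
      qed
      then have "(\<Sum>j\<in>J. (b j)\<^sup>2) \<le> (\<Sum>j\<in>J. 2 * (b j - Y j)\<^sup>2 + 2 * (card I * (\<kappa> * 2 ^ n))\<^sup>2)"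
        by (rule sum_mono)
      then have 1: "(\<Sum>j\<in>J. (b j)\<^sup>2) \<le> 2 * (\<Sum>j\<in>J. (b j - Y j)\<^sup>2) + 2 * card J * (card I * (\<kappa> * 2 ^ n))\<^sup>2"
        by (simp add: sum.distrib sum_distrib_left)
      have "(\<Sum>i\<in>I. (a i)\<^sup>2) \<le> (\<Sum>i\<in>I. (\<kappa> * 2 ^ n)\<^sup>2)"
      proof (rule sum_mono)
        fix i assume "i \<in> I"
        then show "(a i)\<^sup>2 \<le> (\<kappa> * 2 ^ n)\<^sup>2" using power_mono[OF a, of i 2] by simp
      qed
      then have 2: "(\<Sum>i\<in>I. (a i)\<^sup>2) \<le> card I * (\<kappa> * 2 ^ n)\<^sup>2" by simp
      have 3: "(2 * card J * (card I)\<^sup>2 + card I) * (\<kappa> * 2 ^ n)\<^sup>2 \<le> (2 ^ n)\<^sup>2 / 8"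
      proof -
        have "real (2 * card J * (card I)\<^sup>2 + card I) \<le> real (2 * m\<^sup>2)"
          unfolding of_nat_le_iff m_def by (simp add: power2_eq_square algebra_simps)
        then have "(2 * card J * (card I)\<^sup>2 + card I) * \<kappa>\<^sup>2 \<le> real (2 * m\<^sup>2) * \<kappa>\<^sup>2"
          by (intro mult_right_mono) auto
        also have "\<dots> = 2 * (real m * \<kappa>)\<^sup>2" by (simp add: power_mult_distrib)
        also have "real m * \<kappa> = 1 / 8" using m by (simp add: \<kappa>_def)
        finally have "(2 * card J * (card I)\<^sup>2 + card I) * \<kappa>\<^sup>2 \<le> 1 / 8" by (simp add: power2_eq_square)
        then have "(2 * card J * (card I)\<^sup>2 + card I) * \<kappa>\<^sup>2 * (2 ^ n)\<^sup>2 \<le> 1 / 8 * (2 ^ n)\<^sup>2"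
          by (rule mult_right_mono) simp
        then show ?thesis by (simp add: power_mult_distrib mult.assoc)
      qed
      have "2 * card J * (card I * (\<kappa> * 2 ^ n))\<^sup>2 + card I * (\<kappa> * 2 ^ n)\<^sup>2
        = (2 * card J * (card I)\<^sup>2 + card I) * (\<kappa> * 2 ^ n)\<^sup>2"
        by (simp add: power_mult_distrib algebra_simps)
      then have "(2 ^ n)\<^sup>2 / 4 \<le> 2 * (\<Sum>j\<in>J. (b j - Y j)\<^sup>2) + (2 ^ n)\<^sup>2 / 8"
        using R 1 2 3 by linarith
      then have "(2 ^ n)\<^sup>2 / 16 \<le> (\<Sum>j\<in>J. (b j - Y j)\<^sup>2)" by simp
      then have "c * ((2 ^ n)\<^sup>2 / 16) \<le> c * (\<Sum>j\<in>J. (b j - Y j)\<^sup>2)"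
        using c by (intro mult_left_mono) auto
      then show ?thesis by (simp add: f_def y_def Y_def)
    qed
    then have "(\<Sum>g\<in>grid J I n. f a b n g) \<le> (\<Sum>g\<in>grid J I n. exp (- y))" by (rule sum_mono)
    also have "\<dots> = card (grid J I n) * exp (- y)" by simp
    also have "\<dots> \<le> (3 ^ p * (2 ^ n) ^ p) * exp (- y)"
      using card_grid_le[OF I J, of n] by (intro mult_right_mono) (auto simp: p_def)
    also have "\<dots> \<le> K'"
    proof -
      have y0: "y \<ge> 0" using c by (simp add: y_def)
      have "(2 ^ n :: real) \<le> (2 ^ n)\<^sup>2" by (simp add: power2_eq_square)
      then have "(2 ^ n :: real) \<le> 16 / c * y" using c by (simp add: y_def)
      then have "(2 ^ n :: real) ^ p \<le> (16 / c * y) ^ p" by (intro power_mono) auto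
      also have "\<dots> \<le> (16 / c) ^ p * (fact p * exp y)"
        unfolding power_mult_distrib using c y0 by (intro mult_left_mono power_le_fact_exp) auto
      finally have "(2 ^ n :: real) ^ p * exp (- y) \<le> (16 / c) ^ p * (fact p * exp y) * exp (- y)"
        by (rule mult_right_mono) simp
      also have "\<dots> = fact p * (16 / c) ^ p" by (simp add: exp_minus)
      finally show ?thesis by (simp add: K'_def mult.assoc mult_left_mono)
    qed
    also have "\<dots> \<le> (K ^ card J + K') * 1" using K by simp
    also have "\<dots> \<le> (K ^ card J + K') * (2 ^ n) ^ ((card I - 1) * card J)"
      using K K' by (intro mult_left_mono one_le_power) auto
    finally show ?thesis .
  qed
  moreover have "K ^ card J + K' > 0" using K K' by (intro add_pos_pos) auto
  ultimately show ?thesis unfolding f_def by (intro exI[of _ "K ^ card J + K'"]) auto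
qed

section \<open>Covers of sets of subspaces\<close>

context orthonormal_split
begin

text \<open>A dyadic cube of side \<open>1 / 2 ^ n\<close> in matrix coordinates, taken as a set of
  planes so that it can serve as a covering set. The entry bound is the one supplied by
  \<open>graph_representation\<close>.\<close>

definition cell :: "nat \<Rightarrow> ('a \<Rightarrow> 'a \<Rightarrow> int) \<Rightarrow> 'a set set" where
  "cell n g = {graph L |L. \<forall>c\<in>C. \<forall>b\<in>B. \<bar>L c b\<bar> \<le> 1 \<and> g c b = \<lfloor>2 ^ n * L c b\<rfloor>}"

lemma cell_close:
  assumes "\<bar>L c b\<bar> \<le> 1" "g c b = \<lfloor>2 ^ n * L c b\<rfloor>"
  shows "\<bar>L c b - real_of_int (g c b) / 2 ^ n\<bar> \<le> 1 / 2 ^ n"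
proof -
  have "L c b - real_of_int (g c b) / 2 ^ n = (2 ^ n * L c b - real_of_int \<lfloor>2 ^ n * L c b\<rfloor>) / 2 ^ n"
    using assms by (simp add: diff_divide_distrib)
  moreover have "\<bar>2 ^ n * L c b - real_of_int \<lfloor>2 ^ n * L c b\<rfloor>\<bar> \<le> 1" by linarith
  ultimately show ?thesis by (simp add: divide_right_mono)
qed

lemma grassmann_dist_cell:
  assumes "V \<in> cell n g" "W \<in> cell n g"
  shows "grassmann_dist V W \<le> 2 * real (card B) * real (card C) * (1/2) ^ n"
proof -
  obtain L where L: "V = graph L" "\<And>c b. c \<in> C \<Longrightarrow> b \<in> B \<Longrightarrow> g c b = \<lfloor>2 ^ n * L c b\<rfloor>"
    using assms(1) by (auto simp: cell_def)
  obtain L' where L': "W = graph L'" "\<And>c b. c \<in> C \<Longrightarrow> b \<in> B \<Longrightarrow> g c b = \<lfloor>2 ^ n * L' c b\<rfloor>"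
    using assms(2) by (auto simp: cell_def)
  have "\<bar>L c b - L' c b\<bar> \<le> (1/2) ^ n" if "c \<in> C" "b \<in> B" for c b
  proof -
    have "\<lfloor>2 ^ n * L c b\<rfloor> = \<lfloor>2 ^ n * L' c b\<rfloor>" using L(2) L'(2) that by metis
    then have "\<bar>2 ^ n * L c b - 2 ^ n * L' c b\<bar> \<le> 1" by linarith
    then have "2 ^ n * \<bar>L c b - L' c b\<bar> \<le> 1"
      by (simp add: right_diff_distrib[symmetric] abs_mult)
    then show ?thesis by (simp add: power_one_over pos_le_divide_eq mult.commute)
  qed
  then have "grassmann_dist (graph L) (graph L') \<le> 2 * (real (card B) * real (card C) * (1/2) ^ n)"
    by (intro grassmann_dist_graph_le) auto
  then show ?thesis by (simp add: L L')
qed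

lemma graph_in_cell:
  assumes "\<And>c b. c \<in> C \<Longrightarrow> b \<in> B \<Longrightarrow> \<bar>L c b\<bar> \<le> 1"
  shows "\<exists>g\<in>grid C B n. graph L \<in> cell n g"
proof
  define g where "g = (\<lambda>c\<in>C. \<lambda>b\<in>B. \<lfloor>2 ^ n * L c b\<rfloor>)"
  show "graph L \<in> cell n g"
    unfolding cell_def using assms by (auto simp: g_def intro!: exI[of _ L])
  show "g \<in> grid C B n"
  proof (unfold g_def, intro restrict_PiE_iff[THEN iffD2] ballI)
    fix c b assume "c \<in> C" "b \<in> B"
    then have L: "- 1 \<le> L c b" "L c b \<le> 1" using assms by (auto simp: abs_le_iff)
    have "- (2 ^ n) \<le> 2 ^ n * L c b" "2 ^ n * L c b \<le> 2 ^ n"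
      using mult_left_mono[OF L(1), of "2 ^ n"] mult_left_mono[OF L(2), of "2 ^ n"] by auto
    moreover have "real_of_int (- (2 ^ n)) = - (2 ^ n)" "real_of_int (2 ^ n + 1) = 2 ^ n + 1" by simp_all
    ultimately have "real_of_int (- (2 ^ n)) \<le> 2 ^ n * L c b" "2 ^ n * L c b < real_of_int (2 ^ n + 1)"
      by linarith+
    then show "\<lfloor>2 ^ n * L c b\<rfloor> \<in> grid_ints n"
      unfolding atLeastAtMost_iff le_floor_iff floor_le_iff by simp
  qed
qed

end

text \<open>A finite net splits \<open>A\<close> into pieces, each lying in the chart of one plane
  \<open>W\<close>; there the cells containing a bad plane of their own level cover the piece
  infinitely often, as the limsup lemma requires.\<close>

lemma hausdorff_measure_grassmannian_zero:
  fixes A :: "'a::euclidean_space set set" and bad :: "nat \<Rightarrow> 'a set \<Rightarrow> bool"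
  assumes A: "A \<subseteq> grassmannian k" and k: "k \<le> DIM('a)"
    and io: "\<And>V m. V \<in> A \<Longrightarrow> \<exists>n\<ge>m. bad n V"
    and count: "\<And>B C :: 'a set. orthonormal_split B C \<Longrightarrow> card B = k \<Longrightarrow> card C = DIM('a) - k \<Longrightarrow>
      \<exists>K. \<forall>n\<ge>1. real (card {g \<in> grid C B n. \<exists>V \<in> orthonormal_split.cell B C n g. V \<in> grassmannian k \<and> bad n V})
        \<le> K * 2 powr (real n * a)"
    and t: "a < t" "0 < t"
  shows "hausdorff_measure grassmann_dist t A = 0"
proof (cases "A = {}")
  case True
  show ?thesis unfolding True
    by (rule hausdorff_measure_zeroI) (rule exI[of _ "\<lambda>_. {}"], simp)
next
  case False
  obtain T :: "'a set set" where T: "finite T" "T \<subseteq> grassmannian k"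
    "\<And>V. V \<in> grassmannian k \<Longrightarrow> \<exists>W\<in>T. grassmann_dist V W \<le> 1/2"
    using grassmannian_finite_net by metis
  have "T \<noteq> {}" using False T(3) A by blast
  have zero: "hausdorff_measure grassmann_dist t {V \<in> A. grassmann_dist V W \<le> 1/2} = 0" if W: "W \<in> T" for W
  proof -
    obtain B C where BC: "orthonormal_split B C" "span B = W" "card B = k" "card C = DIM('a) - k"
      using orthonormal_split_exists W T(2) by (metis subsetD)
    interpret orthonormal_split B C by fact
    obtain K where K: "\<And>n. 1 \<le> n \<Longrightarrow> real (card {g \<in> grid C B n. \<exists>V \<in> cell n g. V \<in> grassmannian k \<and> bad n V})
        \<le> K * 2 powr (real n * a)"
      using count[OF BC(1,3,4)] by blast
    \<comment> \<open>Level 0 is left empty because the count starts at 1: frequencies in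
      \<open>annulus 0\<close> have no lower bound on their length.\<close>
    define Z where "Z n = (if n = 0 then {} else {g \<in> grid C B n. \<exists>V \<in> cell n g. V \<in> grassmannian k \<and> bad n V})" for n
    show ?thesis
    proof (rule hausdorff_measure_limsup_zero)
      show "finite (Z n)" for n
        using finite_grid[OF finite_B finite_C] by (simp add: Z_def)
      show "grassmann_dist V V' \<le> 2 * real (card B) * real (card C) * (1/2) ^ n"
        if "g \<in> Z n" "V \<in> cell n g" "V' \<in> cell n g" for n g V V'
        using that by (intro grassmann_dist_cell)
      show "real (card (Z n)) \<le> max 0 K * 2 powr (real n * a)" for n
      proof (cases "n = 0")
        case False
        then have "real (card (Z n)) \<le> K * 2 powr (real n * a)" using K[of n] by (simp add: Z_def)
        also have "\<dots> \<le> max 0 K * 2 powr (real n * a)" by (intro mult_right_mono) auto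
        finally show ?thesis .
      qed (simp add: Z_def)
      show "\<exists>n\<ge>m. \<exists>g\<in>Z n. V \<in> cell n g" if V: "V \<in> {V \<in> A. grassmann_dist V W \<le> 1/2}" for V m
      proof -
        have VG: "V \<in> grassmannian k" using V A by auto
        obtain n where n: "n \<ge> max 1 m" "bad n V" using io V by blast
        obtain L where L: "V = graph L" "\<And>c b. c \<in> C \<Longrightarrow> b \<in> B \<Longrightarrow> \<bar>L c b\<bar> \<le> 1"
          using graph_representation[of V] V VG W T(2) BC by auto
        then obtain g where "g \<in> grid C B n" "V \<in> cell n g" using graph_in_cell by metis
        then show ?thesis using n VG by (intro exI[of _ n]) (auto simp: Z_def)
      qed
    qed (use t in auto)
  qed
  have "range (from_nat_into T) = T"
    using \<open>T \<noteq> {}\<close> T(1) by (intro range_from_nat_into countable_finite)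
  then have "A = (\<Union>i. {V \<in> A. grassmann_dist V (from_nat_into T i) \<le> 1/2})"
    using T(3) A by (auto simp: subset_eq) (metis rangeE)
  moreover have "hausdorff_measure grassmann_dist t (\<Union>i. {V \<in> A. grassmann_dist V (from_nat_into T i) \<le> 1/2}) = 0"
    using \<open>range (from_nat_into T) = T\<close> by (intro hausdorff_measure_zero_UN zero) auto
  ultimately show ?thesis by simp
qed

text \<open>With every plane declared bad, the count is the number of all cells, of order
  \<open>2 ^ n\<close> to the power \<open>k * (d - k)\<close>.\<close>

lemma hausdorff_dim_grassmannian_le:
  fixes A :: "'a::euclidean_space set set"
  assumes "A \<subseteq> grassmannian k" "k \<le> DIM('a)"
  shows "hausdorff_dim grassmann_dist A \<le> ereal (real k * (real DIM('a) - real k))"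
proof (rule ereal_le_epsilon2)
  fix e :: real assume "0 < e"
  define a where "a = real k * (real DIM('a) - real k)"
  have a: "0 \<le> a" using assms by (simp add: a_def)
  have "hausdorff_measure grassmann_dist (a + e) A = 0"
  proof (rule hausdorff_measure_grassmannian_zero[where bad = "\<lambda>_ _. True" and a = a])
    fix B C :: "'a set" assume BC: "orthonormal_split B C" "card B = k" "card C = DIM('a) - k"
    interpret orthonormal_split B C by fact
    have "real (card {g \<in> grid C B n. \<exists>V\<in>cell n g. V \<in> grassmannian k \<and> True})
         \<le> 3 ^ (card B * card C) * 2 powr (real n * a)" for n
    proof -
      have "real (card {g \<in> grid C B n. \<exists>V\<in>cell n g. V \<in> grassmannian k \<and> True}) \<le> real (card (grid C B n))"
        using finite_grid[OF finite_B finite_C] by (intro of_nat_mono card_mono) auto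
      also have "\<dots> \<le> 3 ^ (card B * card C) * (2 ^ n) ^ (card B * card C)"
        by (rule card_grid_le[OF finite_B finite_C])
      also have "(2 ^ n :: real) ^ (card B * card C) = 2 powr (real n * a)"
        using assms(2) by (simp add: powr_realpow[symmetric] powr_powr a_def BC of_nat_diff mult.assoc)
      finally show ?thesis .
    qed
    then show "\<exists>K. \<forall>n\<ge>1. real (card {g \<in> grid C B n. \<exists>V\<in>cell n g. V \<in> grassmannian k \<and> True})
         \<le> K * 2 powr (real n * a)" by blast
  qed (use assms a \<open>0 < e\<close> in auto)
  then have "hausdorff_dim grassmann_dist A \<le> ereal (a + e)"
    using a \<open>0 < e\<close> by (intro hausdorff_dim_le) auto
  then show "hausdorff_dim grassmann_dist A \<le> ereal (real k * (real DIM('a) - real k)) + ereal e"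
    by (simp add: a_def)
qed

section \<open>Anisotropic Gaussians and the Fourier transform\<close>

lemma nn_integral_lborel_translate:
  fixes f :: "'a::euclidean_space \<Rightarrow> ennreal"
  assumes [measurable]: "f \<in> borel_measurable borel"
  shows "(\<integral>\<^sup>+x. f (c + x) \<partial>lborel) = (\<integral>\<^sup>+x. f x \<partial>lborel)"
proof -
  have "(\<integral>\<^sup>+x. f x \<partial>distr lborel borel ((+) c)) = (\<integral>\<^sup>+x. f (c + x) \<partial>lborel)"
    by (rule nn_integral_distr) auto
  then show ?thesis by (simp add: lborel_distr_plus)
qed

lemma nn_integral_lborel_reflect:
  fixes f :: "'a::euclidean_space \<Rightarrow> ennreal"
  assumes [measurable]: "f \<in> borel_measurable borel"
  shows "(\<integral>\<^sup>+x. f (c - x) \<partial>lborel) = (\<integral>\<^sup>+x. f x \<partial>lborel)"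
proof -
  have "lborel = distr lborel borel (\<lambda>x. c - x)"
    using lborel_affine[of "-1" c] by (simp add: density_1)
  moreover have "(\<integral>\<^sup>+x. f x \<partial>distr lborel borel (\<lambda>x. c - x)) = (\<integral>\<^sup>+x. f (c - x) \<partial>lborel)"
    by (rule nn_integral_distr) auto
  ultimately show ?thesis by simp
qed

text \<open>
  A translation invariant measure is a multiple of Lebesgue measure by Fubini's theorem; the unit
  ball, which every orthogonal transformation preserves, shows that the factor is one.
\<close>

lemma lborel_distr_orthogonal:
  fixes Q :: "'a::euclidean_space \<Rightarrow> 'a"
  assumes Q: "orthogonal_transformation Q"
  shows "distr lborel borel Q = lborel"
proof (rule measure_eqI)
  fix A :: "'a set" assume "A \<in> sets (distr lborel borel Q)"
  then have [measurable]: "A \<in> sets borel" by simp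
  have lin: "linear Q" by (rule orthogonal_transformation_linear[OF Q])
  have [measurable]: "Q \<in> borel_measurable borel"
    using lin by (intro borel_measurable_continuous_onI linear_continuous_on) (simp add: linear_conv_bounded_linear)
  define D where "D = ball (0::'a) 1"
  have [measurable]: "D \<in> sets borel" by (simp add: D_def)
  have QD: "indicator D (Q w) = (indicator D w :: ennreal)" for w
    using orthogonal_transformation_norm[OF Q, of w] by (simp add: D_def indicator_def)
  have inv: "Q (inv Q x) = x" for x
    using orthogonal_transformation_surj[OF Q] by (simp add: surj_f_inv_f)
  have "emeasure (distr lborel borel Q) A * emeasure lborel D
    = (\<integral>\<^sup>+w. indicator A (Q w) \<partial>lborel) * (\<integral>\<^sup>+x. indicator D x \<partial>lborel)"
    by (simp add: nn_integral_indicator[symmetric] nn_integral_distr del: nn_integral_indicator)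
  also have "\<dots> = (\<integral>\<^sup>+w. indicator A (Q w) * (\<integral>\<^sup>+x. indicator D x \<partial>lborel) \<partial>lborel)"
    by (simp add: nn_integral_multc)
  also have "\<dots> = (\<integral>\<^sup>+w. (\<integral>\<^sup>+x. indicator A (Q w) * indicator D (Q w + x) \<partial>lborel) \<partial>lborel)"
    by (subst nn_integral_cmult) (simp_all add: nn_integral_lborel_translate)
  also have "\<dots> = (\<integral>\<^sup>+x. (\<integral>\<^sup>+w. indicator A (Q w) * indicator D (Q w + x) \<partial>lborel) \<partial>lborel)"
    by (rule lborel_pair.Fubini') simp
  \<comment> \<open>As \<open>Q w + x = Q (w + inv Q x)\<close>, translating \<open>w\<close> moves
    the shift by \<open>x\<close> from the factor of \<open>D\<close> to that of
    \<open>A\<close>.\<close>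
  also have "\<dots> = (\<integral>\<^sup>+x. (\<integral>\<^sup>+w. indicator A (Q w - x) * indicator D (Q w) \<partial>lborel) \<partial>lborel)"
  proof (rule nn_integral_cong)
    fix x :: 'a
    have "(\<integral>\<^sup>+w. indicator A (Q w) * indicator D (Q w + x) \<partial>lborel)
        = (\<integral>\<^sup>+w. indicator A (Q (- inv Q x + w)) * indicator D (Q (- inv Q x + w) + x) \<partial>lborel)"
      by (rule nn_integral_lborel_translate[symmetric]) simp
    then show "(\<integral>\<^sup>+w. indicator A (Q w) * indicator D (Q w + x) \<partial>lborel)
        = (\<integral>\<^sup>+w. indicator A (Q w - x) * indicator D (Q w) \<partial>lborel)"
      by (simp add: linear_diff[OF lin] inv)
  qed
  also have "\<dots> = (\<integral>\<^sup>+w. (\<integral>\<^sup>+x. indicator A (Q w - x) * indicator D w \<partial>lborel) \<partial>lborel)"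
    unfolding QD by (rule lborel_pair.Fubini') simp
  also have "\<dots> = (\<integral>\<^sup>+w. emeasure lborel A * indicator D w \<partial>lborel)"
    using nn_integral_lborel_reflect[of "indicator A"] by (simp add: nn_integral_multc)
  also have "\<dots> = emeasure lborel A * emeasure lborel D"
    by (simp add: nn_integral_cmult)
  finally have eq: "emeasure (distr lborel borel Q) A * emeasure lborel D = emeasure lborel A * emeasure lborel D" .
  moreover have "emeasure lborel D \<noteq> \<infinity>"
    using emeasure_bounded_finite[of D] by (auto simp: D_def)
  moreover have "emeasure lborel D \<noteq> 0"
    using content_ball_pos[of 1 "0::'a"] by (auto simp: D_def measure_def)
  ultimately show "emeasure (distr lborel borel Q) A = emeasure lborel A"
    by (metis mult_divide_eq_ennreal infinity_ennreal_def)
qed simp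

lemma lborel_prod:
  fixes f :: "'a::euclidean_space \<Rightarrow> real \<Rightarrow> complex"
  assumes int: "\<And>b. b \<in> Basis \<Longrightarrow> integrable lborel (f b)"
  shows integrable_lborel_prod: "integrable lborel (\<lambda>x. \<Prod>b\<in>Basis. f b (x \<bullet> b))"
    and integral_lborel_prod: "(LINT x|lborel. (\<Prod>b\<in>Basis. f b (x \<bullet> b))) = (\<Prod>b\<in>Basis. (LINT t|lborel. f b t))"
proof -
  interpret product_sigma_finite "\<lambda>_::'a. lborel :: real measure" ..
  have [measurable]: "f b \<in> borel_measurable borel" if "b \<in> Basis" for b
    using borel_measurable_integrable[OF int[OF that]] by simp
  have [measurable]: "(\<lambda>g. \<Sum>b\<in>Basis. g b *\<^sub>R b :: 'a) \<in> (\<Pi>\<^sub>M b\<in>Basis. lborel) \<rightarrow>\<^sub>M borel"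
    by measurable
  have [measurable]: "(\<lambda>x. \<Prod>b\<in>Basis. f b (x \<bullet> b)) \<in> borel_measurable (borel :: 'a measure)"
    by measurable
  have eq: "(\<Prod>b\<in>Basis. f b ((\<Sum>c\<in>Basis. g c *\<^sub>R c) \<bullet> b)) = (\<Prod>b\<in>Basis. f b (g b))"
    for g :: "'a \<Rightarrow> real"
    by (intro prod.cong) (auto simp: inner_sum_left inner_Basis if_distrib sum.delta cong: if_cong)
  show "integrable lborel (\<lambda>x. \<Prod>b\<in>Basis. f b (x \<bullet> b))"
    by (subst lborel_eq, subst integrable_distr_eq) (auto simp: eq int intro!: product_integrable_prod)
  show "(LINT x|lborel. (\<Prod>b\<in>Basis. f b (x \<bullet> b))) = (\<Prod>b\<in>Basis. (LINT t|lborel. f b t))"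
    by (subst lborel_eq, subst integral_distr) (auto simp: eq int intro!: product_integral_prod)
qed

text \<open>Fubini's theorem in the basis \<open>B \<union> C\<close>. The map \<open>Q\<close>
  sends the standard basis bijectively to \<open>B \<union> C\<close>, is orthogonal and hence
  preserves Lebesgue measure, so the claim reduces to the standard coordinates.\<close>

lemma lborel_prod_orthonormal:
  fixes B C :: "'a::euclidean_space set"
    and f :: "'a \<Rightarrow> real \<Rightarrow> complex"
  assumes "orthonormal_split B C"
    and int: "\<And>b. b \<in> B \<union> C \<Longrightarrow> integrable lborel (f b)"
  shows integrable_lborel_prod_orthonormal: "integrable lborel (\<lambda>x. \<Prod>b\<in>B \<union> C. f b (x \<bullet> b))"
    and integral_lborel_prod_orthonormal:
      "(LINT x|lborel. (\<Prod>b\<in>B \<union> C. f b (x \<bullet> b))) = (\<Prod>b\<in>B \<union> C. (LINT t|lborel. f b t))"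
proof -
  interpret orthonormal_split B C by fact
  have fin: "finite (B \<union> C)" using finite_B finite_C by simp
  have ind: "independent (B \<union> C)"
  proof (rule pairwise_orthogonal_independent)
    show "pairwise orthogonal (B \<union> C)"
      using orthonormal by (auto simp: pairwise_def orthogonal_def)
    show "0 \<notin> B \<union> C" using norm_basis by force
  qed
  have "x \<in> span (B \<union> C)" for x :: "'a"
  proof -
    have "(\<Sum>b\<in>B. (x \<bullet> b) *\<^sub>R b) + (\<Sum>c\<in>C. (x \<bullet> c) *\<^sub>R c) \<in> span (B \<union> C)"
      by (intro span_add span_sum span_scale span_base) auto
    then show ?thesis by (simp only: representation)
  qed
  then have "card (B \<union> C) = DIM('a)"
    using dim_span_eq_card_independent[OF ind] by (metis UNIV_eq_I dim_UNIV)
  then obtain \<phi> where \<phi>: "bij_betw \<phi> (Basis :: 'a set) (B \<union> C)"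
    using fin finite_same_card_bij finite_Basis by metis
  define Q where "Q x = (\<Sum>e\<in>Basis. (x \<bullet> e) *\<^sub>R \<phi> e)" for x :: "'a"
  have \<phi>in: "\<phi> e \<in> B \<union> C" if "e \<in> Basis" for e using bij_betwE[OF \<phi>] that by blast
  have Q\<phi>: "Q x \<bullet> \<phi> e = x \<bullet> e" if e: "e \<in> Basis" for x e
  proof -
    have "Q x \<bullet> \<phi> e = (\<Sum>e'\<in>Basis. if e' = e then x \<bullet> e else 0)"
      unfolding Q_def inner_sum_left
    proof (intro sum.cong refl)
      fix e' :: "'a" assume e': "e' \<in> Basis"
      have "\<phi> e' = \<phi> e \<longleftrightarrow> e' = e"
        using bij_betw_imp_inj_on[OF \<phi>] e e' by (auto simp: inj_on_eq_iff)
      then show "(x \<bullet> e') *\<^sub>R \<phi> e' \<bullet> \<phi> e = (if e' = e then x \<bullet> e else 0)"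
        using orthonormal[OF \<phi>in[OF e'] \<phi>in[OF e]] by simp
    qed
    then show ?thesis using e by simp
  qed
  have "orthogonal_transformation Q"
    unfolding orthogonal_transformation
  proof (intro conjI allI)
    show "linear Q"
      unfolding Q_def by (intro linear_compose_sum ballI linear_compose_scale_right)
        (rule bounded_linear.linear, rule bounded_linear_scaleR_const, rule bounded_linear_inner_left)
    fix v :: "'a"
    have "(norm (Q v))\<^sup>2 = (\<Sum>b\<in>B \<union> C. (Q v \<bullet> b)\<^sup>2)"
      using finite_B finite_C disjoint by (simp add: norm_representation sum.union_disjoint)
    also have "\<dots> = (\<Sum>e\<in>Basis. (Q v \<bullet> \<phi> e)\<^sup>2)"
      by (rule sum.reindex_bij_betw[OF \<phi>, symmetric])
    also have "\<dots> = (\<Sum>e\<in>Basis. (v \<bullet> e)\<^sup>2)" by (simp add: Q\<phi>)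
    also have "\<dots> = (norm v)\<^sup>2"
      unfolding power2_norm_eq_inner euclidean_inner[of v v] by (simp add: power2_eq_square)
    finally show "norm (Q v) = norm v" by simp
  qed
  then have distr: "distr lborel borel Q = lborel" and "bounded_linear Q"
    using orthogonal_transformation_linear[of Q]
    by (simp_all add: lborel_distr_orthogonal linear_conv_bounded_linear)
  then have [measurable]: "Q \<in> borel_measurable borel"
    by (intro borel_measurable_continuous_onI linear_continuous_on)
  have [measurable]: "f b \<in> borel_measurable borel" if "b \<in> B \<union> C" for b
    using borel_measurable_integrable[OF int[OF that]] by simp
  have [measurable]: "(\<lambda>x. \<Prod>b\<in>B \<union> C. f b (x \<bullet> b)) \<in> borel_measurable borel"
    by (intro borel_measurable_prod) simp
  have eq: "(\<Prod>b\<in>B \<union> C. f b (Q x \<bullet> b)) = (\<Prod>e\<in>Basis. f (\<phi> e) (x \<bullet> e))" for x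
    by (subst prod.reindex_bij_betw[OF \<phi>, symmetric]) (simp add: Q\<phi>)
  have int': "integrable lborel (f (\<phi> e))" if "e \<in> Basis" for e using int \<phi>in[OF that] by blast
  have "integrable (distr lborel borel Q) (\<lambda>x. \<Prod>b\<in>B \<union> C. f b (x \<bullet> b))"
    using integrable_lborel_prod[OF int'] by (subst integrable_distr_eq) (simp_all add: eq)
  then show "integrable lborel (\<lambda>x. \<Prod>b\<in>B \<union> C. f b (x \<bullet> b))" by (simp add: distr)
  have "(LINT x|distr lborel borel Q. (\<Prod>b\<in>B \<union> C. f b (x \<bullet> b))) = (\<Prod>e\<in>Basis. (LINT t|lborel. f (\<phi> e) t))"
    using integral_lborel_prod[OF int'] by (subst integral_distr) (simp_all add: eq)
  also have "\<dots> = (\<Prod>b\<in>B \<union> C. (LINT t|lborel. f b t))"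
    by (rule prod.reindex_bij_betw[OF \<phi>])
  finally show "(LINT x|lborel. (\<Prod>b\<in>B \<union> C. f b (x \<bullet> b))) = (\<Prod>b\<in>B \<union> C. (LINT t|lborel. f b t))"
    by (simp add: distr)
qed

text \<open>The characteristic function of the standard normal distribution after a linear
  substitution.\<close>

lemma fourier_gaussian_real:
  fixes a x :: real
  assumes "0 < a"
  shows "has_bochner_integral lborel
    (\<lambda>t. complex_of_real (exp (- pi * (a * t)\<^sup>2)) * exp (- 2 * of_real pi * \<i> * of_real (t * x)))
    (complex_of_real (exp (- pi * (x / a)\<^sup>2) / a))"
proof -
  \<comment> \<open>The substitution \<open>y = c * t\<close> turns \<open>y\<^sup>2 / 2\<close>
    into \<open>pi * (a * t)\<^sup>2\<close>, and \<open>s\<close> is chosen so that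
    \<open>s * (c * t) = - 2 * pi * (t * x)\<close>.\<close>
  define c where "c = sqrt (2 * pi) * a"
  define s where "s = - 2 * pi * x / c"
  have c: "c > 0" "c\<^sup>2 = 2 * pi * a\<^sup>2" using assms by (auto simp: c_def power_mult_distrib)
  define f where "f y = complex_of_real (exp (- y\<^sup>2 / 2)) * iexp (s * y)" for y
  have int: "integrable lborel (\<lambda>y. complex_of_real (std_normal_density y) * iexp (s * y))"
  proof (rule Bochner_Integration.integrable_bound[OF integrable_normal_density[of 1 0]])
    show "AE y in lborel. norm (complex_of_real (std_normal_density y) * iexp (s * y))
        \<le> norm (normal_density 0 1 y)"
      by (simp add: norm_mult)
  qed simp_all
  have "char std_normal_distribution s = (LINT y|lborel. complex_of_real (std_normal_density y) * iexp (s * y))"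
    unfolding char_def by (subst integral_density) (auto simp: scaleR_conv_of_real)
  then have "has_bochner_integral lborel (\<lambda>y. complex_of_real (std_normal_density y) * iexp (s * y))
     (complex_of_real (exp (- (s\<^sup>2) / 2)))"
    using int by (simp add: has_bochner_integral_iff char_std_normal_distribution)
  then have "has_bochner_integral lborel (\<lambda>y. complex_of_real (sqrt (2*pi)) * (complex_of_real (std_normal_density y) * iexp (s * y)))
     (complex_of_real (sqrt (2*pi)) * complex_of_real (exp (- (s\<^sup>2) / 2)))"
    by (rule has_bochner_integral_mult_right)
  also have "(\<lambda>y. complex_of_real (sqrt (2*pi)) * (complex_of_real (std_normal_density y) * iexp (s * y))) = f"
    by (auto simp: f_def std_normal_density_def fun_eq_iff)
  finally have "has_bochner_integral lborel (\<lambda>t. f (0 + c * t))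
     ((complex_of_real (sqrt (2*pi)) * complex_of_real (exp (- (s\<^sup>2) / 2))) /\<^sub>R \<bar>c\<bar>)"
    using c(1) by (subst lborel_has_bochner_integral_real_affine_iff[symmetric]) auto
  moreover have "f (0 + c * t) = complex_of_real (exp (- pi * (a * t)\<^sup>2)) * exp (- 2 * of_real pi * \<i> * of_real (t * x))" for t
  proof -
    have "(c * t)\<^sup>2 / 2 = pi * (a * t)\<^sup>2" using c by (simp add: power_mult_distrib)
    moreover have "s * (c * t) = - 2 * pi * (t * x)" using c by (simp add: s_def)
    ultimately show ?thesis by (simp add: f_def mult.commute mult.left_commute)
  qed
  moreover have "(complex_of_real (sqrt (2*pi)) * complex_of_real (exp (- (s\<^sup>2) / 2))) /\<^sub>R \<bar>c\<bar>
      = complex_of_real (exp (- pi * (x / a)\<^sup>2) / a)"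
  proof -
    have "s\<^sup>2 / 2 = 2 * pi\<^sup>2 * x\<^sup>2 / c\<^sup>2" by (simp add: s_def power_divide power_mult_distrib)
    also have "\<dots> = pi * (x / a)\<^sup>2"
      unfolding c(2) using assms by (simp add: power_divide power2_eq_square)
    finally have "exp (- (s\<^sup>2) / 2) = exp (- pi * (x / a)\<^sup>2)" by simp
    moreover have "sqrt (2 * pi) / \<bar>c\<bar> = 1 / a" using assms by (simp add: c_def)
    ultimately show ?thesis
      using c by (simp add: scaleR_conv_of_real divide_inverse[symmetric] c_def)
  qed
  ultimately show ?thesis by simp
qed

text \<open>A Gaussian of width 1/r along \<open>V\<close> and width 1 across it. Its transform has
  width r along \<open>V\<close> and again 1 across, hence on bounded sets it is a smooth version of
  the indicator of the points whose projection to \<open>V\<close> has length at most r.\<close>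

definition aniso_gaussian :: "real \<Rightarrow> 'a::euclidean_space set \<Rightarrow> 'a \<Rightarrow> real" where
  "aniso_gaussian r V z = exp (- pi * (r\<^sup>2 * (norm (orth_proj V z))\<^sup>2 + (norm (z - orth_proj V z))\<^sup>2))"

definition echar :: "'a::euclidean_space \<Rightarrow> 'a \<Rightarrow> complex" where
  "echar z x = exp (- 2 * of_real pi * \<i> * of_real (z \<bullet> x))"

lemma aniso_gaussian_pos: "0 < aniso_gaussian r V z"
  by (simp add: aniso_gaussian_def)

lemma measurable_orth_proj_borel:
  "subspace V \<Longrightarrow> orth_proj V \<in> borel_measurable borel"
  by (intro borel_measurable_continuous_onI linear_continuous_on bounded_linear_orth_proj)

lemma measurable_aniso_gaussian:
  assumes "subspace V"
  shows "aniso_gaussian r V \<in> borel_measurable borel"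
proof -
  note [measurable] = measurable_orth_proj_borel[OF assms]
  show ?thesis unfolding aniso_gaussian_def by measurable
qed

text \<open>In a basis adapted to \<open>V\<close> both sides are products of one-dimensional
  Gaussians, with scale \<open>r\<close> in the \<open>k\<close> directions of \<open>V\<close> and
  1 in the others; the normalising factors multiply to \<open>r ^ k\<close>.\<close>

lemma fourier_aniso_gaussian:
  fixes V :: "'a::euclidean_space set"
  assumes V: "V \<in> grassmannian k" and r: "0 < r"
  shows "has_bochner_integral lborel (\<lambda>z. complex_of_real (aniso_gaussian r V z) * echar z x)
    (complex_of_real (aniso_gaussian (1/r) V x / r ^ k))"
proof -
  obtain B C where BC: "orthonormal_split B C" "span B = V" "card B = k" "card C = DIM('a) - k"
    using orthonormal_split_exists[OF V] .
  interpret orthonormal_split B C by fact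
  have fin: "finite (B \<union> C)" using finite_B finite_C by simp
  define a where "a b = (if b \<in> B then r else 1)" for b
  have a: "a b > 0" for b using r by (simp add: a_def)
  have aB: "(\<Sum>b\<in>B. f (a b) b) = (\<Sum>b\<in>B. f r b)" "(\<Sum>b\<in>C. f (a b) b) = (\<Sum>b\<in>C. f 1 b)"
    for f :: "real \<Rightarrow> 'a \<Rightarrow> real"
    using disjoint by (auto simp: a_def intro!: sum.cong)
  define f where "f b t = complex_of_real (exp (- pi * (a b * t)\<^sup>2)) * exp (- 2 * of_real pi * \<i> * of_real (t * (x \<bullet> b)))"
    for b t
  have f: "has_bochner_integral lborel (f b) (complex_of_real (exp (- pi * ((x \<bullet> b) / a b)\<^sup>2) / a b))" for b
    unfolding f_def by (rule fourier_gaussian_real[OF a])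
  have aniso: "aniso_gaussian s V z = exp (\<Sum>b\<in>B \<union> C. - pi * (c b * (z \<bullet> b))\<^sup>2)"
    if c: "\<And>b. b \<in> B \<Longrightarrow> c b = s" "\<And>b. b \<in> C \<Longrightarrow> c b = 1" for s c z
  proof -
    have "s\<^sup>2 * (norm (orth_proj V z))\<^sup>2 + (norm (z - orth_proj V z))\<^sup>2
      = s\<^sup>2 * (\<Sum>b\<in>B. (z \<bullet> b)\<^sup>2) + (\<Sum>b\<in>C. (z \<bullet> b)\<^sup>2)"
      unfolding BC(2)[symmetric] norm_orth_proj_span norm_minus_orth_proj_span ..
    also have "\<dots> = (\<Sum>b\<in>B \<union> C. (c b * (z \<bullet> b))\<^sup>2)"
      using c disjoint finite_B finite_C
      by (simp add: sum.union_disjoint sum_distrib_left power_mult_distrib)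
    finally show ?thesis
      unfolding aniso_gaussian_def by (simp add: sum_distrib_left)
  qed
  have "complex_of_real (aniso_gaussian r V z) * echar z x = (\<Prod>b\<in>B \<union> C. f b (z \<bullet> b))" for z
  proof -
    have "complex_of_real (aniso_gaussian r V z) = (\<Prod>b\<in>B \<union> C. complex_of_real (exp (- pi * (a b * (z \<bullet> b))\<^sup>2)))"
      using disjoint by (subst aniso[of a]) (auto simp: a_def exp_sum[OF fin])
    moreover have "echar z x = (\<Prod>b\<in>B \<union> C. exp (- 2 * of_real pi * \<i> * of_real ((z \<bullet> b) * (x \<bullet> b))))"
    proof -
      have "z \<bullet> x = (\<Sum>b\<in>B \<union> C. (z \<bullet> b) * (x \<bullet> b))"
        using inner_representation[of z x] disjoint finite_B finite_C by (simp add: sum.union_disjoint)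
      then show ?thesis by (simp only: echar_def of_real_sum sum_distrib_left exp_sum[OF fin])
    qed
    ultimately show ?thesis by (simp add: f_def prod.distrib)
  qed
  moreover have "integrable lborel (\<lambda>z. \<Prod>b\<in>B \<union> C. f b (z \<bullet> b))"
    using f by (intro integrable_lborel_prod_orthonormal BC(1)) (auto simp: has_bochner_integral_iff)
  moreover have "(LINT z|lborel. (\<Prod>b\<in>B \<union> C. f b (z \<bullet> b)))
      = (\<Prod>b\<in>B \<union> C. complex_of_real (exp (- pi * ((x \<bullet> b) / a b)\<^sup>2) / a b))"
    using f by (subst integral_lborel_prod_orthonormal[OF BC(1)])
      (auto simp: has_bochner_integral_iff intro!: prod.cong)
  moreover have "(\<Prod>b\<in>B \<union> C. complex_of_real (exp (- pi * ((x \<bullet> b) / a b)\<^sup>2) / a b))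
      = complex_of_real (aniso_gaussian (1/r) V x / r ^ k)"
  proof -
    have "(\<Prod>b\<in>B \<union> C. a b) = (\<Prod>b\<in>B. a b) * (\<Prod>b\<in>C. a b)"
      by (rule prod.union_disjoint[OF finite_B finite_C disjoint])
    also have "(\<Prod>b\<in>C. a b) = 1" using disjoint by (intro prod.neutral) (auto simp: a_def)
    also have "(\<Prod>b\<in>B. a b) = r ^ k" using BC(3) by (simp add: a_def)
    finally have A: "(\<Prod>b\<in>B \<union> C. a b) = r ^ k" by simp
    have "aniso_gaussian (1/r) V x = exp (\<Sum>b\<in>B \<union> C. - pi * (1 / a b * (x \<bullet> b))\<^sup>2)"
      using disjoint by (intro aniso) (auto simp: a_def)
    then have "aniso_gaussian (1/r) V x = (\<Prod>b\<in>B \<union> C. exp (- pi * ((x \<bullet> b) / a b)\<^sup>2))"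
      by (simp add: exp_sum[OF fin])
    then show ?thesis
      unfolding of_real_prod[symmetric] prod_dividef A by simp
  qed
  ultimately show ?thesis by (simp add: has_bochner_integral_iff)
qed

text \<open>The total mass is the value of the transform at 0.\<close>

lemma nn_integral_aniso_gaussian:
  fixes V :: "'a::euclidean_space set"
  assumes "V \<in> grassmannian k" "0 < r"
  shows "(\<integral>\<^sup>+z. ennreal (aniso_gaussian r V z) \<partial>lborel) = ennreal (1 / r ^ k)"
proof -
  have "orth_proj V 0 = 0"
    using assms(1) by (intro orth_proj_unique) (auto simp: grassmannian_def subspace_0 orthogonal_def)
  then have "aniso_gaussian (1 / r) V 0 = 1" by (simp add: aniso_gaussian_def)
  then have "has_bochner_integral lborel (\<lambda>z. complex_of_real (aniso_gaussian r V z)) (complex_of_real (1 / r ^ k))"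
    using fourier_aniso_gaussian[OF assms, of 0] by (simp add: echar_def)
  then have "has_bochner_integral lborel (aniso_gaussian r V) (1 / r ^ k)"
    using has_bochner_integral_Re by fastforce
  then have "integrable lborel (aniso_gaussian r V)" "(LINT z|lborel. aniso_gaussian r V z) = 1 / r ^ k"
    by (simp_all add: has_bochner_integral_iff)
  then show ?thesis
    using nn_integral_eq_integral[of lborel "aniso_gaussian r V"]
    by (simp add: less_imp_le[OF aniso_gaussian_pos])
qed

section \<open>Characters and a Gaussian form of Plancherel's theorem\<close>

lemma norm_echar [simp]: "norm (echar z x) = 1"
proof -
  have "echar z x = iexp (- 2 * pi * (z \<bullet> x))" by (simp add: echar_def mult.commute mult.left_commute)
  then show ?thesis by (simp only: norm_exp_i_times)
qed

lemma cnj_echar: "cnj (echar z x) = echar z (- x)"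
  by (simp add: exp_cnj echar_def)

lemma echar_diff: "echar z (x - y) = echar z x * echar z (- y)"
  by (simp add: echar_def exp_add[symmetric] inner_diff_right algebra_simps)

lemma measurable_echar [measurable (raw)]:
  "f \<in> borel_measurable M \<Longrightarrow> g \<in> borel_measurable M \<Longrightarrow> (\<lambda>x. echar (f x) (g x)) \<in> borel_measurable M"
  unfolding echar_def by measurable

lemma fourier_echar: "fourier \<mu> z = (LINT x|\<mu>. echar z x)"
  by (simp add: fourier_def echar_def)

lemma measurable_fourier:
  fixes \<mu> :: "'a::euclidean_space measure"
  assumes "finite_measure \<mu>" and [measurable_cong]: "sets \<mu> = sets borel"
  shows "fourier \<mu> \<in> borel_measurable borel"
proof -
  interpret finite_measure \<mu> by fact
  show ?thesis unfolding fourier_echar by measurable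
qed

lemma norm_fourier_le:
  fixes \<mu> :: "'a::euclidean_space measure"
  assumes "finite_measure \<mu>" and [measurable_cong]: "sets \<mu> = sets borel"
  shows "norm (fourier \<mu> z) \<le> measure \<mu> (space \<mu>)"
proof -
  interpret finite_measure \<mu> by fact
  have "norm (fourier \<mu> z) \<le> (LINT x|\<mu>. norm (echar z x))"
    unfolding fourier_echar by (rule integral_norm_bound)
  then show ?thesis by simp
qed

text \<open>Expand the squared modulus of the transform as a double integral of characters against
  \<mu> and integrate over the frequency first; the inner integral is the transform of the Gaussian
  at \<open>x - y\<close>.\<close>

lemma gaussian_energy:
  fixes \<mu> :: "'a::euclidean_space measure"
  assumes fin: "finite_measure \<mu>" and sets: "sets \<mu> = sets borel"
    and V: "V \<in> grassmannian k" and r: "0 < r"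
  shows "(\<integral>\<^sup>+x. \<integral>\<^sup>+y. ennreal (aniso_gaussian (1/r) V (x - y)) \<partial>\<mu> \<partial>\<mu>)
    = ennreal (r ^ k) * (\<integral>\<^sup>+z. ennreal (aniso_gaussian r V z * (norm (fourier \<mu> z))\<^sup>2) \<partial>lborel)"
proof -
  note sets[measurable_cong]
  interpret finite_measure \<mu> by fact
  interpret LM: pair_sigma_finite lborel \<mu> ..
  define M where "M = measure \<mu> (space \<mu>)"
  define G where "G = aniso_gaussian r V"
  define H where "H = aniso_gaussian (1/r) V"
  have subV: "subspace V" using V by (simp add: grassmannian_def)
  have [measurable]: "G \<in> borel_measurable borel" "H \<in> borel_measurable borel"
    using measurable_aniso_gaussian[OF subV] by (auto simp: G_def H_def)
  note [measurable] = measurable_fourier[OF fin sets]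
  have [measurable]: "(\<lambda>z. cnj (fourier \<mu> z)) \<in> borel_measurable borel"
    by (rule measurable_compose[OF measurable_fourier[OF fin sets]])
      (intro borel_measurable_continuous_onI continuous_intros)
  have G0: "0 < G z" and H0: "0 < H z" for z by (simp_all add: G_def H_def aniso_gaussian_pos)
  have H1: "H z \<le> 1" for z by (simp add: H_def aniso_gaussian_def)
  have intG: "integrable lborel G"
    using nn_integral_aniso_gaussian[OF V r] G0
    by (intro integrableI_nonneg) (auto simp: G_def[symmetric] intro: less_imp_le)
  have pair: "integrable (lborel \<Otimes>\<^sub>M \<mu>) (\<lambda>(z, x). G z)"
    by (rule LM.Fubini_integrable) (use intG in auto)
  \<comment> \<open>The domination for both exchanges of integrals: the Gaussian is Lebesgue
    integrable, \<mu> is finite and the remaining factor is bounded.\<close>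
  have bound: "integrable (lborel \<Otimes>\<^sub>M \<mu>) (\<lambda>(z, x). complex_of_real (G z) * h z x)"
    if [measurable]: "(\<lambda>(z, x). h z x) \<in> borel_measurable (lborel \<Otimes>\<^sub>M \<mu>)" and h: "\<And>z x. norm (h z x) \<le> K" for h K
  proof (rule Bochner_Integration.integrable_bound)
    show "integrable (lborel \<Otimes>\<^sub>M \<mu>) (\<lambda>p. K * (case p of (z, x) \<Rightarrow> G z))"
      by (intro integrable_mult_right pair)
    show "AE p in lborel \<Otimes>\<^sub>M \<mu>. norm (case p of (z, x) \<Rightarrow> complex_of_real (G z) * h z x)
        \<le> norm (K * (case p of (z, x) \<Rightarrow> G z))"
    proof (rule AE_I2, clarify)
      fix z x
      have "norm (h z x) \<le> \<bar>K\<bar>" using h[of z x] by simp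
      then show "norm (complex_of_real (G z) * h z x) \<le> norm (K * G z)"
        using G0[of z] by (simp add: norm_mult abs_mult mult.commute)
    qed
  qed measurable
  have cnjf: "cnj (fourier \<mu> z) = (LINT y|\<mu>. echar z (- y))" for z
    unfolding fourier_echar cnj_echar[symmetric] by simp
  have "complex_of_real (LINT z|lborel. G z * (norm (fourier \<mu> z))\<^sup>2)
    = (LINT z|lborel. complex_of_real (G z) * (fourier \<mu> z * cnj (fourier \<mu> z)))"
    by (simp add: integral_complex_of_real[symmetric] complex_norm_square[symmetric] del: integral_complex_of_real)
  also have "\<dots> = (LINT z|lborel. LINT x|\<mu>. complex_of_real (G z) * (echar z x * cnj (fourier \<mu> z)))"
    unfolding fourier_echar by (simp add: mult.assoc)
  also have "\<dots> = (LINT x|\<mu>. LINT z|lborel. complex_of_real (G z) * (echar z x * cnj (fourier \<mu> z)))"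
  proof (intro LM.Fubini_integral[symmetric] bound[of _ M])
    show "(\<lambda>(z, x). echar z x * cnj (fourier \<mu> z)) \<in> borel_measurable (lborel \<Otimes>\<^sub>M \<mu>)" by measurable
  qed (use norm_fourier_le[OF fin sets] in \<open>auto simp: norm_mult M_def\<close>)
  also have "\<dots> = (LINT x|\<mu>. LINT z|lborel. LINT y|\<mu>. complex_of_real (G z) * echar z (x - y))"
    unfolding cnjf echar_diff by simp
  also have "\<dots> = (LINT x|\<mu>. LINT y|\<mu>. LINT z|lborel. complex_of_real (G z) * echar z (x - y))"
    by (intro Bochner_Integration.integral_cong refl LM.Fubini_integral[symmetric] bound[of _ 1]) (auto)
  also have "\<dots> = (LINT x|\<mu>. LINT y|\<mu>. complex_of_real (H (x - y) / r ^ k))"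
    using fourier_aniso_gaussian[OF V r] unfolding G_def H_def has_bochner_integral_iff by simp
  also have "\<dots> = complex_of_real (LINT x|\<mu>. LINT y|\<mu>. H (x - y) / r ^ k)"
    by (simp only: integral_complex_of_real)
  finally have eq: "(LINT z|lborel. G z * (norm (fourier \<mu> z))\<^sup>2) = (LINT x|\<mu>. LINT y|\<mu>. H (x - y) / r ^ k)"
    by (simp only: of_real_eq_iff)
  have intHy: "integrable \<mu> (\<lambda>y. H (x - y))" for x
    using H0 H1 by (intro integrable_const_bound[of _ 1]) (auto simp: less_imp_le)
  have Hle: "(LINT y|\<mu>. H (x - y)) \<le> M" for x
  proof -
    have "(LINT y|\<mu>. H (x - y)) \<le> (LINT y|\<mu>. 1)"
      using H1 intHy by (intro integral_mono) auto
    then show ?thesis by (simp add: M_def)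
  qed
  have Hnn: "0 \<le> (LINT y|\<mu>. H (x - y))" for x
    using H0 by (intro integral_nonneg_AE) (auto simp: less_imp_le)
  have intH: "integrable \<mu> (\<lambda>x. LINT y|\<mu>. H (x - y))"
    using Hle Hnn by (intro integrable_const_bound[of _ M]) auto
  have "(\<integral>\<^sup>+x. \<integral>\<^sup>+y. ennreal (H (x - y)) \<partial>\<mu> \<partial>\<mu>) = (\<integral>\<^sup>+x. ennreal (LINT y|\<mu>. H (x - y)) \<partial>\<mu>)"
    using H0 intHy by (intro nn_integral_cong nn_integral_eq_integral) (auto simp: less_imp_le)
  also have "\<dots> = ennreal (LINT x|\<mu>. LINT y|\<mu>. H (x - y))"
    using intH Hnn by (intro nn_integral_eq_integral) auto
  also have "(LINT x|\<mu>. LINT y|\<mu>. H (x - y)) = r ^ k * (LINT z|lborel. G z * (norm (fourier \<mu> z))\<^sup>2)"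
    unfolding eq using r by simp
  also have "ennreal \<dots> = ennreal (r ^ k) * ennreal (LINT z|lborel. G z * (norm (fourier \<mu> z))\<^sup>2)"
    using r by (intro ennreal_mult') simp
  also have "ennreal (LINT z|lborel. G z * (norm (fourier \<mu> z))\<^sup>2)
    = (\<integral>\<^sup>+z. ennreal (G z * (norm (fourier \<mu> z))\<^sup>2) \<partial>lborel)"
  proof (rule nn_integral_eq_integral[symmetric])
    show "integrable lborel (\<lambda>z. G z * (norm (fourier \<mu> z))\<^sup>2)"
    proof (rule Bochner_Integration.integrable_bound)
      show "integrable lborel (\<lambda>z. G z * M\<^sup>2)" using intG by simp
      show "AE z in lborel. norm (G z * (norm (fourier \<mu> z))\<^sup>2) \<le> norm (G z * M\<^sup>2)"
      proof (rule AE_I2)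
        fix z
        have "(norm (fourier \<mu> z))\<^sup>2 \<le> M\<^sup>2"
          using norm_fourier_le[OF fin sets, of z] by (intro power_mono) (auto simp: M_def)
        then show "norm (G z * (norm (fourier \<mu> z))\<^sup>2) \<le> norm (G z * M\<^sup>2)"
          using G0[of z] by (simp add: abs_mult)
      qed
    qed measurable
    show "AE z in lborel. 0 \<le> G z * (norm (fourier \<mu> z))\<^sup>2" using G0 by (auto simp: less_imp_le)
  qed
  finally show ?thesis by (simp add: G_def H_def)
qed

section \<open>Fourier energy near a subspace\<close>

text \<open>\<open>annulus 0\<close> is the whole open unit ball, so that the annuli partition the
  space. Lower bounds on \<open>norm z\<close> hold only from level 1 on.\<close>

definition annulus :: "nat \<Rightarrow> 'a::real_normed_vector set" where
  "annulus n = {z. norm z < 2 ^ n \<and> (0 < n \<longrightarrow> 2 ^ n \<le> 2 * norm z)}"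

lemma annulus_borel [measurable]: "annulus n \<in> sets (borel :: 'a::euclidean_space measure)"
  unfolding annulus_def by measurable

lemma disjoint_annulus: "disjoint_family (annulus :: nat \<Rightarrow> 'a::real_normed_vector set)"
  unfolding disjoint_family_on_def
proof (intro ballI impI)
  have *: "annulus m \<inter> annulus n = ({} :: 'a set)" if "m < n" for m n
  proof -
    have "(2::real) ^ Suc m \<le> 2 ^ n" using that by (intro power_increasing) auto
    then show ?thesis using that by (force simp: annulus_def)
  qed
  fix m n :: nat assume "m \<noteq> n"
  then show "annulus m \<inter> annulus n = ({} :: 'a set)"
    using *[of m n] *[of n m] by (cases "m < n") auto
qed

lemma UN_annulus: "(\<Union>n. annulus n) = (UNIV :: 'a::real_normed_vector set)"
proof -
  have "\<exists>n. z \<in> annulus n" for z :: 'a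
  proof -
    define n where "n = (LEAST n. norm z < 2 ^ n)"
    have ex: "\<exists>n. norm z < 2 ^ n" using real_arch_pow[of 2 "norm z"] by auto
    have "norm z < 2 ^ n" unfolding n_def by (rule LeastI_ex[OF ex])
    moreover have "2 ^ n \<le> 2 * norm z" if "0 < n"
    proof -
      have "\<not> norm z < 2 ^ (n - 1)" using that unfolding n_def by (intro not_less_Least) auto
      then show ?thesis using that by (cases n) auto
    qed
    ultimately show ?thesis by (auto simp: annulus_def)
  qed
  then show ?thesis by blast
qed

lemma nn_integral_annulus:
  fixes f :: "'a::euclidean_space \<Rightarrow> ennreal"
  assumes [measurable]: "f \<in> borel_measurable borel"
  shows "(\<integral>\<^sup>+z. f z \<partial>lborel) = (\<Sum>n. \<integral>\<^sup>+z\<in>annulus n. f z \<partial>lborel)"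
proof -
  have "(\<integral>\<^sup>+z. f z \<partial>lborel) = (\<integral>\<^sup>+z\<in>(\<Union>n. annulus n). f z \<partial>lborel)"
    by (simp add: UN_annulus)
  also have "\<dots> = (\<Sum>n. \<integral>\<^sup>+z\<in>annulus n. f z \<partial>lborel)"
    by (rule nn_integral_disjoint_family) (auto intro: disjoint_annulus)
  finally show ?thesis .
qed

text \<open>The exponent is half that of \<open>aniso_gaussian\<close> across \<open>V\<close>; the
  other half is kept to produce decay in the length of the frequency.\<close>

definition tube :: "'a::euclidean_space set \<Rightarrow> 'a \<Rightarrow> real" where
  "tube V z = exp (- (pi / 2) * (norm (z - orth_proj V z))\<^sup>2)"

lemma tube_pos: "0 < tube V z"
  by (simp add: tube_def)

lemma measurable_tube:
  assumes "subspace V"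
  shows "tube V \<in> borel_measurable borel"
proof -
  note [measurable] = measurable_orth_proj_borel[OF assms]
  show ?thesis unfolding tube_def by measurable
qed

lemma nn_integral_lborel_scale:
  fixes f :: "'a::euclidean_space \<Rightarrow> ennreal"
  assumes [measurable]: "f \<in> borel_measurable borel" and c: "0 < c"
  shows "(\<integral>\<^sup>+z. f z \<partial>lborel) = ennreal (c ^ DIM('a)) * (\<integral>\<^sup>+z. f (c *\<^sub>R z) \<partial>lborel)"
proof -
  have "(\<integral>\<^sup>+z. f z \<partial>lborel) = (\<integral>\<^sup>+z. f z \<partial>density (distr lborel borel (\<lambda>x. 0 + c *\<^sub>R x)) (\<lambda>_. \<bar>c\<bar> ^ DIM('a)))"
    using c by (subst lborel_affine[of c 0]) auto
  also have "\<dots> = (\<integral>\<^sup>+z. ennreal (c ^ DIM('a)) * f z \<partial>distr lborel borel (\<lambda>x. c *\<^sub>R x))"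
    using c by (subst nn_integral_density) auto
  also have "\<dots> = (\<integral>\<^sup>+z. ennreal (c ^ DIM('a)) * f (c *\<^sub>R z) \<partial>lborel)"
    by (subst nn_integral_distr) auto
  also have "\<dots> = ennreal (c ^ DIM('a)) * (\<integral>\<^sup>+z. f (c *\<^sub>R z) \<partial>lborel)"
    by (rule nn_integral_cmult) auto
  finally show ?thesis .
qed

text \<open>On the annulus the tube weight is at most \<open>exp (pi / 2)\<close> times an
  anisotropic Gaussian of length \<open>2 ^ n\<close> along \<open>V\<close>: adding that direction
  costs a bounded factor, as |z| < 2^n. The scaling by \<open>1 / sqrt 2\<close> converts the
  exponent \<open>pi / 2\<close> into \<open>pi\<close>.\<close>

lemma nn_integral_tube_annulus_le:
  obtains W :: real where "0 < W"
    "\<And>(V :: 'a::euclidean_space set) n. V \<in> grassmannian k \<Longrightarrow>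
      (\<integral>\<^sup>+z\<in>annulus n. ennreal (tube V z) \<partial>lborel) \<le> ennreal (W * (2 ^ n) ^ k)"
proof
  define c :: real where "c = 1 / sqrt 2"
  have c: "0 < c" "c\<^sup>2 = 1 / 2" by (auto simp: c_def power_divide)
  define W where "W = exp (pi / 2) / c ^ DIM('a)"
  show "0 < W" using c by (simp add: W_def)
  fix V :: "'a set" and n assume V: "V \<in> grassmannian k"
  have subV: "subspace V" using V by (simp add: grassmannian_def)
  define r :: real where "r = 1 / 2 ^ n"
  have r: "0 < r" by (simp add: r_def)
  note [measurable] = measurable_aniso_gaussian[OF subV, of r]
  have le: "ennreal (tube V z) * indicator (annulus n) z \<le> ennreal (exp (pi / 2)) * ennreal (aniso_gaussian r V (c *\<^sub>R z))" for z
  proof (cases "z \<in> annulus n")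
    case True
    have P: "orth_proj V (c *\<^sub>R z) = c *\<^sub>R orth_proj V z" by (rule linear_scale[OF linear_orth_proj[OF subV]])
    have "r * norm (orth_proj V z) \<le> r * norm z" using norm_orth_proj_le[OF subV] r by (intro mult_left_mono) auto
    also have "\<dots> \<le> 1" using True by (simp add: annulus_def r_def)
    finally have "(r * norm (orth_proj V z))\<^sup>2 \<le> 1" using r by (intro power_le_one) auto
    then have "pi / 2 * (r * norm (orth_proj V z))\<^sup>2 \<le> pi / 2 * 1" by (intro mult_left_mono) auto
    moreover have "pi * (r\<^sup>2 * (norm (c *\<^sub>R orth_proj V z))\<^sup>2 + (norm (c *\<^sub>R z - c *\<^sub>R orth_proj V z))\<^sup>2)
      = pi / 2 * (r * norm (orth_proj V z))\<^sup>2 + pi / 2 * (norm (z - orth_proj V z))\<^sup>2"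
    proof -
      have "norm (c *\<^sub>R orth_proj V z) = c * norm (orth_proj V z)"
        "norm (c *\<^sub>R z - c *\<^sub>R orth_proj V z) = c * norm (z - orth_proj V z)"
        using c by (simp_all add: scaleR_diff_right[symmetric] del: scaleR_diff_right)
      then show ?thesis by (simp only: power_mult_distrib c(2)) (simp add: field_simps)
    qed
    ultimately have "tube V z \<le> exp (pi / 2) * aniso_gaussian r V (c *\<^sub>R z)"
      unfolding tube_def aniso_gaussian_def P exp_add[symmetric] by (intro exp_mono) simp
    then show ?thesis using True by (simp add: ennreal_mult'[symmetric] ennreal_leI)
  qed simp
  have "(\<integral>\<^sup>+z\<in>annulus n. ennreal (tube V z) \<partial>lborel)
    \<le> (\<integral>\<^sup>+z. ennreal (exp (pi / 2)) * ennreal (aniso_gaussian r V (c *\<^sub>R z)) \<partial>lborel)"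
    by (intro nn_integral_mono le)
  also have "\<dots> = ennreal (exp (pi / 2)) * (\<integral>\<^sup>+z. ennreal (aniso_gaussian r V (c *\<^sub>R z)) \<partial>lborel)"
    by (rule nn_integral_cmult) simp
  also have "(\<integral>\<^sup>+z. ennreal (aniso_gaussian r V (c *\<^sub>R z)) \<partial>lborel) = ennreal (1 / c ^ DIM('a)) * ennreal (1 / r ^ k)"
  proof -
    have "ennreal (1 / r ^ k) = ennreal (c ^ DIM('a)) * (\<integral>\<^sup>+z. ennreal (aniso_gaussian r V (c *\<^sub>R z)) \<partial>lborel)"
      using nn_integral_lborel_scale[of "\<lambda>z. ennreal (aniso_gaussian r V z)" c] c nn_integral_aniso_gaussian[OF V r]
      by simp
    then have "ennreal (1 / c ^ DIM('a)) * ennreal (1 / r ^ k)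
      = ennreal (1 / c ^ DIM('a)) * ennreal (c ^ DIM('a)) * (\<integral>\<^sup>+z. ennreal (aniso_gaussian r V (c *\<^sub>R z)) \<partial>lborel)"
      by (simp add: mult.assoc)
    also have "ennreal (1 / c ^ DIM('a)) * ennreal (c ^ DIM('a)) = 1"
      using c by (subst ennreal_mult'[symmetric]) auto
    finally show ?thesis by simp
  qed
  also have "ennreal (exp (pi / 2)) * (ennreal (1 / c ^ DIM('a)) * ennreal (1 / r ^ k)) = ennreal (W * (2 ^ n) ^ k)"
    using c by (simp add: ennreal_mult'[symmetric] W_def r_def power_divide)
  finally show "(\<integral>\<^sup>+z\<in>annulus n. ennreal (tube V z) \<partial>lborel) \<le> ennreal (W * (2 ^ n) ^ k)" .
qed

text \<open>For \<open>r \<le> 1\<close> half of the Gaussian exponent dominates half of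
  \<open>pi * (r * norm z)\<^sup>2\<close>, the rest dominates the tube exponent. The first half
  decays faster than any power of \<open>r * 2 ^ n\<close>, so any \<open>p\<close> up to
  \<open>k\<close> may be extracted.\<close>

lemma aniso_gaussian_le_tube:
  assumes V: "subspace V" and r: "0 < r" "r \<le> 1" and p: "0 \<le> p" "p \<le> real k"
    and z: "z \<in> annulus n"
  shows "aniso_gaussian r V z \<le> (1 + fact k * (8 / pi) ^ k * exp (pi / 8)) * (r * 2 ^ n) powr (- p) * tube V z"
proof -
  define K where "K = fact k * (8 / pi) ^ k * exp (pi / 8)"
  have K: "0 \<le> K" by (simp add: K_def)
  define y where "y = r * 2 ^ n"
  have y: "0 < y" using r by (simp add: y_def)
  define E where "E = exp (- (pi / 2) * (r * norm z)\<^sup>2)"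
  have "pi * (r\<^sup>2 * (norm (orth_proj V z))\<^sup>2 + (norm (z - orth_proj V z))\<^sup>2)
    \<ge> (pi / 2) * (r * norm z)\<^sup>2 + (pi / 2) * (norm (z - orth_proj V z))\<^sup>2"
  proof -
    define a where "a = (norm (orth_proj V z))\<^sup>2"
    define b where "b = (norm (z - orth_proj V z))\<^sup>2"
    have ab: "0 \<le> a" "0 \<le> b" by (auto simp: a_def b_def)
    have r2: "r\<^sup>2 \<le> 1" using r by (intro power_le_one) auto
    have "(r * norm z)\<^sup>2 = r\<^sup>2 * a + r\<^sup>2 * b"
      using norm_orth_proj_Pythagorean[OF V, of z] by (simp add: a_def b_def power_mult_distrib distrib_left)
    also have "\<dots> \<le> r\<^sup>2 * a + 1 * b" using r2 ab by (intro add_mono mult_right_mono) auto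
    finally have "(r * norm z)\<^sup>2 + b \<le> 2 * (r\<^sup>2 * a + b)"
      using ab mult_nonneg_nonneg[OF zero_le_power2[of r] ab(1)]
      unfolding distrib_left mult_1 by linarith
    then have "(pi / 2) * ((r * norm z)\<^sup>2 + b) \<le> (pi / 2) * (2 * (r\<^sup>2 * a + b))" by (intro mult_left_mono) auto
    then show ?thesis by (simp add: a_def b_def algebra_simps)
  qed
  then have "aniso_gaussian r V z \<le> E * tube V z"
    unfolding aniso_gaussian_def tube_def E_def exp_add[symmetric] by (intro exp_mono) simp
  moreover have "E \<le> (1 + K) * y powr (- p)"
  proof (cases "n = 0")
    \<comment> \<open>Here no lower bound on |z| is available, but \<open>y = r \<le> 1\<close>
      makes \<open>y powr (- p)\<close> at least 1.\<close>
    case True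
    have "y powr p \<le> 1" using True r p y by (intro powr_le1) (auto simp: y_def)
    then have "1 \<le> y powr (- p)" using y by (simp add: powr_minus one_le_inverse_iff)
    moreover have "E \<le> 1" by (simp add: E_def)
    ultimately have "E \<le> 1 * y powr (- p)" by simp
    also have "\<dots> \<le> (1 + K) * y powr (- p)" using K by (intro mult_right_mono) auto
    finally show ?thesis .
  next
    case False
    have "y / 2 \<le> r * norm z" using False z r by (simp add: y_def annulus_def)
    then have "(y / 2)\<^sup>2 \<le> (r * norm z)\<^sup>2" using y by (intro power_mono) auto
    then have "(pi / 2) * (y / 2)\<^sup>2 \<le> (pi / 2) * (r * norm z)\<^sup>2" by (intro mult_left_mono) auto
    then have E: "E \<le> exp (- (pi / 8 * y\<^sup>2))" by (simp add: E_def power_divide)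
    \<comment> \<open>Passing to the base \<open>1 + y\<^sup>2\<close>, which is at least 1, allows
      the real exponent \<open>p\<close> to be raised to the integer \<open>k\<close>, where the
      exponential series applies.\<close>
    have "y powr p \<le> (1 + y\<^sup>2) powr p"
    proof (intro powr_mono2 p)
      have "0 \<le> (y - 1)\<^sup>2" by simp
      then have "2 * y \<le> 1 + y\<^sup>2" by (simp add: power2_diff)
      then show "y \<le> 1 + y\<^sup>2" using y by simp
    qed (use y in auto)
    also have "\<dots> \<le> (1 + y\<^sup>2) powr real k" using p by (intro powr_mono) auto
    also have "\<dots> = (1 + y\<^sup>2) ^ k" by (rule powr_realpow) (simp add: add_pos_nonneg)
    also have "\<dots> = (8 / pi) ^ k * (pi / 8 * (1 + y\<^sup>2)) ^ k"
      unfolding power_mult_distrib[symmetric] mult.assoc[symmetric] by simp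
    also have "\<dots> \<le> (8 / pi) ^ k * (fact k * exp (pi / 8 * (1 + y\<^sup>2)))"
      by (intro mult_left_mono power_le_fact_exp) auto
    also have "\<dots> = K * exp (pi / 8 * y\<^sup>2)" by (simp add: K_def distrib_left exp_add)
    finally have "y powr p * E \<le> (K * exp (pi / 8 * y\<^sup>2)) * exp (- (pi / 8 * y\<^sup>2))"
      using E K by (intro mult_mono) (auto simp: E_def)
    also have "\<dots> = K" by (simp add: exp_minus)
    finally have "y powr p * E \<le> 1 + K" by simp
    then show ?thesis using y by (simp add: powr_minus divide_inverse[symmetric] pos_le_divide_eq mult.commute)
  qed
  ultimately have "aniso_gaussian r V z \<le> ((1 + K) * y powr (- p)) * tube V z"
    by (meson mult_right_mono order.trans tube_pos less_imp_le)
  then show ?thesis by (simp add: K_def y_def)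
qed

definition tube_energy :: "'a::euclidean_space measure \<Rightarrow> nat \<Rightarrow> 'a set \<Rightarrow> ennreal" where
  "tube_energy \<mu> n V = (\<integral>\<^sup>+z\<in>annulus n. ennreal (tube V z * (norm (fourier \<mu> z))\<^sup>2) \<partial>lborel)"

text \<open>With \<open>p = k - w\<close> the annulus of level n contributes at most a multiple of
  r^(-p) 2^(-n p) 2^(n (k - u)) = r^(w - k) 2^(n (w - u)), summable since \<open>w < u\<close>. The
  factor \<open>r ^ k\<close> of \<open>gaussian_energy\<close> leaves
  \<open>r powr w\<close>.\<close>

lemma gaussian_energy_le:
  fixes \<mu> :: "'a::euclidean_space measure"
  assumes fin: "finite_measure \<mu>" and sets: "sets \<mu> = sets borel"
    and V: "V \<in> grassmannian k" and w: "0 \<le> w" "w < u" "u \<le> real k" and K: "0 \<le> K"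
    and energy: "\<And>n. tube_energy \<mu> n V \<le> ennreal (K * 2 powr (real n * (real k - u)))"
  obtains D where "0 \<le> D" "\<And>r. 0 < r \<Longrightarrow> r \<le> 1 \<Longrightarrow>
    (\<integral>\<^sup>+x. \<integral>\<^sup>+y. ennreal (aniso_gaussian (1/r) V (x - y)) \<partial>\<mu> \<partial>\<mu>) \<le> ennreal (D * r powr w)"
proof
  define A where "A = 1 + fact k * (8 / pi) ^ k * exp (pi / 8)"
  have A: "0 \<le> A" by (simp add: A_def)
  define q where "q = 2 powr (w - u)"
  have q: "0 < q" "q < 1" using w by (auto simp: q_def powr_less_one)
  define p where "p = real k - w"
  have p: "0 \<le> p" "p \<le> real k" using w by (auto simp: p_def)
  have subV: "subspace V" using V by (simp add: grassmannian_def)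
  note [measurable] = measurable_aniso_gaussian[OF subV] measurable_tube[OF subV] measurable_fourier[OF fin sets]
  show "0 \<le> A * K / (1 - q)" using A K q by auto
  fix r :: real assume r: "0 < r" "r \<le> 1"
  have "(\<integral>\<^sup>+z. ennreal (aniso_gaussian r V z * (norm (fourier \<mu> z))\<^sup>2) \<partial>lborel)
    = (\<Sum>n. \<integral>\<^sup>+z\<in>annulus n. ennreal (aniso_gaussian r V z * (norm (fourier \<mu> z))\<^sup>2) \<partial>lborel)"
    by (rule nn_integral_annulus) simp
  also have "\<dots> \<le> (\<Sum>n. ennreal (A * K * r powr (- p) * q ^ n))"
  proof (intro suminf_le allI)
    fix n
    define c where "c = A * (r * 2 ^ n) powr (- p)"
    have c: "0 \<le> c" using A by (simp add: c_def)
    have "(\<integral>\<^sup>+z\<in>annulus n. ennreal (aniso_gaussian r V z * (norm (fourier \<mu> z))\<^sup>2) \<partial>lborel)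
      \<le> (\<integral>\<^sup>+z. ennreal c * (ennreal (tube V z * (norm (fourier \<mu> z))\<^sup>2) * indicator (annulus n) z) \<partial>lborel)"
    proof (intro nn_integral_mono)
      fix z :: 'a
      show "ennreal (aniso_gaussian r V z * (norm (fourier \<mu> z))\<^sup>2) * indicator (annulus n) z
        \<le> ennreal c * (ennreal (tube V z * (norm (fourier \<mu> z))\<^sup>2) * indicator (annulus n) z)"
      proof (cases "z \<in> annulus n")
        case True
        have "aniso_gaussian r V z * (norm (fourier \<mu> z))\<^sup>2 \<le> (c * tube V z) * (norm (fourier \<mu> z))\<^sup>2"
          using aniso_gaussian_le_tube[OF subV r p True] by (intro mult_right_mono) (auto simp: c_def A_def)
        then show ?thesis using True c by (simp add: ennreal_mult'[symmetric] ennreal_leI mult.assoc)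
      qed simp
    qed
    also have "\<dots> = ennreal c * tube_energy \<mu> n V"
      unfolding tube_energy_def by (rule nn_integral_cmult) simp
    also have "\<dots> \<le> ennreal c * ennreal (K * 2 powr (real n * (real k - u)))"
      by (intro mult_left_mono energy) auto
    also have "\<dots> = ennreal (c * (K * 2 powr (real n * (real k - u))))"
      using c K by (intro ennreal_mult'[symmetric]) auto
    also have "c * (K * 2 powr (real n * (real k - u))) = A * K * r powr (- p) * (2 powr (real n * (- p)) * 2 powr (real n * (real k - u)))"
      using r by (simp add: c_def powr_mult powr_realpow[symmetric] powr_powr)
    also have "2 powr (real n * (- p)) * 2 powr (real n * (real k - u)) = 2 powr ((w - u) * real n)"
      unfolding powr_add[symmetric] p_def by (simp add: algebra_simps)
    also have "\<dots> = q ^ n" by (simp add: q_def powr_powr[symmetric] powr_realpow)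
    finally show "(\<integral>\<^sup>+z\<in>annulus n. ennreal (aniso_gaussian r V z * (norm (fourier \<mu> z))\<^sup>2) \<partial>lborel)
      \<le> ennreal (A * K * r powr (- p) * q ^ n)" .
  qed auto
  also have "\<dots> = ennreal (\<Sum>n. A * K * r powr (- p) * q ^ n)"
    using q A K by (intro suminf_ennreal2 summable_mult summable_geometric) auto
  also have "(\<Sum>n. A * K * r powr (- p) * q ^ n) = A * K / (1 - q) * r powr (- p)"
    using q by (subst suminf_mult) (auto simp: suminf_geometric summable_geometric)
  finally have le: "(\<integral>\<^sup>+z. ennreal (aniso_gaussian r V z * (norm (fourier \<mu> z))\<^sup>2) \<partial>lborel)
    \<le> ennreal (A * K / (1 - q) * r powr (- p))" .
  have "(\<integral>\<^sup>+x. \<integral>\<^sup>+y. ennreal (aniso_gaussian (1/r) V (x - y)) \<partial>\<mu> \<partial>\<mu>)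
    \<le> ennreal (r ^ k) * ennreal (A * K / (1 - q) * r powr (- p))"
    unfolding gaussian_energy[OF fin sets V r(1)] using le by (intro mult_left_mono) auto
  also have "\<dots> = ennreal (A * K / (1 - q) * (r powr real k * r powr (- p)))"
    using r by (simp add: ennreal_mult'[symmetric] powr_realpow ac_simps)
  also have "r powr real k * r powr (- p) = r powr w" by (simp add: powr_add[symmetric] p_def)
  finally show "(\<integral>\<^sup>+x. \<integral>\<^sup>+y. ennreal (aniso_gaussian (1/r) V (x - y)) \<partial>\<mu> \<partial>\<mu>)
    \<le> ennreal (A * K / (1 - q) * r powr w)" .
qed

section \<open>Dimension of projected measures\<close>

lemma small_scale_exists:
  fixes \<rho> :: real
  assumes "0 < \<rho>" "\<rho> \<le> 1"
  obtains m :: nat where "\<rho> \<le> 1 / 2 ^ m" "1 / 2 ^ m \<le> 2 * \<rho>"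
proof -
  define m where "m = (LEAST m. (1/2) ^ Suc m < \<rho>)"
  obtain j :: nat where "(1/2) ^ j < \<rho>" using real_arch_pow_inv[of \<rho> "1/2"] assms by auto
  moreover have "(1/2::real) ^ Suc j \<le> (1/2) ^ j" by (intro power_decreasing) auto
  ultimately have "(1/2) ^ Suc j < \<rho>" by linarith
  then have ex: "\<exists>m. (1/2) ^ Suc m < \<rho>" ..
  have 1: "(1/2) ^ Suc m < \<rho>" unfolding m_def by (rule LeastI_ex[OF ex])
  have 2: "\<rho> \<le> (1/2) ^ m"
  proof (cases m)
    case (Suc i)
    have "\<not> (1/2) ^ Suc i < \<rho>" using Suc unfolding m_def by (intro not_less_Least) auto
    then show ?thesis using Suc by simp
  qed (use assms in simp)
  show thesis using 1 2 by (intro that[of m]) (auto simp: power_one_over)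
qed

lemma ediam_finite_dist:
  assumes "ediam dist U \<le> 1" "x \<in> U" "y \<in> U"
  shows "dist x y \<le> enn2real (ediam dist U)"
proof -
  have "ennreal (dist x y) \<le> ediam dist U"
    unfolding ediam_def using assms by (intro SUP_upper2[of x] SUP_upper2[of y]) auto
  moreover have "ediam dist U < top" using assms(1) by (simp add: le_less_trans)
  ultimately show ?thesis by (metis enn2real_ennreal enn2real_mono zero_le_dist)
qed

text \<open>A ball in \<open>V\<close> is tested through its preimage, a slab in the ambient space.
  The hypothesis controls slab masses only on average, so the argument takes place on a part of the
  preimage of \<open>Y\<close> that has positive measure and on which all dyadic scales are
  controlled pointwise.\<close>

lemma measure_hausdorff_dim_ge:
  fixes \<mu> :: "'a::euclidean_space measure"
  assumes fin: "finite_measure \<mu>" and sets: "sets \<mu> = sets borel"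
    and supp: "AE x in \<mu>. norm x \<le> R" and V: "V \<in> grassmannian k" and D: "0 \<le> D"
    and energy: "\<And>r. 0 < r \<Longrightarrow> r \<le> 1 \<Longrightarrow>
    (\<integral>\<^sup>+x. \<integral>\<^sup>+y. ennreal (aniso_gaussian (1/r) V (x - y)) \<partial>\<mu> \<partial>\<mu>) \<le> ennreal (D * r powr w)"
  shows "ereal w \<le> measure_hausdorff_dim (proj_measure V \<mu>)"
  unfolding measure_hausdorff_dim_def
proof (rule Inf_greatest, clarify, rule ccontr)
  fix Y assume Y: "Y \<in> sets (proj_measure V \<mu>)" "0 < emeasure (proj_measure V \<mu>) Y"
    and "\<not> ereal w \<le> hausdorff_dim dist Y"
  then have "hausdorff_dim dist Y < ereal w" by simp
  then obtain s where s: "0 \<le> s" "s < w" "hausdorff_measure dist s Y = 0"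
    unfolding hausdorff_dim_def Inf_less_iff by auto
  note sets[measurable_cong]
  interpret finite_measure \<mu> by fact
  have subV: "subspace V" using V by (simp add: grassmannian_def)
  note [measurable] = measurable_aniso_gaussian[OF subV] measurable_orth_proj_borel[OF subV]
  have space: "space \<mu> = UNIV" using sets_eq_imp_space_eq[OF sets] by simp
  define f where "f m x = (\<integral>\<^sup>+y. ennreal (aniso_gaussian (2 ^ m) V (x - y)) \<partial>\<mu>)" for m :: nat and x
  have [measurable]: "f m \<in> borel_measurable \<mu>" for m unfolding f_def by measurable
  \<comment> \<open>One function bounding all scales at once. Its integral is at most a convergent
    geometric series of ratio \<open>2 powr (s - w)\<close>, so it is finite almost
    everywhere.\<close>
  define h where "h x = (\<Sum>m. ennreal (2 powr (s * real m)) * f m x)" for x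
  have [measurable]: "h \<in> borel_measurable \<mu>" unfolding h_def by measurable
  have "(\<integral>\<^sup>+x. h x \<partial>\<mu>) = (\<Sum>m. ennreal (2 powr (s * real m)) * (\<integral>\<^sup>+x. f m x \<partial>\<mu>))"
    unfolding h_def by (subst nn_integral_suminf) (auto simp: nn_integral_cmult)
  also have "\<dots> \<le> (\<Sum>m. ennreal (D * (2 powr (s - w)) ^ m))"
  proof (intro suminf_le allI)
    fix m :: nat
    have "(\<integral>\<^sup>+x. f m x \<partial>\<mu>) \<le> ennreal (D * (1 / 2 ^ m) powr w)"
      unfolding f_def using energy[of "1 / 2 ^ m"] by simp
    then have "ennreal (2 powr (s * real m)) * (\<integral>\<^sup>+x. f m x \<partial>\<mu>)
      \<le> ennreal (2 powr (s * real m)) * ennreal (D * (1 / 2 ^ m) powr w)" by (intro mult_left_mono) auto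
    also have "\<dots> = ennreal (2 powr (s * real m) * (D * (1 / 2 ^ m) powr w))"
      using D by (intro ennreal_mult'[symmetric]) auto
    also have "(1 / 2 ^ m) powr w = 2 powr (- w * real m)"
    proof -
      have "(1 / 2 ^ m :: real) = 2 powr (- real m)"
        by (simp only: powr_minus powr_realpow zero_less_numeral inverse_eq_divide)
      then show ?thesis by (simp add: powr_powr mult.commute)
    qed
    also have "2 powr (s * real m) * (D * 2 powr (- w * real m)) = D * 2 powr ((s - w) * real m)"
      by (simp add: powr_add[symmetric] algebra_simps)
    also have "2 powr ((s - w) * real m) = (2 powr (s - w)) ^ m"
      by (simp add: powr_powr[symmetric] powr_realpow)
    finally show "ennreal (2 powr (s * real m)) * (\<integral>\<^sup>+x. f m x \<partial>\<mu>) \<le> ennreal (D * (2 powr (s - w)) ^ m)" .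
  qed auto
  also have "\<dots> = ennreal (\<Sum>m. D * (2 powr (s - w)) ^ m)"
    using s D by (intro suminf_ennreal2 summable_mult summable_geometric) (auto simp: powr_less_one)
  also have "\<dots> < \<infinity>" by simp
  finally have "AE x in \<mu>. h x \<noteq> \<infinity>" by (intro nn_integral_PInf_AE) auto
  define A where "A M = {x \<in> space \<mu>. orth_proj V x \<in> Y \<and> norm x \<le> R \<and> h x \<le> ennreal (real M)}" for M :: nat
  have "Y \<in> sets (restrict_space borel V)" using Y by (simp add: proj_measure_def)
  then have YB: "Y \<in> sets borel"
    using closed_subspace[OF subV] by (auto simp: sets_restrict_space_iff)
  note [measurable] = YB
  have A_meas [measurable]: "A M \<in> sets \<mu>" for M
    unfolding A_def by measurable
  have "\<exists>M. emeasure \<mu> (A M) \<noteq> 0"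
  proof (rule ccontr)
    assume "\<nexists>M. emeasure \<mu> (A M) \<noteq> 0"
    then have "(\<Union>M. A M) \<in> null_sets \<mu>" by (intro null_sets_UN) auto
    then have "AE x in \<mu>. x \<notin> (\<Union>M. A M)" by (rule AE_not_in)
    then have "AE x in \<mu>. orth_proj V x \<notin> Y"
      using supp \<open>AE x in \<mu>. h x \<noteq> \<infinity>\<close> AE_space
    proof eventually_elim
      case (elim x)
      obtain M :: nat where "h x \<le> ennreal (real M)"
        using elim(3) by (metis ennreal_cases ennreal_leI infinity_ennreal_def less_imp_le reals_Archimedean2)
      then show ?case using elim by (auto simp: A_def)
    qed
    then have "emeasure \<mu> (orth_proj V -` Y \<inter> space \<mu>) = 0"
      by (subst (asm) AE_iff_measurable[OF _ refl]) (auto simp: vimage_def Int_def conj_commute)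
    moreover have "emeasure (proj_measure V \<mu>) Y = emeasure \<mu> (orth_proj V -` Y \<inter> space \<mu>)"
      using Y measurable_orth_proj[OF subV] unfolding proj_measure_def
      by (intro emeasure_distr) (auto simp: measurable_cong_sets[OF sets refl])
    ultimately show False using Y by simp
  qed
  then obtain M0 where "emeasure \<mu> (A M0) \<noteq> 0" by blast
  \<comment> \<open>At least 1, so that the constant \<open>c\<close> below is positive.\<close>
  define M where "M = max 1 M0"
  have "A M0 \<subseteq> A M"
    unfolding A_def M_def by (auto intro: order_trans ennreal_leI)
  then have "emeasure \<mu> (A M0) \<le> emeasure \<mu> (A M)" by (intro emeasure_mono) auto
  then have AM: "emeasure \<mu> (A M) \<noteq> 0" using \<open>emeasure \<mu> (A M0) \<noteq> 0\<close> by auto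
  then have AM': "0 < measure \<mu> (A M)" by (simp add: emeasure_eq_measure zero_less_measure_iff)
  \<comment> \<open>A lower bound for the Gaussian on the slab: the scaled component along
    \<open>V\<close> has length at most 1, and the one across has length at most
    \<open>2 * R\<close>.\<close>
  define e where "e = exp (- pi * (1 + 4 * R\<^sup>2))"
  define c where "c = real M / e"
  have c: "0 < c" by (simp add: c_def e_def M_def)
  have ball: "measure \<mu> {y. norm y \<le> R \<and> norm (orth_proj V (x - y)) \<le> \<rho>} \<le> c * 2 powr (- s * real m)"
    if x: "x \<in> A M" and \<rho>: "\<rho> \<le> 1 / 2 ^ m" for x \<rho> and m :: nat
  proof -
    define S where "S = {y. norm y \<le> R \<and> norm (orth_proj V (x - y)) \<le> \<rho>}"
    have [measurable]: "S \<in> sets \<mu>" unfolding S_def sets by measurable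
    have "ennreal e * indicator S y \<le> ennreal (aniso_gaussian (2 ^ m) V (x - y))" for y
    proof (cases "y \<in> S")
      case True
      have "norm (x - y) \<le> 2 * R" using norm_triangle_ineq4[of x y] x True by (auto simp: A_def S_def)
      moreover have "norm (x - y - orth_proj V (x - y)) \<le> norm (x - y)"
        using norm_orth_proj_Pythagorean[OF subV, of "x - y"] by (simp add: power2_le_imp_le)
      ultimately have "(norm (x - y - orth_proj V (x - y)))\<^sup>2 \<le> (2 * R)\<^sup>2" by (intro power_mono) auto
      moreover have "norm (orth_proj V (x - y)) \<le> 1 / 2 ^ m" using True \<rho> by (simp add: S_def)
      then have "2 ^ m * norm (orth_proj V (x - y)) \<le> 1" by (simp add: pos_le_divide_eq mult.commute)
      then have "(2 ^ m * norm (orth_proj V (x - y)))\<^sup>2 \<le> 1" by (intro power_le_one) auto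
      ultimately have "pi * ((2 ^ m)\<^sup>2 * (norm (orth_proj V (x - y)))\<^sup>2 + (norm (x - y - orth_proj V (x - y)))\<^sup>2)
        \<le> pi * (1 + 4 * R\<^sup>2)"
        unfolding power_mult_distrib by (intro mult_left_mono) auto
      then have "e \<le> aniso_gaussian (2 ^ m) V (x - y)"
        unfolding e_def aniso_gaussian_def by (intro exp_mono) simp
      then show ?thesis using True by (simp add: ennreal_leI)
    qed simp
    then have "ennreal e * emeasure \<mu> S \<le> f m x"
      unfolding f_def by (subst nn_integral_cmult_indicator[symmetric]) (auto intro: nn_integral_mono)
    then have "ennreal (2 powr (s * real m)) * (ennreal e * emeasure \<mu> S) \<le> ennreal (2 powr (s * real m)) * f m x"
      by (intro mult_left_mono) auto
    also have "\<dots> \<le> h x"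
      unfolding h_def using sum_le_suminf[of "\<lambda>m. ennreal (2 powr (s * real m)) * f m x" "{m}"] by simp
    also have "\<dots> \<le> ennreal (real M)" using x by (simp add: A_def)
    finally have "ennreal (2 powr (s * real m) * (e * measure \<mu> S)) \<le> ennreal (real M)"
      by (simp add: emeasure_eq_measure ennreal_mult e_def)
    then have "2 powr (s * real m) * (e * measure \<mu> S) \<le> real M" by simp
    then have "measure \<mu> S \<le> c * 2 powr (- s * real m)"
      by (simp add: c_def e_def powr_minus field_simps)
    then show ?thesis by (simp add: S_def)
  qed
  define K where "K = c * 2 powr s"
  have K: "0 < K" using c by (simp add: K_def)
  \<comment> \<open>The covering sets are arbitrary and may be non-measurable, so each piece is
    enlarged to a measurable slab around one of its points.\<close>
  have piece: "\<exists>S\<in>sets \<mu>. A M \<inter> orth_proj V -` U \<subseteq> S \<and> emeasure \<mu> S \<le> ennreal K * diam_powr dist s U"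
    if U: "ediam dist U \<le> 1" for U :: "'a set"
  proof (cases "A M \<inter> orth_proj V -` U = {}")
    case False
    then obtain x where x: "x \<in> A M" "orth_proj V x \<in> U" by blast
    define \<rho> where "\<rho> = enn2real (ediam dist U)"
    define S where "S = {y. norm y \<le> R \<and> norm (orth_proj V (x - y)) \<le> \<rho>}"
    have S [measurable]: "S \<in> sets \<mu>" unfolding S_def sets by measurable
    have \<rho>: "0 \<le> \<rho>" "\<rho> \<le> 1" using enn2real_mono[OF U] by (auto simp: \<rho>_def)
    have bd: "measure \<mu> S \<le> c * 2 powr (- s * real m)" if "\<rho> \<le> 1 / 2 ^ m" for m :: nat
      using ball[OF x(1) that] by (simp add: S_def)
    have "A M \<inter> orth_proj V -` U \<subseteq> S"
    proof
      fix y assume y: "y \<in> A M \<inter> orth_proj V -` U"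
      then have "dist (orth_proj V x) (orth_proj V y) \<le> \<rho>"
        using ediam_finite_dist[OF U x(2)] by (simp add: \<rho>_def)
      then show "y \<in> S" using y by (simp add: S_def A_def dist_norm linear_diff[OF linear_orth_proj[OF subV]])
    qed
    moreover have "ennreal (measure \<mu> S) \<le> ennreal K * diam_powr dist s U"
    proof -
      consider "s = 0" | "0 < s" "\<rho> = 0" | "0 < s" "0 < \<rho>" using s \<rho> by linarith
      then show ?thesis
      proof cases
        case 1
        have "measure \<mu> S \<le> K" using bd[of 0] \<rho> 1 by (simp add: K_def)
        then show ?thesis using 1 x by (auto simp: diam_powr_def intro: ennreal_leI)
      next
        \<comment> \<open>A set of diameter 0 costs nothing for positive \<open>s\<close>, so its
          slab must be null; this follows by letting the scale tend to 0.\<close>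
        case 2
        have "(\<lambda>m. c * (2 powr (- s)) ^ m) \<longlonglongrightarrow> c * 0"
          using 2 by (intro tendsto_intros LIMSEQ_power_zero) (auto simp: powr_less_one)
        moreover have "measure \<mu> S \<le> c * (2 powr (- s)) ^ m" for m
        proof -
          have "2 powr (- s * real m) = (2 powr (- s)) ^ m"
            by (subst powr_powr[symmetric], subst powr_realpow) auto
          then show ?thesis using bd[of m] 2 by simp
        qed
        ultimately have "measure \<mu> S \<le> c * 0" by (intro LIMSEQ_le_const) auto
        then show ?thesis by (simp add: ennreal_neg)
      next
        case 3
        obtain m where m: "\<rho> \<le> 1 / 2 ^ m" "1 / 2 ^ m \<le> 2 * \<rho>" using small_scale_exists 3 \<rho> by metis
        have "measure \<mu> S \<le> c * 2 powr (- s * real m)" by (rule bd[OF m(1)])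
        also have "2 powr (- s * real m) = (1 / 2 ^ m) powr s"
        proof -
          have "(1 / 2 ^ m :: real) = 2 powr (- real m)"
            by (simp only: powr_minus powr_realpow zero_less_numeral inverse_eq_divide)
          then show ?thesis by (simp add: powr_powr mult.commute)
        qed
        also have "c * (1 / 2 ^ m) powr s \<le> c * (2 * \<rho>) powr s"
          using c m s by (intro mult_left_mono powr_mono2) auto
        also have "\<dots> = K * \<rho> powr s" using \<rho> by (simp add: K_def powr_mult)
        finally have "ennreal (measure \<mu> S) \<le> ennreal (K * \<rho> powr s)" by (rule ennreal_leI)
        also have "\<dots> = ennreal K * diam_powr dist s U"
          using 3 x K by (auto simp: diam_powr_def \<rho>_def ennreal_mult')
        finally show ?thesis .
      qed
    qed
    ultimately show ?thesis using S by (intro bexI[of _ S]) (auto simp: emeasure_eq_measure)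
  qed (auto intro: bexI[of _ "{}"])
  \<comment> \<open>A cover of \<open>Y\<close> of cost below this value makes
    \<open>measure \<mu> (A M)\<close> smaller than itself.\<close>
  define \<epsilon> where "\<epsilon> = measure \<mu> (A M) / K"
  have \<epsilon>: "0 < \<epsilon>" using AM' K by (simp add: \<epsilon>_def)
  obtain U where U: "Y \<subseteq> (\<Union>i. U i)" "\<And>i::nat. ediam dist (U i) \<le> ennreal 1"
    "(\<Sum>i. diam_powr dist s (U i)) < ennreal \<epsilon>"
    using hausdorff_measure_zeroD[OF s(3) zero_less_one \<epsilon>] by metis
  have "\<forall>i. \<exists>S\<in>sets \<mu>. A M \<inter> orth_proj V -` U i \<subseteq> S \<and> emeasure \<mu> S \<le> ennreal K * diam_powr dist s (U i)"
    using piece U(2) by simp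
  then obtain S where S: "\<And>i. S i \<in> sets \<mu>" "\<And>i. A M \<inter> orth_proj V -` U i \<subseteq> S i"
    "\<And>i. emeasure \<mu> (S i) \<le> ennreal K * diam_powr dist s (U i)"
    by metis
  have "A M \<subseteq> (\<Union>i. S i)"
  proof
    fix x assume x: "x \<in> A M"
    then have "orth_proj V x \<in> (\<Union>i. U i)" using U(1) by (auto simp: A_def)
    then show "x \<in> (\<Union>i. S i)" using x S(2) by blast
  qed
  then have "emeasure \<mu> (A M) \<le> emeasure \<mu> (\<Union>i. S i)" using S(1) by (intro emeasure_mono) auto
  also have "\<dots> \<le> (\<Sum>i. emeasure \<mu> (S i))" using S(1) by (intro emeasure_subadditive_countably) auto
  also have "\<dots> \<le> (\<Sum>i. ennreal K * diam_powr dist s (U i))" using S(3) by (intro suminf_le) auto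
  also have "\<dots> = ennreal K * (\<Sum>i. diam_powr dist s (U i))" by simp
  also have "\<dots> < ennreal K * ennreal \<epsilon>" using U(3) K by (intro ennreal_mult_strict_left_mono) auto
  also have "\<dots> = ennreal (measure \<mu> (A M))" using K \<epsilon> by (simp add: ennreal_mult'[symmetric] \<epsilon>_def)
  finally show False by (simp add: emeasure_eq_measure)
qed

section \<open>Counting bad cells\<close>

text \<open>Within a cell the matrix entries vary by \<open>1 / 2 ^ n\<close> while |z| < 2^n, so
  each defining equation of the plane changes by at most \<open>card B\<close> at \<open>z\<close>.
  The constant is such that \<open>c * (2 * card C * (1 + card B)\<^sup>2) = pi / 2\<close>, the
  exponent of \<open>tube\<close>.\<close>

lemma (in orthonormal_split) tube_cell_le:
  assumes V: "V \<in> cell n g" and z: "z \<in> annulus n" and "C \<noteq> {}"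
  defines "c \<equiv> pi / (4 * real (card C) * (1 + real (card B))\<^sup>2)"
  shows "tube V z \<le> exp (c * (2 * real (card C) * (real (card B))\<^sup>2))
    * exp (- c * (\<Sum>c\<in>C. (z \<bullet> c - (\<Sum>b\<in>B. real_of_int (g c b) / 2 ^ n * (z \<bullet> b)))\<^sup>2))"
proof -
  obtain L where L: "V = graph L" "\<And>c b. c \<in> C \<Longrightarrow> b \<in> B \<Longrightarrow> \<bar>L c b\<bar> \<le> 1"
    "\<And>c b. c \<in> C \<Longrightarrow> b \<in> B \<Longrightarrow> g c b = \<lfloor>2 ^ n * L c b\<rfloor>"
    using V by (auto simp: cell_def)
  define N where "N = norm (z - orth_proj V z)"
  define X where "X c = z \<bullet> c - (\<Sum>b\<in>B. real_of_int (g c b) / 2 ^ n * (z \<bullet> b))" for c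
  have C: "0 < real (card C)" using \<open>C \<noteq> {}\<close> finite_C by (simp add: card_gt_0_iff)
  have "(X c)\<^sup>2 \<le> 2 * ((1 + real (card B)) * N)\<^sup>2 + 2 * (real (card B))\<^sup>2" if c: "c \<in> C" for c
  proof -
    define Y where "Y = z \<bullet> c - (\<Sum>b\<in>B. L c b * (z \<bullet> b))"
    have Y: "\<bar>Y\<bar> \<le> (1 + real (card B)) * N"
      using abs_diff_graph_le[of L c z] L c by (simp add: Y_def N_def)
    have "X c - Y = (\<Sum>b\<in>B. (L c b - real_of_int (g c b) / 2 ^ n) * (z \<bullet> b))"
      by (simp add: X_def Y_def left_diff_distrib sum_subtractf)
    also have "\<bar>\<dots>\<bar> \<le> (\<Sum>b\<in>B. 1)"
    proof (intro order.trans[OF sum_abs] sum_mono)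
      fix b assume b: "b \<in> B"
      have "\<bar>L c b - real_of_int (g c b) / 2 ^ n\<bar> \<le> 1 / 2 ^ n"
        using L c b by (intro cell_close) auto
      moreover have "\<bar>z \<bullet> b\<bar> \<le> 2 ^ n" using inner_basis_le[of b z] b z by (simp add: annulus_def)
      ultimately have "\<bar>L c b - real_of_int (g c b) / 2 ^ n\<bar> * \<bar>z \<bullet> b\<bar> \<le> 1 / 2 ^ n * 2 ^ n"
        by (intro mult_mono) auto
      then show "\<bar>(L c b - real_of_int (g c b) / 2 ^ n) * (z \<bullet> b)\<bar> \<le> 1" by (simp add: abs_mult)
    qed
    finally have XY: "\<bar>X c - Y\<bar> \<le> real (card B)" by simp
    have "(X c)\<^sup>2 \<le> 2 * Y\<^sup>2 + 2 * (X c - Y)\<^sup>2"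
      using zero_le_power2[of "X c - 2 * Y"] by (simp add: power2_eq_square algebra_simps)
    moreover have "Y\<^sup>2 \<le> ((1 + real (card B)) * N)\<^sup>2" using power_mono[OF Y, of 2] by simp
    moreover have "(X c - Y)\<^sup>2 \<le> (real (card B))\<^sup>2" using power_mono[OF XY, of 2] by simp
    ultimately show ?thesis by linarith
  qed
  then have "(\<Sum>c\<in>C. (X c)\<^sup>2) \<le> (\<Sum>c\<in>C. 2 * ((1 + real (card B)) * N)\<^sup>2 + 2 * (real (card B))\<^sup>2)"
    by (rule sum_mono)
  also have "\<dots> = 2 * real (card C) * (1 + real (card B))\<^sup>2 * N\<^sup>2 + 2 * real (card C) * (real (card B))\<^sup>2"
    by (simp only: sum_constant power_mult_distrib) (simp add: algebra_simps)
  finally have "c * (\<Sum>c\<in>C. (X c)\<^sup>2)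
    \<le> c * (2 * real (card C) * (1 + real (card B))\<^sup>2 * N\<^sup>2 + 2 * real (card C) * (real (card B))\<^sup>2)"
    using C by (intro mult_left_mono) (auto simp: c_def)
  also have "\<dots> = c * (2 * real (card C) * (1 + real (card B))\<^sup>2) * N\<^sup>2 + c * (2 * real (card C) * (real (card B))\<^sup>2)"
    by (simp add: distrib_left mult.assoc)
  also have "c * (2 * real (card C) * (1 + real (card B))\<^sup>2) = pi / 2"
  proof -
    have "1 + real (card B) \<noteq> 0" by (simp add: add_nonneg_eq_0_iff)
    then show ?thesis using C by (simp add: c_def)
  qed
  finally show ?thesis
    unfolding tube_def exp_add[symmetric] X_def[symmetric] N_def[symmetric] by (intro exp_mono) simp
qed

text \<open>Splitting at height \<open>T\<close> takes the place of Hoelder's inequality. Above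
  \<open>T\<close> the factor \<open>(x\<^sup>2) powr (1 - 1 / \<theta>)\<close> has a nonpositive
  exponent and is largest at \<open>T\<close>.\<close>

lemma power_le_truncation:
  fixes x T \<theta> :: real
  assumes "0 \<le> x" "0 < T" "0 < \<theta>" "\<theta> \<le> 1"
  shows "x\<^sup>2 \<le> T + x powr (2 / \<theta>) * T powr (1 - 1 / \<theta>)"
proof (cases "x\<^sup>2 \<le> T")
  case True
  then show ?thesis by (simp add: add_increasing2)
next
  case False
  then have x: "0 < x\<^sup>2" "T \<le> x\<^sup>2" "0 < x" using assms by (auto simp: less_le)
  have e: "1 - 1 / \<theta> \<le> 0" using assms by simp
  have "x\<^sup>2 = (x\<^sup>2) powr (1 / \<theta>) * (x\<^sup>2) powr (1 - 1 / \<theta>)"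
    using x by (simp add: powr_add[symmetric])
  also have "\<dots> \<le> (x\<^sup>2) powr (1 / \<theta>) * T powr (1 - 1 / \<theta>)"
    using x assms e by (intro mult_left_mono powr_mono2') auto
  also have "(x\<^sup>2) powr (1 / \<theta>) = x powr (2 / \<theta>)"
  proof -
    have "x\<^sup>2 = x powr 2" using x by simp
    then show ?thesis by (simp only: powr_powr) simp
  qed
  finally show ?thesis using assms by simp
qed

text \<open>Since |z| lies between \<open>2 ^ n / 2\<close> and \<open>2 ^ n\<close>, the loss is at
  most \<open>2 powr \<bar>e\<bar>\<close> for either sign of \<open>e\<close>.\<close>

lemma powr_annulus_ge:
  assumes "z \<in> annulus n" "0 < n"
  shows "2 powr (- \<bar>e\<bar>) * 2 powr (real n * e) \<le> norm z powr e"
proof -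
  have z: "norm z < 2 ^ n" "2 ^ n \<le> 2 * norm z" using assms by (auto simp: annulus_def)
  have z0: "0 < norm z" by (rule order.strict_trans2[of _ "2 ^ n / 2"]) (use z in auto)
  have eq: "2 powr (real n * e) = (2 ^ n) powr e" by (simp add: powr_powr[symmetric] powr_realpow)
  show ?thesis
  proof (cases "0 \<le> e")
    case True
    have "(2 ^ n / 2) powr e \<le> norm z powr e" using z True by (intro powr_mono2) auto
    moreover have "(2 ^ n / 2) powr e = (2 ^ n) powr e / 2 powr e" by (simp only: powr_divide)
    moreover have "2 powr (- \<bar>e\<bar>) = inverse (2 powr e)" using True by (simp only: abs_of_nonneg powr_minus)
    ultimately show ?thesis unfolding eq by (simp only: divide_inverse mult.commute)
  next
    case False
    have "(2 ^ n) powr e \<le> norm z powr e" using z z0 False by (intro powr_mono2') auto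
    moreover have "2 powr (- \<bar>e\<bar>) * (2 ^ n) powr e \<le> 1 * (2 ^ n) powr e" 
      by (intro mult_right_mono) (simp_all add: powr_minus inverse_le_1_iff ge_one_powr_ge_zero)
    ultimately show ?thesis unfolding eq mult_1 by (rule order.trans[rotated])
  qed
qed

text \<open>Small values of the transform cannot account for a large tube energy, because the tube
  has volume at most \<open>W * (2 ^ n) ^ k\<close>; the large values must therefore carry a
  definite amount of 2/\<theta>-mass.\<close>

lemma tube_energy_large:
  fixes \<mu> :: "'a::euclidean_space measure"
  assumes fin: "finite_measure \<mu>" and sets: "sets \<mu> = sets borel"
    and V: "V \<in> grassmannian k" and \<theta>: "0 < \<theta>" "\<theta> \<le> 1" and W: "0 < W"
    and vol: "(\<integral>\<^sup>+z\<in>annulus n. ennreal (tube V z) \<partial>lborel) \<le> ennreal (W * (2 ^ n) ^ k)"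
    and large: "\<not> tube_energy \<mu> n V \<le> ennreal (2 powr (real n * (real k - u)))"
  shows "ennreal ((2 * W) powr (1 - 1 / \<theta>) / 2 * 2 powr (real n * (real k - u / \<theta>)))
    \<le> (\<integral>\<^sup>+z\<in>annulus n. ennreal (tube V z * norm (fourier \<mu> z) powr (2 / \<theta>)) \<partial>lborel)"
proof -
  have subV: "subspace V" using V by (simp add: grassmannian_def)
  note [measurable] = measurable_tube[OF subV] measurable_fourier[OF fin sets]
  define H where "H = 2 powr (real n * (real k - u))"
  \<comment> \<open>At this height the truncated part contributes at most
    \<open>T * W * (2 ^ n) ^ k = H / 2\<close>, half of the assumed lower bound.\<close>
  define T where "T = 2 powr (- real n * u) / (2 * W)"
  have T: "0 < T" using W by (simp add: T_def)
  define I where "I = (\<integral>\<^sup>+z\<in>annulus n. ennreal (tube V z * norm (fourier \<mu> z) powr (2 / \<theta>)) \<partial>lborel)"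
  have "tube_energy \<mu> n V \<le> (\<integral>\<^sup>+z. ennreal T * (ennreal (tube V z) * indicator (annulus n) z)
      + ennreal (T powr (1 - 1 / \<theta>)) * (ennreal (tube V z * norm (fourier \<mu> z) powr (2 / \<theta>)) * indicator (annulus n) z) \<partial>lborel)"
    unfolding tube_energy_def
  proof (intro nn_integral_mono)
    fix z :: 'a
    have "tube V z * (norm (fourier \<mu> z))\<^sup>2 \<le> tube V z * (T + norm (fourier \<mu> z) powr (2 / \<theta>) * T powr (1 - 1 / \<theta>))"
      using T \<theta> by (intro mult_left_mono power_le_truncation less_imp_le[OF tube_pos]) auto
    also have "\<dots> = T * tube V z + T powr (1 - 1 / \<theta>) * (tube V z * norm (fourier \<mu> z) powr (2 / \<theta>))"
      by (simp add: algebra_simps)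
    finally have "ennreal (tube V z * (norm (fourier \<mu> z))\<^sup>2)
      \<le> ennreal (T * tube V z + T powr (1 - 1 / \<theta>) * (tube V z * norm (fourier \<mu> z) powr (2 / \<theta>)))"
      by (rule ennreal_leI)
    also have "\<dots> = ennreal T * ennreal (tube V z) + ennreal (T powr (1 - 1 / \<theta>)) * ennreal (tube V z * norm (fourier \<mu> z) powr (2 / \<theta>))"
      using T tube_pos[of V z] by (simp add: ennreal_plus ennreal_mult' less_imp_le)
    finally show "ennreal (tube V z * (norm (fourier \<mu> z))\<^sup>2) * indicator (annulus n) z
      \<le> ennreal T * (ennreal (tube V z) * indicator (annulus n) z)
      + ennreal (T powr (1 - 1 / \<theta>)) * (ennreal (tube V z * norm (fourier \<mu> z) powr (2 / \<theta>)) * indicator (annulus n) z)"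
      by (simp split: split_indicator)
  qed
  also have "\<dots> = ennreal T * (\<integral>\<^sup>+z\<in>annulus n. ennreal (tube V z) \<partial>lborel) + ennreal (T powr (1 - 1 / \<theta>)) * I"
    unfolding I_def by (simp add: nn_integral_add nn_integral_cmult)
  also have "\<dots> \<le> ennreal T * ennreal (W * (2 ^ n) ^ k) + ennreal (T powr (1 - 1 / \<theta>)) * I"
    using vol by (intro add_right_mono mult_left_mono) auto
  also have "ennreal T * ennreal (W * (2 ^ n) ^ k) = ennreal (H / 2)"
  proof -
    have "(2 ^ n :: real) ^ k = 2 powr (real n * real k)"
      by (simp add: powr_powr[symmetric] powr_realpow)
    then have "T * (W * (2 ^ n) ^ k) = 2 powr (- real n * u) * 2 powr (real n * real k) / 2"
      using W by (simp add: T_def)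
    also have "2 powr (- real n * u) * 2 powr (real n * real k) = H"
      unfolding H_def powr_add[symmetric] by (simp add: algebra_simps)
    finally have "T * (W * (2 ^ n) ^ k) = H / 2" .
    then show ?thesis using T by (subst ennreal_mult'[symmetric]) (simp, simp only:)
  qed
  finally have le: "tube_energy \<mu> n V \<le> ennreal (H / 2) + ennreal (T powr (1 - 1 / \<theta>)) * I" .
  have "ennreal H < tube_energy \<mu> n V" using large by (simp add: H_def not_le)
  then have lt: "ennreal H < ennreal (H / 2) + ennreal (T powr (1 - 1 / \<theta>)) * I" using le by (rule less_le_trans)
  have "(2 * W) powr (1 - 1 / \<theta>) / 2 * 2 powr (real n * (real k - u / \<theta>)) = T powr (1 / \<theta> - 1) * (H / 2)"
  proof -
    have "T powr (1 / \<theta> - 1) = 2 powr (- real n * u * (1 / \<theta> - 1)) * (2 * W) powr (1 - 1 / \<theta>)"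
    proof -
      define e where "e = 1 / \<theta> - 1"
      have "T powr e = 2 powr (- real n * u * e) / (2 * W) powr e"
        by (simp only: T_def powr_divide powr_powr)
      also have "\<dots> = 2 powr (- real n * u * e) * (2 * W) powr (- e)"
        by (simp only: powr_minus divide_inverse)
      also have "- e = 1 - 1 / \<theta>" by (simp add: e_def)
      finally show ?thesis by (simp only: e_def)
    qed
    then have "T powr (1 / \<theta> - 1) * (H / 2) = (2 * W) powr (1 - 1 / \<theta>) / 2 * (2 powr (- real n * u * (1 / \<theta> - 1)) * 2 powr (real n * (real k - u)))"
      by (simp add: H_def)
    also have "2 powr (- real n * u * (1 / \<theta> - 1)) * 2 powr (real n * (real k - u)) = 2 powr (real n * (real k - u / \<theta>))"
      unfolding powr_add[symmetric] by (simp add: algebra_simps)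
    finally show ?thesis by simp
  qed
  moreover have "ennreal (T powr (1 / \<theta> - 1) * (H / 2)) \<le> I"
  proof (cases I)
    case (real i)
    then have "ennreal H < ennreal (H / 2 + T powr (1 - 1 / \<theta>) * i)"
      using lt T by (simp add: ennreal_mult'[symmetric] ennreal_plus[symmetric] H_def del: ennreal_plus)
    then have "H < H / 2 + T powr (1 - 1 / \<theta>) * i" by (simp add: ennreal_less_iff H_def)
    then have "T powr (1 / \<theta> - 1) * (H / 2) \<le> T powr (1 / \<theta> - 1) * (T powr (1 - 1 / \<theta>) * i)"
      by (intro mult_left_mono) auto
    also have "\<dots> = i" using T by (simp add: mult.assoc[symmetric] powr_add[symmetric])
    finally show ?thesis using real by (simp add: ennreal_leI)
  qed simp
  ultimately show ?thesis by (simp add: I_def)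
qed

text \<open>Chebyshev's inequality by double counting: every bad cell carries at least
  \<open>b\<close> of weighted 2/\<theta>-mass, while at each frequency the weights of all cells sum
  to at most a multiple of \<open>P\<close>, so the energy integral bounds the number of bad
  cells.\<close>

lemma count_bad_cells:
  fixes \<mu> :: "'a::euclidean_space measure"
  assumes fin: "finite_measure \<mu>" and sets: "sets \<mu> = sets borel"
    and BC: "orthonormal_split B C" "card B = k" "card C = DIM('a) - k" and k: "1 \<le> k" "k < DIM('a)"
    and \<theta>: "0 < \<theta>" "\<theta> \<le> 1" and energy: "energy s \<theta> \<mu> < \<infinity>"
  shows "\<exists>K. \<forall>n\<ge>1. real (card {g \<in> grid C B n. \<exists>V \<in> orthonormal_split.cell B C n g. V \<in> grassmannian k \<and>
        \<not> tube_energy \<mu> n V \<le> ennreal (2 powr (real n * (real k - u)))})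
      \<le> K * 2 powr (real n * (real k * (real DIM('a) - real k) + (u - s) / \<theta>))"
proof -
  interpret orthonormal_split B C by fact
  note [measurable] = measurable_fourier[OF fin sets]
  define d where "d = real DIM('a)"
  define F where "F z = norm (fourier \<mu> z) powr (2 / \<theta>)" for z
  have [measurable]: "F \<in> borel_measurable borel" unfolding F_def by measurable
  have F0: "0 \<le> F z" for z by (simp add: F_def)
  define J where "J = (\<integral>\<^sup>+z. ennreal (F z * norm z powr (s / \<theta> - d)) \<partial>lborel)"
  have "J < \<infinity>"
    using energy unfolding energy_def ennreal_powr_def J_def F_def d_def by (auto simp: top.not_eq_extremum split: if_splits)
  then obtain j where j: "0 \<le> j" "J = ennreal j" by (cases J) auto
  obtain W where W: "0 < W" "\<And>(V :: 'a set) n. V \<in> grassmannian k \<Longrightarrow>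
      (\<integral>\<^sup>+z\<in>annulus n. ennreal (tube V z) \<partial>lborel) \<le> ennreal (W * (2 ^ n) ^ k)"
    using nn_integral_tube_annulus_le by metis
  have C: "C \<noteq> {}" using BC(3) k by auto
  define c where "c = pi / (4 * real (card C) * (1 + real (card B))\<^sup>2)"
  have c: "0 < c"
  proof -
    have "0 < real (card C)" using BC(3) k by simp
    moreover have "0 < (1 + real (card B))\<^sup>2" by (simp add: add_nonneg_eq_0_iff)
    ultimately show ?thesis unfolding c_def by (intro divide_pos_pos mult_pos_pos) auto
  qed
  define E where "E = exp (c * (2 * real (card C) * (real (card B))\<^sup>2))"
  define G where "G n g z = exp (- c * (\<Sum>c\<in>C. (z \<bullet> c - (\<Sum>b\<in>B. real_of_int (g c b) / 2 ^ n * (z \<bullet> b)))\<^sup>2))" for n g z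
  have [measurable]: "G n g \<in> borel_measurable borel" for n g unfolding G_def by measurable
  obtain K where K: "K > 0" "\<And>a b n. (2 ^ n)\<^sup>2 / 4 \<le> (\<Sum>i\<in>B. (a i)\<^sup>2) + (\<Sum>j\<in>C. (b j)\<^sup>2) \<Longrightarrow>
    (\<Sum>g\<in>grid C B n. exp (- c * (\<Sum>j\<in>C. (b j - (\<Sum>i\<in>B. real_of_int (g j i) / 2 ^ n * a i))\<^sup>2)))
      \<le> K * (2 ^ n) ^ ((card B - 1) * card C)"
    using sum_gaussian_grid_bounded[OF c finite_B finite_C] by blast
  define c0 where "c0 = (2 * W) powr (1 - 1 / \<theta>) / 2"
  have c0: "0 < c0" using W by (simp add: c0_def)
  define e where "e = s / \<theta> - d"
  define K' where "K' = E * K * 2 powr \<bar>e\<bar> * j / c0"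
  have "real (card {g \<in> grid C B n. \<exists>V \<in> cell n g. V \<in> grassmannian k \<and>
        \<not> tube_energy \<mu> n V \<le> ennreal (2 powr (real n * (real k - u)))})
      \<le> K' * 2 powr (real n * (real k * (d - real k) + (u - s) / \<theta>))" if n: "1 \<le> n" for n
  proof -
    define Z where "Z = {g \<in> grid C B n. \<exists>V \<in> cell n g. V \<in> grassmannian k \<and>
        \<not> tube_energy \<mu> n V \<le> ennreal (2 powr (real n * (real k - u)))}"
    have Zsub: "Z \<subseteq> grid C B n" by (auto simp: Z_def)
    have fing: "finite (grid C B n)" by (rule finite_grid[OF finite_B finite_C])
    have finZ: "finite Z" using Zsub fing by (rule finite_subset)
    define b where "b = c0 * 2 powr (real n * (real k - u / \<theta>))"
    have b: "0 < b" using c0 by (simp add: b_def)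
    have each: "ennreal b \<le> (\<integral>\<^sup>+z\<in>annulus n. ennreal (E * G n g z * F z) \<partial>lborel)" if g: "g \<in> Z" for g
    proof -
      obtain V where V: "V \<in> cell n g" "V \<in> grassmannian k" 
        "\<not> tube_energy \<mu> n V \<le> ennreal (2 powr (real n * (real k - u)))"
        using g by (auto simp: Z_def)
      have "ennreal b \<le> (\<integral>\<^sup>+z\<in>annulus n. ennreal (tube V z * F z) \<partial>lborel)"
        unfolding b_def c0_def F_def
        by (rule tube_energy_large[OF fin sets V(2) \<theta> W(1) W(2)[OF V(2)] V(3)])
      also have "\<dots> \<le> (\<integral>\<^sup>+z\<in>annulus n. ennreal (E * G n g z * F z) \<partial>lborel)"
      proof (intro nn_integral_mono)
        fix z
        have "tube V z \<le> E * G n g z" if "z \<in> annulus n"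
          using tube_cell_le[OF V(1) that C] unfolding E_def G_def c_def .
        then show "ennreal (tube V z * F z) * indicator (annulus n) z \<le> ennreal (E * G n g z * F z) * indicator (annulus n) z"
          using F0[of z] by (auto split: split_indicator intro!: ennreal_leI mult_right_mono)
      qed
      finally show ?thesis .
    qed
    define P where "P = K * (2 ^ n) ^ ((k - 1) * card C)"
    have P: "0 < P" using K by (simp add: P_def)
    \<comment> \<open>The reciprocal of the lower bound for \<open>norm z powr e\<close> on the
      annulus: \<open>Q * norm z powr e\<close> is at least 1, so the energy weight can be
      inserted.\<close>
    define Q where "Q = 2 powr \<bar>e\<bar> * 2 powr (- real n * e)"
    have sumG: "(\<Sum>g\<in>Z. ennreal (E * G n g z * F z) * indicator (annulus n) z)
      \<le> ennreal (E * P * Q) * ennreal (F z * norm z powr e)" for z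
    proof (cases "z \<in> annulus n")
      case True
      have z: "2 ^ n \<le> 2 * norm z" using True n by (auto simp: annulus_def)
      have "(2 ^ n)\<^sup>2 \<le> (2 * norm z)\<^sup>2" using z by (intro power_mono) auto
      then have "(2 ^ n)\<^sup>2 / 4 \<le> (\<Sum>i\<in>B. (z \<bullet> i)\<^sup>2) + (\<Sum>j\<in>C. (z \<bullet> j)\<^sup>2)"
        unfolding norm_representation[symmetric] by (simp add: power_mult_distrib)
      from K(2)[OF this] have "(\<Sum>g\<in>grid C B n. G n g z) \<le> P"
        by (simp add: G_def P_def BC(2))
      moreover have "(\<Sum>g\<in>Z. G n g z) \<le> (\<Sum>g\<in>grid C B n. G n g z)"
        using fing Zsub by (intro sum_mono2) (auto simp: G_def)
      ultimately have GP: "(\<Sum>g\<in>Z. G n g z) \<le> P" by simp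
      have "1 \<le> Q * norm z powr e"
      proof -
        have "Q * (2 powr (- \<bar>e\<bar>) * 2 powr (real n * e)) \<le> Q * norm z powr e"
          using powr_annulus_ge[OF True, of e] n by (intro mult_left_mono) (auto simp: Q_def)
        moreover have "Q * (2 powr (- \<bar>e\<bar>) * 2 powr (real n * e)) = 2 powr (\<bar>e\<bar> + - real n * e + - \<bar>e\<bar> + real n * e)"
          unfolding Q_def powr_add by simp
        ultimately show ?thesis by simp
      qed
      have "(\<Sum>g\<in>Z. E * G n g z * F z) = E * F z * (\<Sum>g\<in>Z. G n g z)"
        by (simp add: sum_distrib_left ac_simps)
      also have "\<dots> \<le> E * F z * (P * (Q * norm z powr e))"
      proof (intro mult_left_mono)
        have "P * 1 \<le> P * (Q * norm z powr e)" using \<open>1 \<le> Q * norm z powr e\<close> P by (intro mult_left_mono) auto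
        then show "(\<Sum>g\<in>Z. G n g z) \<le> P * (Q * norm z powr e)" using GP by simp
      qed (use F0 in \<open>auto simp: E_def\<close>)
      finally have "(\<Sum>g\<in>Z. E * G n g z * F z) \<le> (E * P * Q) * (F z * norm z powr e)" by (simp add: ac_simps)
      then have "ennreal (\<Sum>g\<in>Z. E * G n g z * F z) \<le> ennreal ((E * P * Q) * (F z * norm z powr e))" by (rule ennreal_leI)
      then show ?thesis using True F0 P
        by (simp add: sum_ennreal[symmetric] E_def G_def Q_def ennreal_mult' del: sum_ennreal)
    qed simp
    have "ennreal (real (card Z) * b) = (\<Sum>g\<in>Z. ennreal b)"
      using b by (simp add: ennreal_mult'' ennreal_of_nat_eq_real_of_nat)
    also have "\<dots> \<le> (\<Sum>g\<in>Z. \<integral>\<^sup>+z\<in>annulus n. ennreal (E * G n g z * F z) \<partial>lborel)"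
      by (intro sum_mono each)
    also have "\<dots> = (\<integral>\<^sup>+z. (\<Sum>g\<in>Z. ennreal (E * G n g z * F z) * indicator (annulus n) z) \<partial>lborel)"
      by (rule nn_integral_sum[symmetric]) simp
    also have "\<dots> \<le> (\<integral>\<^sup>+z. ennreal (E * P * Q) * ennreal (F z * norm z powr e) \<partial>lborel)"
      by (intro nn_integral_mono sumG)
    also have "\<dots> = ennreal (E * P * Q) * J"
      unfolding J_def e_def by (rule nn_integral_cmult) simp
    also have "\<dots> = ennreal (E * P * Q * j)"
      using j P by (simp add: ennreal_mult'' E_def Q_def)
    finally have "real (card Z) * b \<le> E * P * Q * j"
      using j P by (subst (asm) ennreal_le_iff) (auto simp: E_def Q_def)
    then have "real (card Z) \<le> E * P * Q * j / b" using b by (simp add: pos_le_divide_eq)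
    also have "\<dots> = K' * ((2 ^ n) ^ ((k - 1) * card C) * 2 powr (- real n * e) / 2 powr (real n * (real k - u / \<theta>)))"
      by (simp add: K'_def P_def Q_def b_def)
    also have "(2 ^ n :: real) ^ ((k - 1) * card C) = 2 powr (real n * (real (k - 1) * real (card C)))"
      by (simp add: powr_powr[symmetric] powr_realpow power_mult)
    also have "2 powr (real n * (real (k - 1) * real (card C))) * 2 powr (- real n * e) / 2 powr (real n * (real k - u / \<theta>))
      = 2 powr (real n * (real (k - 1) * real (card C)) + - real n * e - real n * (real k - u / \<theta>))"
      by (simp only: powr_add powr_diff)
    also have "real n * (real (k - 1) * real (card C)) + - real n * e - real n * (real k - u / \<theta>)
      = real n * (real k * (d - real k) + (u - s) / \<theta>)"
      using k by (simp add: BC(3) d_def e_def of_nat_diff algebra_simps diff_divide_distrib)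
    finally show ?thesis by (simp add: Z_def)
  qed
  then show ?thesis unfolding d_def by blast
qed

section \<open>Exceptional projections\<close>

lemma measure_hausdorff_dim_nonneg: "0 \<le> measure_hausdorff_dim \<nu>"
  unfolding measure_hausdorff_dim_def by (intro Inf_greatest) (auto simp: hausdorff_dim_nonneg)

text \<open>It remains to see that a plane in the set is bad at infinitely many scales. If it were
  good from scale \<open>m\<close> on, the energy estimate would give projected dimension at least
  some \<open>w\<close> strictly above its actual value.\<close>

lemma exceptional_directions_null:
  fixes \<mu> :: "'a::euclidean_space measure"
  assumes fin: "finite_measure \<mu>" and sets: "sets \<mu> = sets borel"
    and supp: "AE x in \<mu>. norm x \<le> R" and k: "1 \<le> k" "k < DIM('a)" and u: "u \<le> real k"
    and \<theta>: "0 < \<theta>" "\<theta> \<le> 1" and energy: "energy s \<theta> \<mu> < \<infinity>"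
    and t: "0 < t" "real k * (real DIM('a) - real k) + (u - s) / \<theta> < t"
  shows "hausdorff_measure grassmann_dist t
    {V \<in> grassmannian k. measure_hausdorff_dim (proj_measure V \<mu>) < ereal u} = 0"
proof (rule hausdorff_measure_grassmannian_zero[where
      bad = "\<lambda>n V. \<not> tube_energy \<mu> n V \<le> ennreal (2 powr (real n * (real k - u)))"])
  show "\<exists>K. \<forall>n\<ge>1. real (card {g \<in> grid C B n. \<exists>V \<in> orthonormal_split.cell B C n g. V \<in> grassmannian k \<and>
        \<not> tube_energy \<mu> n V \<le> ennreal (2 powr (real n * (real k - u)))})
      \<le> K * 2 powr (real n * (real k * (real DIM('a) - real k) + (u - s) / \<theta>))"
    if "orthonormal_split B C" "card B = k" "card C = DIM('a) - k" for B C :: "'a set"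
    using that by (rule count_bad_cells[OF fin sets _ _ _ k \<theta> energy])
next
  fix V :: "'a set" and m
  assume "V \<in> {V \<in> grassmannian k. measure_hausdorff_dim (proj_measure V \<mu>) < ereal u}"
  then have V: "V \<in> grassmannian k" and dim: "measure_hausdorff_dim (proj_measure V \<mu>) < ereal u" by auto
  show "\<exists>n\<ge>m. \<not> tube_energy \<mu> n V \<le> ennreal (2 powr (real n * (real k - u)))"
  proof (rule ccontr)
    assume "\<nexists>n. m \<le> n \<and> \<not> tube_energy \<mu> n V \<le> ennreal (2 powr (real n * (real k - u)))"
    then have good: "tube_energy \<mu> n V \<le> ennreal (2 powr (real n * (real k - u)))" if "m \<le> n" for n
      using that by blast
    \<comment> \<open>A value strictly below \<open>u\<close> is needed for the series over the
      scales to converge.\<close>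
    obtain w where w: "measure_hausdorff_dim (proj_measure V \<mu>) < ereal w" "w < u"
      using ereal_dense2[OF dim] by auto
    have w0: "0 \<le> w"
      using le_less_trans[OF measure_hausdorff_dim_nonneg w(1)] by simp
    obtain W where W: "0 < W" "\<And>(V :: 'a set) n. V \<in> grassmannian k \<Longrightarrow>
      (\<integral>\<^sup>+z\<in>annulus n. ennreal (tube V z) \<partial>lborel) \<le> ennreal (W * (2 ^ n) ^ k)"
      using nn_integral_tube_annulus_le by metis
    have subV: "subspace V" using V by (simp add: grassmannian_def)
    note [measurable] = measurable_tube[OF subV]
    define M where "M = (measure \<mu> (space \<mu>))\<^sup>2"
    have M: "0 \<le> M" by (simp add: M_def)
    \<comment> \<open>Absorbs the finitely many scales below \<open>m\<close>, where the transform
      is bounded by the total mass and the tube by its volume.\<close>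
    define K where "K = 1 + M * (W * (2 ^ m) ^ k)"
    have K: "1 \<le> K" using M W by (simp add: K_def)
    have "tube_energy \<mu> n V \<le> ennreal (K * 2 powr (real n * (real k - u)))" for n
    proof (cases "m \<le> n")
      case True
      have "1 * 2 powr (real n * (real k - u)) \<le> K * 2 powr (real n * (real k - u))"
        using K by (intro mult_right_mono) auto
      then show ?thesis using good[OF True] by (simp add: order_trans ennreal_leI)
    next
      case False
      have "tube_energy \<mu> n V \<le> (\<integral>\<^sup>+z. ennreal M * (ennreal (tube V z) * indicator (annulus n) z) \<partial>lborel)"
        unfolding tube_energy_def
      proof (intro nn_integral_mono)
        fix z
        have "(norm (fourier \<mu> z))\<^sup>2 \<le> M"
          unfolding M_def by (intro power_mono norm_fourier_le fin sets) auto
        then have "tube V z * (norm (fourier \<mu> z))\<^sup>2 \<le> M * tube V z"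
          using tube_pos[of V z] by (subst mult.commute) (intro mult_right_mono, auto)
        then show "ennreal (tube V z * (norm (fourier \<mu> z))\<^sup>2) * indicator (annulus n) z
          \<le> ennreal M * (ennreal (tube V z) * indicator (annulus n) z)"
          using M by (auto simp: ennreal_mult'[symmetric] ennreal_leI split: split_indicator)
      qed
      also have "\<dots> = ennreal M * (\<integral>\<^sup>+z\<in>annulus n. ennreal (tube V z) \<partial>lborel)"
        by (rule nn_integral_cmult) simp
      also have "\<dots> \<le> ennreal M * ennreal (W * (2 ^ n) ^ k)" by (intro mult_left_mono W V) auto
      also have "\<dots> = ennreal (M * (W * (2 ^ n) ^ k))" using M by (intro ennreal_mult'[symmetric]) auto
      also have "\<dots> \<le> ennreal (K * 2 powr (real n * (real k - u)))"
      proof (rule ennreal_leI)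
        have "(2 ^ n :: real) \<le> 2 ^ m" using False by (intro power_increasing) auto
        then have "M * (W * (2 ^ n) ^ k) \<le> M * (W * (2 ^ m) ^ k)"
          using M W by (intro mult_left_mono power_mono) auto
        also have "\<dots> \<le> K * 1" by (simp add: K_def)
        also have "\<dots> \<le> K * 2 powr (real n * (real k - u))"
          using K u by (intro mult_left_mono) (auto intro: ge_one_powr_ge_zero)
        finally show "M * (W * (2 ^ n) ^ k) \<le> K * 2 powr (real n * (real k - u))" .
      qed
      finally show ?thesis .
    qed
    then obtain D where "0 \<le> D" "\<And>r. 0 < r \<Longrightarrow> r \<le> 1 \<Longrightarrow>
      (\<integral>\<^sup>+x. \<integral>\<^sup>+y. ennreal (aniso_gaussian (1/r) V (x - y)) \<partial>\<mu> \<partial>\<mu>) \<le> ennreal (D * r powr w)"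
      using gaussian_energy_le[OF fin sets V w0 w(2) u, of K] K by auto
    then have "ereal w \<le> measure_hausdorff_dim (proj_measure V \<mu>)"
      by (rule measure_hausdorff_dim_ge[OF fin sets supp V])
    then show False using w(1) by simp
  qed
qed (use k t in auto)

section \<open>Compactly supported measures and their projections\<close>

lemma null_complement_msupport:
  fixes \<mu> :: "'a::euclidean_space measure"
  assumes sets: "sets \<mu> = sets borel"
  shows "emeasure \<mu> (- msupport \<mu>) = 0"
proof -
  define \<F> where "\<F> = {U. open U \<and> emeasure \<mu> U = 0}"
  \<comment> \<open>The complement of the support is a possibly uncountable union of open null sets;
    by Lindelof's theorem countably many of them have the same union.\<close>
  obtain \<F>' where F': "\<F>' \<subseteq> \<F>" "countable \<F>'" "\<Union>\<F>' = \<Union>\<F>"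
    using Lindelof[of \<F>] by (auto simp: \<F>_def)
  have "- msupport \<mu> = \<Union>\<F>"
  proof (intro equalityI subsetI)
    fix x assume "x \<in> - msupport \<mu>"
    then obtain F where "closed F" "emeasure \<mu> (- F) = 0" "x \<in> - F" by (auto simp: msupport_def)
    then show "x \<in> \<Union>\<F>" unfolding \<F>_def by (intro UnionI[of "- F"]) auto
  next
    fix x assume "x \<in> \<Union>\<F>"
    then obtain U where "open U" "emeasure \<mu> U = 0" "x \<in> U" by (auto simp: \<F>_def)
    then show "x \<in> - msupport \<mu>" unfolding msupport_def by (auto intro!: exI[of _ "- U"])
  qed
  moreover have "\<Union>\<F>' \<in> null_sets \<mu>"
    using F' by (intro null_sets_UN'[of \<F>' "\<lambda>U. U", simplified]) (auto simp: \<F>_def sets null_sets_def)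
  ultimately show ?thesis using F'(3) by auto
qed

lemma compact_measuresD:
  fixes \<mu> :: "'a::euclidean_space measure"
  assumes "\<mu> \<in> compact_measures X"
  shows "finite_measure \<mu>" "sets \<mu> = sets borel" "0 < emeasure \<mu> (msupport \<mu>)"
    "\<exists>R. AE x in \<mu>. norm x \<le> R" "compact (msupport \<mu>)" "msupport \<mu> \<subseteq> X"
proof -
  show sets: "sets \<mu> = sets borel" and cpt: "compact (msupport \<mu>)" and sub: "msupport \<mu> \<subseteq> X"
    using assms by (auto simp: compact_measures_def)
  have X: "0 < emeasure \<mu> X" "emeasure \<mu> X < \<infinity>" using assms by (auto simp: compact_measures_def)
  \<comment> \<open>A set outside the \<sigma>-algebra has \<open>emeasure\<close> 0 by convention,
    so positive mass makes \<open>X\<close> measurable.\<close>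
  have Xm: "X \<in> sets \<mu>" using X(1) emeasure_notin_sets[of X \<mu>] by force
  have space: "space \<mu> = UNIV" using sets_eq_imp_space_eq[OF sets] by simp
  have Sm: "msupport \<mu> \<in> sets \<mu>" using cpt by (simp add: sets borel_compact)
  have null: "- msupport \<mu> \<in> null_sets \<mu>"
    using null_complement_msupport[OF sets] Sm by (auto simp: null_sets_def sets)
  have eq: "emeasure \<mu> (space \<mu>) = emeasure \<mu> (msupport \<mu>)"
    using emeasure_Un_null_set[OF Sm null] by (simp add: space)
  also have "\<dots> \<le> emeasure \<mu> X" using sub Xm by (intro emeasure_mono) auto
  finally show "finite_measure \<mu>" using X by (intro finite_measureI) auto
  have "emeasure \<mu> X \<le> emeasure \<mu> (space \<mu>)" using Xm by (rule emeasure_mono[OF sets.sets_into_space sets.top])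
  then show "0 < emeasure \<mu> (msupport \<mu>)" using X eq by simp
  obtain R where "\<And>x. x \<in> msupport \<mu> \<Longrightarrow> norm x \<le> R"
    using compact_imp_bounded[OF cpt] by (auto simp: bounded_iff)
  then show "\<exists>R. AE x in \<mu>. norm x \<le> R"
    using AE_not_in[OF null] by (intro exI[of _ R]) auto
qed

text \<open>The projection of \<open>X\<close> may fail to be Borel, so the test set is the
  projection of the support: it is compact, has positive projected measure and lies in the
  projection of \<open>X\<close>.\<close>

lemma measure_hausdorff_dim_proj_le:
  fixes \<mu> :: "'a::euclidean_space measure"
  assumes \<mu>: "\<mu> \<in> compact_measures X" and V: "V \<in> grassmannian k"
  shows "measure_hausdorff_dim (proj_measure V \<mu>) \<le> hausdorff_dim dist (orth_proj V ` X)"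
proof -
  note D = compact_measuresD[OF \<mu>]
  have subV: "subspace V" using V by (simp add: grassmannian_def)
  have space: "space \<mu> = UNIV" using sets_eq_imp_space_eq[OF D(2)] by simp
  define Y where "Y = orth_proj V ` msupport \<mu>"
  have "compact Y"
    unfolding Y_def by (intro compact_continuous_image D(5) linear_continuous_on bounded_linear_orth_proj subV)
  moreover have "Y \<subseteq> V" unfolding Y_def using orth_proj_in[OF subV] by blast
  ultimately have Y: "Y \<in> sets (restrict_space borel V)"
    using closed_subspace[OF subV] by (auto simp: sets_restrict_space_iff borel_compact)
  have meas: "orth_proj V \<in> \<mu> \<rightarrow>\<^sub>M restrict_space borel V"
    using measurable_orth_proj[OF subV] by (simp add: measurable_cong_sets[OF D(2) refl])
  have "emeasure \<mu> (msupport \<mu>) \<le> emeasure \<mu> (orth_proj V -` Y \<inter> space \<mu>)"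
    using measurable_sets[OF meas Y] by (intro emeasure_mono) (auto simp: Y_def space)
  also have "\<dots> = emeasure (proj_measure V \<mu>) Y"
    unfolding proj_measure_def by (rule emeasure_distr[OF meas Y, symmetric])
  finally have "0 < emeasure (proj_measure V \<mu>) Y" using D(3) by simp
  then have "measure_hausdorff_dim (proj_measure V \<mu>) \<le> hausdorff_dim dist Y"
    unfolding measure_hausdorff_dim_def using Y by (intro Inf_lower) (auto simp: proj_measure_def)
  also have "\<dots> \<le> hausdorff_dim dist (orth_proj V ` X)"
    unfolding Y_def using D(6) by (intro hausdorff_dim_mono image_mono)
  finally show ?thesis .
qed

text \<open>When \<open>D\<close> is a positive real \<open>r\<close>, the inequality at a fixed
  \<theta> is equivalent to \<open>\<sigma> \<le> u - (r - a) * \<theta>\<close>. In this form it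
  passes to the supremum over \<sigma>, and infinite values of \<sigma> need no separate
  treatment.\<close>

lemma ereal_le_INF_Sup0:
  fixes D :: ereal and a u :: real
  assumes Da: "D \<le> ereal a" and u: "0 \<le> u"
    and le: "\<And>\<theta> \<sigma>. \<theta> \<in> {0<..1} \<Longrightarrow> \<sigma> \<in> S \<theta> \<Longrightarrow> D \<le> max 0 (ereal a + (ereal u - \<sigma>) / ereal \<theta>)"
  shows "D \<le> max 0 (ereal a + (INF \<theta>\<in>{0<..1::real}. (ereal u - Sup0 (S \<theta>)) / ereal \<theta>))"
proof (cases "D \<le> 0")
  case True
  then show ?thesis by (simp add: le_max_iff_disj)
next
  case False
  then obtain r where r: "D = ereal r" "0 < r" using Da by (cases D) auto
  have shift: "ereal r \<le> ereal a + x \<longleftrightarrow> ereal (r - a) \<le> x" for x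
    by (cases x) auto
  have "ereal (r - a) \<le> (INF \<theta>\<in>{0<..1::real}. (ereal u - Sup0 (S \<theta>)) / ereal \<theta>)"
  proof (rule INF_greatest)
    fix \<theta> :: real assume \<theta>: "\<theta> \<in> {0<..1}"
    then have \<theta>0: "0 < \<theta>" by simp
    have iff: "ereal (r - a) \<le> (ereal u - \<sigma>) / ereal \<theta> \<longleftrightarrow> \<sigma> \<le> ereal (u - (r - a) * \<theta>)" for \<sigma>
      using \<theta>0 by (cases \<sigma>) (auto simp: field_simps)
    have "Sup0 (S \<theta>) \<le> ereal (u - (r - a) * \<theta>)"
    proof (cases "S \<theta> = {}")
      case True
      \<comment> \<open>With no admissible value \<open>Sup0\<close> is 0, and
        \<open>0 \<le> u - (r - a) * \<theta>\<close> holds by \<open>D \<le> a\<close> and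
        \<open>0 \<le> u\<close>.\<close>
      have "(r - a) * \<theta> \<le> 0" using Da r \<theta>0 by (intro mult_nonpos_nonneg) auto
      then show ?thesis using True u by (simp add: Sup0_def zero_ereal_def)
    next
      case False
      have "\<sigma> \<le> ereal (u - (r - a) * \<theta>)" if "\<sigma> \<in> S \<theta>" for \<sigma>
      proof -
        have "ereal r \<le> ereal a + (ereal u - \<sigma>) / ereal \<theta>"
          using le[OF \<theta> that] r by (auto simp: le_max_iff_disj)
        then show ?thesis by (simp only: shift iff)
      qed
      then show ?thesis using False by (auto simp: Sup0_def intro: Sup_least)
    qed
    then show "ereal (r - a) \<le> (ereal u - Sup0 (S \<theta>)) / ereal \<theta>" by (simp only: iff)
  qed
  then show ?thesis using r by (simp add: shift[symmetric] le_max_iff_disj)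
qed

lemma exceptional_directions_measure:
  fixes \<mu> :: "'a::euclidean_space measure"
  assumes k: "1 \<le> k" "k < DIM('a)" and \<mu>: "\<mu> \<in> compact_measures X" and u: "0 \<le> u" "u \<le> real k"
  shows "hausdorff_dim grassmann_dist
      {V \<in> grassmannian k. measure_hausdorff_dim (proj_measure V \<mu>) < ereal u}
    \<le> max 0 (ereal (real k * (real DIM('a) - real k)) +
        (INF \<theta>\<in>{0<..1::real}. (ereal u - fourier_spectrum \<theta> \<mu>) / ereal \<theta>))"
  unfolding fourier_spectrum_def
proof (rule ereal_le_INF_Sup0[OF _ u(1)])
  let ?E = "{V \<in> grassmannian k. measure_hausdorff_dim (proj_measure V \<mu>) < ereal u}"
  show "hausdorff_dim grassmann_dist ?E \<le> ereal (real k * (real DIM('a) - real k))"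
    using k by (intro hausdorff_dim_grassmannian_le) auto
  fix \<theta> :: real and \<sigma> assume \<theta>: "\<theta> \<in> {0<..1}" and "\<sigma> \<in> {ereal s |s. energy s \<theta> \<mu> < \<infinity>}"
  then obtain s where s: "\<sigma> = ereal s" "energy s \<theta> \<mu> < \<infinity>" by auto
  obtain R where R: "AE x in \<mu>. norm x \<le> R" using compact_measuresD(4)[OF \<mu>] by blast
  define b where "b = real k * (real DIM('a) - real k) + (u - s) / \<theta>"
  \<comment> \<open>The null set lemma asks for an exponent that is positive and strictly above
    \<open>b\<close>, hence the slack \<open>e\<close>.\<close>
  have "hausdorff_dim grassmann_dist ?E \<le> ereal (max 0 b) + ereal e" if "0 < e" for e
  proof -
    have "hausdorff_measure grassmann_dist (max 0 b + e) ?E = 0"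
      using \<theta> that unfolding b_def
      by (intro exceptional_directions_null[OF compact_measuresD(1,2)[OF \<mu>] R k u(2) _ _ s(2)]) auto
    then have "hausdorff_dim grassmann_dist ?E \<le> ereal (max 0 b + e)"
      using that by (intro hausdorff_dim_le) auto
    then show ?thesis by (simp only: plus_ereal.simps)
  qed
  then have "hausdorff_dim grassmann_dist ?E \<le> ereal (max 0 b)" by (rule ereal_le_epsilon2)
  also have "ereal (max 0 b) = max 0 (ereal (real k * (real DIM('a) - real k)) + (ereal u - \<sigma>) / ereal \<theta>)"
    using \<theta> by (simp add: s b_def zero_ereal_def)
  finally show "hausdorff_dim grassmann_dist ?E
    \<le> max 0 (ereal (real k * (real DIM('a) - real k)) + (ereal u - \<sigma>) / ereal \<theta>)" .
qed

text \<open>For each measure on \<open>X\<close> the exceptional planes of \<open>X\<close> are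
  exceptional for the measure as well, since its projections have no larger dimension. Capping the
  spectrum at the ambient dimension only weakens the resulting bound.\<close>

lemma exceptional_directions_set:
  fixes X :: "'a::euclidean_space set"
  assumes k: "1 \<le> k" "k < DIM('a)" and u: "0 \<le> u" "u \<le> real k"
  shows "hausdorff_dim grassmann_dist
      {V \<in> grassmannian k. hausdorff_dim dist (orth_proj V ` X) < ereal u}
    \<le> max 0 (ereal (real k * (real DIM('a) - real k)) +
        (INF \<theta>\<in>{0<..1::real}. (ereal u - fourier_spectrum_set \<theta> X) / ereal \<theta>))"
  unfolding fourier_spectrum_set_def
proof (rule ereal_le_INF_Sup0[OF _ u(1)])
  let ?E = "{V \<in> grassmannian k. hausdorff_dim dist (orth_proj V ` X) < ereal u}"
  let ?a = "ereal (real k * (real DIM('a) - real k))"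
  show "hausdorff_dim grassmann_dist ?E \<le> ?a"
    using k by (intro hausdorff_dim_grassmannian_le) auto
  fix \<theta> :: real and \<sigma> assume \<theta>: "\<theta> \<in> {0<..1}"
    and "\<sigma> \<in> {min (fourier_spectrum \<theta> \<mu>) (ereal (real DIM('a))) |\<mu>. \<mu> \<in> compact_measures X}"
  then obtain \<mu> where \<mu>: "\<mu> \<in> compact_measures X" "\<sigma> = min (fourier_spectrum \<theta> \<mu>) (ereal (real DIM('a)))"
    by auto
  have "hausdorff_dim grassmann_dist ?E
    \<le> hausdorff_dim grassmann_dist {V \<in> grassmannian k. measure_hausdorff_dim (proj_measure V \<mu>) < ereal u}"
    by (intro hausdorff_dim_mono) (auto intro: le_less_trans[OF measure_hausdorff_dim_proj_le[OF \<mu>(1)]])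
  also have "\<dots> \<le> max 0 (?a + (INF \<theta>\<in>{0<..1::real}. (ereal u - fourier_spectrum \<theta> \<mu>) / ereal \<theta>))"
    by (rule exceptional_directions_measure[OF k \<mu>(1) u])
  also have "\<dots> \<le> max 0 (?a + (ereal u - \<sigma>) / ereal \<theta>)"
  proof (intro max.mono order_refl add_left_mono)
    have "(INF \<theta>\<in>{0<..1::real}. (ereal u - fourier_spectrum \<theta> \<mu>) / ereal \<theta>)
      \<le> (ereal u - fourier_spectrum \<theta> \<mu>) / ereal \<theta>"
      using \<theta> by (intro INF_lower) auto
    also have "\<dots> \<le> (ereal u - \<sigma>) / ereal \<theta>"
      using \<theta> \<mu>(2) by (intro ereal_divide_right_mono ereal_minus_mono) auto
    finally show "(INF \<theta>\<in>{0<..1::real}. (ereal u - fourier_spectrum \<theta> \<mu>) / ereal \<theta>)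
      \<le> (ereal u - \<sigma>) / ereal \<theta>" .
  qed
  finally show "hausdorff_dim grassmann_dist ?E \<le> max 0 (?a + (ereal u - \<sigma>) / ereal \<theta>)" .
qed

theorem corollary6p1:
  fixes k :: nat
  assumes "1 \<le> k" and "k < CARD('n::finite)"
  shows
    "(\<forall>\<mu> \<in> compact_measures (UNIV :: (real ^ 'n) set). \<forall>u \<in> {0..real k}.
        hausdorff_dim grassmann_dist
          {V \<in> grassmannian k. measure_hausdorff_dim (proj_measure V \<mu>) < ereal u}
        \<le> max 0 (ereal (real k * (real CARD('n) - real k)) +
                  (INF \<theta>\<in>{0<..1::real}. (ereal u - fourier_spectrum \<theta> \<mu>) / ereal \<theta>)))
     \<and>
     (\<forall>X \<in> sets (borel :: (real ^ 'n) measure). \<forall>u \<in> {0..real k}.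
        hausdorff_dim grassmann_dist
          {V \<in> grassmannian k. hausdorff_dim dist (orth_proj V ` X) < ereal u}
        \<le> max 0 (ereal (real k * (real CARD('n) - real k)) +
                  (INF \<theta>\<in>{0<..1::real}. (ereal u - fourier_spectrum_set \<theta> X) / ereal \<theta>)))"
proof -
  have k: "1 \<le> k" "k < DIM(real ^ 'n)" using assms by auto
  have "DIM(real ^ 'n) = CARD('n)" by simp
  then show ?thesis
    using exceptional_directions_measure[OF k, where X = UNIV] exceptional_directions_set[OF k] by auto
qed

end
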